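(* Let $n\ge 2$, let $P=T_1\times\cdots\times T_n$ be a product of $n$ totally ordered sets with the product order, and let $M$ be a pointwise finite-dimensional persistence module over $P$ with values in vector spaces over a field $\mathbf{k}$. Then $M$ is block-decomposable if and only if $M$ is $k$-middle exact for all $2\le k\le n$.
   Context: A persistence module over a poset $Q$ is a functor from $Q$ to $\mathbf{k}$-vector spaces; it is pointwise finite-dimensional if $\dim M(q)<\infty$ for all $q$. An interval of a poset is a non-empty convex and connected (via finite zig-zags of relations inside it) subset $I$; the interval module $\mathbf{k}_I$ is $\mathbf{k}$ on $I$, $0$ elsewhere, with identity maps between points of $I$ and zero maps otherwise. Blocks. For $n=2$, a block ($2$-block) of $T_1\times T_2$ is the product of two non-empty upward-closed proper subsets of the axes (birth block), or of two non-empty downward-closed proper subsets of the axes (death block), or of an interval of one axis with the entire other axis (band). For $n\ge3$, an $n$-block of $T_1\times\cdots\times T_n$ is inductively a Cartesian product of either a non-empty upward-closed proper subset of each axis (birth block), or a non-empty downward-closed proper subset of each axis (death block), or an $(n-1)$-block in the product of $n-1$ of the axes and the entire remaining axis (induced block). A block module is $\mathbf{k}_B$ with $B$ an $n$-block; a persistence module over $P$ is block-decomposable if it is isomorphic to a direct sum of block modules (possibly empty). Middle exactness. A $k$-cube in $P$ is a subset $C=\{t_1,t_1'\}\times\cdots\times\{t_n,t_n'\}$ with $t_i\le t_i'$ in $T_i$, exactly $k$ of these inequalities being strict; it is identified (as a poset) with the power set of $[k]=\{1,\dots,k\}$ ordered by inclusion, and for $A\subseteq[k]$ one writes $M_A$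 for the value of $M$ at the corresponding vertex. For $k\ge 2$ the Koszul complex $K_C(M)$ is defined inductively: for $k=2$ it is $0\to M_\emptyset\to M_1\oplus M_2\to M_{12}\to0$ with $M_{12}$ in degree $0$, first map $(d^1,d^2)$ and second map $(d_2^{12},-d_1^{12})$, where $d$ denotes structure maps of $M$; for $k\ge3$ it is the mapping cone of the chain map $K_{\mathcal F}(M)\to K_{\mathcal R}(M)$ induced by $S\mapsto S\cup\{k\}$ between the opposite faces $\mathcal F=\mathcal P([k-1])$ and $\mathcal R=\{S\subseteq[k]: k\in S\}$. Explicitly (up to isomorphism), its degree $i$ term is $\bigoplus_{|A|=k-i}M_A$ and the component $M_A\to M_{A\cup\{x\}}$ ($x\notin A$) of the differential is $(-1)^{\#\{y\in A:\,y>x\}}$ times the structure map. $M$ is $k$-middle exact if $H_i(K_C(M))=0$ for all $0<i<k$ and all $k$-cubes $C$ of $P$. *)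

theory Defs
  imports Complex_Main "HOL-Library.FuncSet" "HOL-Library.Function_Algebras"
begin

text \<open>
  Posets are subsets \<open>Q\<close> of an ordered type with the induced order. All vector spaces of a
  persistence module are subspaces of one ambient vector space. This is no restriction, since
  any family of vector spaces embeds into its direct sum.
\<close>

record ('p, 'k, 'v) persmod =
  scl :: "'k \<Rightarrow> 'v \<Rightarrow> 'v"
  obj :: "'p \<Rightarrow> 'v set"
  arr :: "'p \<Rightarrow> 'p \<Rightarrow> 'v \<Rightarrow> 'v"

locale persistence_module = vector_space "scl M"
  for Q :: "'p::order set" and M :: "('p, 'k::field, 'v::ab_group_add) persmod" +
  assumes subspace_obj: "q \<in> Q \<Longrightarrow> subspace (obj M q)"
    and arr_in: "\<lbrakk>p \<in> Q; q \<in> Q; p \<le> q; x \<in> obj M p\<rbrakk> \<Longrightarrow> arr M p q x \<in> obj M q"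
    and arr_add: "\<lbrakk>p \<in> Q; q \<in> Q; p \<le> q; x \<in> obj M p; y \<in> obj M p\<rbrakk>
      \<Longrightarrow> arr M p q (x + y) = arr M p q x + arr M p q y"
    and arr_scl: "\<lbrakk>p \<in> Q; q \<in> Q; p \<le> q; x \<in> obj M p\<rbrakk>
      \<Longrightarrow> arr M p q (scl M c x) = scl M c (arr M p q x)"
    and arr_id: "\<lbrakk>p \<in> Q; x \<in> obj M p\<rbrakk> \<Longrightarrow> arr M p p x = x"
    and arr_comp: "\<lbrakk>p \<in> Q; q \<in> Q; r \<in> Q; p \<le> q; q \<le> r; x \<in> obj M p\<rbrakk>
      \<Longrightarrow> arr M q r (arr M p q x) = arr M p r x"

definition pointwise_finite_dimensional ::
  "'p set \<Rightarrow> ('p, 'k::field, 'v::ab_group_add) persmod \<Rightarrow> bool" where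
  "pointwise_finite_dimensional Q M \<longleftrightarrow>
    (\<forall>q\<in>Q. \<exists>S. finite S \<and> module.span (scl M) S = obj M q)"

definition persmod_iso ::
  "'p::order set \<Rightarrow> ('p, 'k::field, 'v::ab_group_add) persmod \<Rightarrow>
    ('p, 'k, 'w::ab_group_add) persmod \<Rightarrow> bool" where
  "persmod_iso Q M N \<longleftrightarrow> (\<exists>\<phi>.
    (\<forall>p\<in>Q. bij_betw (\<phi> p) (obj M p) (obj N p)) \<and>
    (\<forall>p\<in>Q. \<forall>x\<in>obj M p. \<forall>y\<in>obj M p. \<phi> p (x + y) = \<phi> p x + \<phi> p y) \<and>
    (\<forall>p\<in>Q. \<forall>x\<in>obj M p. \<forall>c. \<phi> p (scl M c x) = scl N c (\<phi> p x)) \<and>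
    (\<forall>p\<in>Q. \<forall>q\<in>Q. p \<le> q \<longrightarrow>
      (\<forall>x\<in>obj M p. \<phi> q (arr M p q x) = arr N p q (\<phi> p x))))"

definition interval_module :: "'p set \<Rightarrow> ('p, 'k::field, 'k) persmod" where
  "interval_module I =
    \<lparr> scl = (*),
      obj = (\<lambda>p. if p \<in> I then UNIV else {0}),
      arr = (\<lambda>p q x. if p \<in> I \<and> q \<in> I then x else 0) \<rparr>"

definition direct_sum ::
  "'j set \<Rightarrow> ('j \<Rightarrow> ('p, 'k, 'v::zero) persmod) \<Rightarrow> ('p, 'k, 'j \<Rightarrow> 'v) persmod" where
  "direct_sum J N =
    \<lparr> scl = (\<lambda>c f j. scl (N j) c (f j)),
      obj = (\<lambda>p. {f. (\<forall>j\<in>J. f j \<in> obj (N j) p) \<and> (\<forall>j. j \<notin> J \<longrightarrow> f j = 0) \<and>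
                     finite {j. f j \<noteq> 0}}),
      arr = (\<lambda>p q f j. if j \<in> J then arr (N j) p q (f j) else 0) \<rparr>"

definition poset_interval :: "'p::order set \<Rightarrow> 'p set \<Rightarrow> bool" where
  "poset_interval Q I \<longleftrightarrow> I \<subseteq> Q \<and> I \<noteq> {} \<and>
    (\<forall>x\<in>I. \<forall>z\<in>I. \<forall>y\<in>Q. x \<le> y \<and> y \<le> z \<longrightarrow> y \<in> I) \<and>
    (\<forall>x\<in>I. \<forall>y\<in>I. (x, y) \<in> {(a, b). a \<in> I \<and> b \<in> I \<and> (a \<le> b \<or> b \<le> a)}\<^sup>*)"

definition proper_upset :: "'p::order set \<Rightarrow> 'p set \<Rightarrow> bool" where
  "proper_upset Q U \<longleftrightarrow> U \<subset> Q \<and> U \<noteq> {} \<and> (\<forall>x\<in>U. \<forall>y\<in>Q. x \<le> y \<longrightarrow> y \<in> U)"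

definition proper_downset :: "'p::order set \<Rightarrow> 'p set \<Rightarrow> bool" where
  "proper_downset Q U \<longleftrightarrow> U \<subset> Q \<and> U \<noteq> {} \<and> (\<forall>x\<in>U. \<forall>y\<in>Q. y \<le> x \<longrightarrow> y \<in> U)"

text \<open>
  The totally ordered axes \<open>T i\<close> are subsets of one linearly ordered type. This is no
  restriction, since finitely many total orders embed into their ordinal sum. The product over
  an index set \<open>I\<close> is \<open>PiE I T\<close>. Its elements agree outside \<open>I\<close>, so the pointwise order
  of functions restricts to the product order on it.

  \<open>block T I B\<close> says that \<open>B\<close> is a \<open>card I\<close>-block of \<open>PiE I T\<close>. In the last rule, the set
  in the conclusion is the product of \<open>B\<close> with the whole axis \<open>T i\<close>.
\<close>

inductive block :: "('i \<Rightarrow> 'a::linorder set) \<Rightarrow> 'i set \<Rightarrow> ('i \<Rightarrow> 'a) set \<Rightarrow> bool"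
  for T :: "'i \<Rightarrow> 'a::linorder set" where
  birth: "\<lbrakk>finite I; card I \<ge> 2; \<And>i. i \<in> I \<Longrightarrow> proper_upset (T i) (U i)\<rbrakk>
    \<Longrightarrow> block T I (PiE I U)"
| death: "\<lbrakk>finite I; card I \<ge> 2; \<And>i. i \<in> I \<Longrightarrow> proper_downset (T i) (U i)\<rbrakk>
    \<Longrightarrow> block T I (PiE I U)"
| band: "\<lbrakk>i \<noteq> j; poset_interval (T i) S\<rbrakk>
    \<Longrightarrow> block T {i, j} (PiE {i, j} (T(i := S)))"
| induced: "\<lbrakk>finite I; card I \<ge> 3; i \<in> I; block T (I - {i}) B\<rbrakk>
    \<Longrightarrow> block T I {x \<in> PiE I T. restrict x (I - {i}) \<in> B}"

text \<open>
  The index type of the direct sum is large enough for every module: if \<open>p\<close> lies in the block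
  with index \<open>j\<close>, the vector of \<open>obj M p\<close> corresponding to \<open>1\<close> in the \<open>j\<close>-th summand
  is nonzero, and for fixed \<open>p\<close> these vectors are linearly independent. So nonzero summands
  can be indexed injectively by pairs of a point and a vector.
\<close>

definition block_decomposable ::
  "nat \<Rightarrow> (nat \<Rightarrow> 'a::linorder set) \<Rightarrow>
    (nat \<Rightarrow> 'a, 'k::field, 'v::ab_group_add) persmod \<Rightarrow> bool" where
  "block_decomposable n T M \<longleftrightarrow>
    (\<exists>(J :: ((nat \<Rightarrow> 'a) \<times> 'v) set) B.
      (\<forall>j\<in>J. block T {1..n} (B j)) \<and>
      persmod_iso (PiE {1..n} T) M (direct_sum J (\<lambda>j. interval_module (B j))))"

text \<open>
  A cube is given by its least vertex \<open>t\<close> and its greatest vertex \<open>t'\<close>. Its set of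
  directions, enumerated increasingly, plays the role of \<open>{1..k}\<close>.
\<close>

definition cube_dirs :: "nat \<Rightarrow> (nat \<Rightarrow> 'a::linorder) \<Rightarrow> (nat \<Rightarrow> 'a) \<Rightarrow> nat set" where
  "cube_dirs n t t' = {i \<in> {1..n}. t i < t' i}"

definition is_cube ::
  "nat \<Rightarrow> (nat \<Rightarrow> 'a::linorder set) \<Rightarrow> nat \<Rightarrow> (nat \<Rightarrow> 'a) \<Rightarrow> (nat \<Rightarrow> 'a) \<Rightarrow> bool" where
  "is_cube n T k t t' \<longleftrightarrow>
    t \<in> PiE {1..n} T \<and> t' \<in> PiE {1..n} T \<and> t \<le> t' \<and> card (cube_dirs n t t') = k"

definition cube_vertex ::
  "(nat \<Rightarrow> 'a) \<Rightarrow> (nat \<Rightarrow> 'a) \<Rightarrow> nat set \<Rightarrow> nat \<Rightarrow> 'a" where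
  "cube_vertex t t' A = (\<lambda>i. if i \<in> A then t' i else t i)"

text \<open>
  An element of the direct sum of the \<open>M\<^sub>A\<close> is a function on sets of directions, extended by zero:
  the term of degree \<open>i\<close> uses the sets with \<open>k - i\<close> elements.
  The component of the differential at \<open>A\<close> collects the contributions from the sets
  \<open>A - {x}\<close>. Up to a sign isomorphism, this complex is the iterated mapping cone of the chain
  maps between opposite faces.
\<close>

definition koszul_term ::
  "nat \<Rightarrow> (nat \<Rightarrow> 'a::linorder, 'k::field, 'v::ab_group_add) persmod \<Rightarrow>
    (nat \<Rightarrow> 'a) \<Rightarrow> (nat \<Rightarrow> 'a) \<Rightarrow> nat \<Rightarrow> (nat set \<Rightarrow> 'v) set" where
  "koszul_term n M t t' i = {c. \<forall>A.
    if A \<subseteq> cube_dirs n t t' \<and> card A + i = card (cube_dirs n t t')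
    then c A \<in> obj M (cube_vertex t t' A) else c A = 0}"

definition koszul_diff ::
  "nat \<Rightarrow> (nat \<Rightarrow> 'a::linorder, 'k::field, 'v::ab_group_add) persmod \<Rightarrow>
    (nat \<Rightarrow> 'a) \<Rightarrow> (nat \<Rightarrow> 'a) \<Rightarrow> (nat set \<Rightarrow> 'v) \<Rightarrow> nat set \<Rightarrow> 'v" where
  "koszul_diff n M t t' c = (\<lambda>A. if A \<subseteq> cube_dirs n t t'
    then \<Sum>x\<in>A. scl M ((- 1) ^ card {y \<in> A - {x}. y > x})
           (arr M (cube_vertex t t' (A - {x})) (cube_vertex t t' A) (c (A - {x})))
    else 0)"

definition koszul_homology_vanishes ::
  "nat \<Rightarrow> (nat \<Rightarrow> 'a::linorder, 'k::field, 'v::ab_group_add) persmod \<Rightarrow>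
    (nat \<Rightarrow> 'a) \<Rightarrow> (nat \<Rightarrow> 'a) \<Rightarrow> nat \<Rightarrow> bool" where
  "koszul_homology_vanishes n M t t' i \<longleftrightarrow>
    {c \<in> koszul_term n M t t' i. koszul_diff n M t t' c = (\<lambda>_. 0)} =
    koszul_diff n M t t' ` koszul_term n M t t' (Suc i)"

definition middle_exact ::
  "nat \<Rightarrow> (nat \<Rightarrow> 'a::linorder set) \<Rightarrow> nat \<Rightarrow>
    (nat \<Rightarrow> 'a, 'k::field, 'v::ab_group_add) persmod \<Rightarrow> bool" where
  "middle_exact n T k M \<longleftrightarrow>
    (\<forall>t t' i. is_cube n T k t t' \<and> 0 < i \<and> i < k \<longrightarrow> koszul_homology_vanishes n M t t' i)"

end

theory Submission
  imports Defs
begin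

text \<open>
  Middle exactness is used only through two statements about a cube with directions \<open>J \<union> {i}\<close>:
  an element killed in all directions \<open>J\<close> lifts along \<open>i\<close> to such an element, and the
  cokernel of the maps in the directions \<open>J\<close> injects along \<open>i\<close>. On a finite grid, an interval
  \<open>[u, d]\<close> carries a direct summand as soon as some \<open>x\<close> in the space at \<open>u\<close> dies outside the
  down-set of \<open>d\<close> and its image at \<open>d\<close> is not in the span of the images from points not above
  \<open>u\<close>. If the space at the least (greatest) vertex is nonzero, such a summand is found by taking
  \<open>d\<close> maximal (\<open>u\<close> minimal), and otherwise there is a bounded band. So modules on finite grids
  decompose.

  An arbitrary pointwise finite-dimensional module is a direct sum of indecomposables. By linear
  compactness, the block idempotents of the restrictions of an indecomposable \<open>M\<close> to finite grids
  agree on any prescribed finite set with endomorphisms of \<open>M\<close>, which by Fitting's lemma are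
  injective or locally nilpotent. Hence every finite set of points meets only one block of the
  restriction to a large grid. It follows that \<open>M\<close> has dimension at most one everywhere and that it
  is the interval module of a block.
\<close>

section \<open>Subspaces of finite-dimensional spaces\<close>

text \<open>Two obstacles shape the proof. On a grid, neither statement moves an element along
  \<open>i\<close> when \<open>J\<close> has no direction other than \<open>i\<close>: with empty
  \<open>J\<close> they would say that structure maps are surjective or injective. Hence the case of
  a single direction in \<open>J\<close> is treated on its own, by moving along the other axes only.
  Off grids, decompositions of the restrictions to growing grids need not be compatible, so no limit
  of them is formed: the module is decomposed abstractly, and grids only serve to inspect one
  indecomposable summand. A global endomorphism that agrees with a block idempotent on a finite set
  need not be idempotent, so indecomposability does not apply to it directly; but it fixes a nonzero
  vector, which excludes the locally nilpotent case of Fitting's lemma.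

  The converse reduces to a single block. A cube either has a direction that does not affect
  membership in the block, which gives a contraction, or meets the block in at most one extreme
  vertex, so that the complex lives in degree 0 or \<open>k\<close>.\<close>

locale linear_space = vector_space scale
  for scale :: "'a::field \<Rightarrow> 'b::ab_group_add \<Rightarrow> 'b"
begin

text \<open>Only containment in a finitely generated span is asked, so the notion makes sense for
  arbitrary subsets and passes to them.\<close>

definition fin_dim :: "'b set \<Rightarrow> bool" where
  "fin_dim V \<longleftrightarrow> (\<exists>S. finite S \<and> V \<subseteq> span S)"

lemma fin_dim_subset: "fin_dim V \<Longrightarrow> U \<subseteq> V \<Longrightarrow> fin_dim U"
  unfolding fin_dim_def by blast

lemma fin_dim_independent_finite:
  assumes "fin_dim V" "B \<subseteq> V" "independent B"
  shows "finite B"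
  using assms independent_span_bound unfolding fin_dim_def by (meson subset_trans)

lemma fin_dim_psubset_dim:
  assumes V: "fin_dim V" and U: "subspace U" "U \<subset> V"
  shows "dim U < dim V"
proof -
  obtain B where B: "B \<subseteq> U" "independent B" "U \<subseteq> span B"
    using maximal_independent_subset by blast
  have finB: "finite B"
    using fin_dim_independent_finite[OF V _ B(2)] B(1) U(2) by blast
  obtain v where v: "v \<in> V" "v \<notin> U" using U(2) by blast
  have vB: "v \<notin> span B" using v(2) span_minimal[OF B(1) U(1)] by blast
  have ind: "independent (insert v B)" by (rule independent_insertI[OF vB B(2)])
  obtain C where C: "insert v B \<subseteq> C" "C \<subseteq> V" "independent C" "V \<subseteq> span C"
    using maximal_independent_subset_extend[OF _ ind, of V] v(1) B(1) U(2) by blast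
  have finC: "finite C" by (rule fin_dim_independent_finite[OF V C(2,3)])
  have "dim U = card B" using basis_card_eq_dim[OF B(1,3,2)] by simp
  also have "\<dots> < card (insert v B)"
    using vB finB span_base by (metis card_insert_disjoint lessI)
  also have "\<dots> \<le> card C" by (rule card_mono[OF finC C(1)])
  also have "\<dots> = dim V" by (rule basis_card_eq_dim[OF C(2,4,3)])
  finally show ?thesis .
qed

lemma fin_dim_subset_dim:
  assumes "fin_dim V" "subspace U" "U \<subseteq> V"
  shows "dim U \<le> dim V"
  using fin_dim_psubset_dim[OF assms(1,2)] assms(3) by (cases "U = V") (auto simp: psubset_eq less_imp_le)

text \<open>The descending chain condition in the form used below: a member of least dimension is
  minimal.\<close>

lemma fin_dim_minimal:
  assumes V: "fin_dim V" and ne: "\<U> \<noteq> {}"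
    and sub: "\<And>U. U \<in> \<U> \<Longrightarrow> subspace U \<and> U \<subseteq> V"
  obtains U where "U \<in> \<U>" "\<And>U'. U' \<in> \<U> \<Longrightarrow> U' \<subseteq> U \<Longrightarrow> U' = U"
proof -
  obtain U0 where "U0 \<in> \<U>" using ne by blast
  then obtain U where U: "U \<in> \<U>" "\<forall>U'. U' \<in> \<U> \<longrightarrow> dim U \<le> dim U'"
    using ex_has_least_nat[of "\<lambda>U. U \<in> \<U>" U0 dim] by blast
  show ?thesis
  proof (rule that[OF U(1)])
    fix U' assume U': "U' \<in> \<U>" "U' \<subseteq> U"
    show "U' = U"
    proof (rule ccontr)
      assume "U' \<noteq> U"
      then have "dim U' < dim U"
        using fin_dim_psubset_dim[of U U'] fin_dim_subset[OF V] sub U(1) U' by blast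
      with U(2) U'(1) show False by fastforce
    qed
  qed
qed

lemma fin_dim_maximal:
  assumes V: "fin_dim V" and ne: "\<U> \<noteq> {}"
    and sub: "\<And>U. U \<in> \<U> \<Longrightarrow> subspace U \<and> U \<subseteq> V"
  obtains U where "U \<in> \<U>" "\<And>U'. U' \<in> \<U> \<Longrightarrow> U \<subseteq> U' \<Longrightarrow> U' = U"
proof -
  obtain U0 where U0: "U0 \<in> \<U>" using ne by blast
  have "\<forall>U. U \<in> \<U> \<longrightarrow> dim U < Suc (dim V)"
    using fin_dim_subset_dim[OF V] sub by (simp add: less_Suc_eq_le)
  from ex_has_greatest_nat[of "\<lambda>U. U \<in> \<U>", OF U0 this]
  obtain U where U: "U \<in> \<U>" "\<forall>U'. U' \<in> \<U> \<longrightarrow> dim U' \<le> dim U" by blast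
  show ?thesis
  proof (rule that[OF U(1)])
    fix U' assume U': "U' \<in> \<U>" "U \<subseteq> U'"
    show "U' = U"
    proof (rule ccontr)
      assume "U' \<noteq> U"
      then have "dim U < dim U'"
        using fin_dim_psubset_dim[of U' U] fin_dim_subset[OF V] sub U(1) U' by blast
      with U(2) U'(1) show False by fastforce
    qed
  qed
qed

text \<open>Supplies the coordinate functional of an interval summand. It is prescribed on a basis
  of \<open>W\<close> together with \<open>x\<close> and extended linearly.\<close>

lemma separating_functional:
  assumes W: "subspace W" and x: "x \<notin> W"
  obtains f :: "'b \<Rightarrow> 'a" where "\<And>a b. f (a + b) = f a + f b" "\<And>c a. f (scale c a) = c * f a"
    "f x = 1" "\<And>w. w \<in> W \<Longrightarrow> f w = 0"
proof -
  interpret F: vector_space "(*) :: 'a \<Rightarrow> 'a \<Rightarrow> 'a"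
    by unfold_locales (auto simp: algebra_simps)
  interpret P: vector_space_pair scale "(*) :: 'a \<Rightarrow> 'a \<Rightarrow> 'a" ..
  obtain B where B: "B \<subseteq> W" "independent B" "W \<subseteq> span B"
    using maximal_independent_subset by blast
  have xB: "x \<notin> span B" using x span_minimal[OF B(1) W] by blast
  have "independent (insert x B)" by (rule independent_insertI[OF xB B(2)])
  then obtain f where f: "Vector_Spaces.linear scale (*) f" "\<forall>b\<in>insert x B. f b = (if b = x then 1 else 0)"
    using P.linear_independent_extend[of "insert x B" "\<lambda>b. if b = x then 1 else 0"] by blast
  interpret L: Vector_Spaces.linear scale "(*)" f by (rule f(1))
  have "f b = 0" if "b \<in> B" for b using f(2) that xB span_base by auto
  then have "f w = 0" if "w \<in> span B" for w using L.eq_0_on_span that by blast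
  moreover have "f x = 1" using f(2) by simp
  ultimately show ?thesis
    using that[of f, OF L.add L.scale] f(2) B(3) by blast
qed

end

sublocale persistence_module \<subseteq> linear_space "scl M"
  by (rule linear_space.intro) (rule vector_space_axioms)

section \<open>Endomorphisms of persistence modules\<close>

definition pfd :: "'p set \<Rightarrow> ('p, 'k::field, 'v::ab_group_add) persmod \<Rightarrow> bool" where
  "pfd Q M \<longleftrightarrow> (\<forall>q\<in>Q. linear_space.fin_dim (scl M) (obj M q))"

definition endo :: "'p::order set \<Rightarrow> ('p, 'k::field, 'v::ab_group_add) persmod \<Rightarrow>
    ('p \<Rightarrow> 'v \<Rightarrow> 'v) \<Rightarrow> bool" where
  "endo Q M e \<longleftrightarrow>
    (\<forall>p\<in>Q. \<forall>x\<in>obj M p. e p x \<in> obj M p) \<and>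
    (\<forall>p\<in>Q. \<forall>x\<in>obj M p. \<forall>y\<in>obj M p. e p (x + y) = e p x + e p y) \<and>
    (\<forall>p\<in>Q. \<forall>x\<in>obj M p. \<forall>c. e p (scl M c x) = scl M c (e p x)) \<and>
    (\<forall>p\<in>Q. \<forall>q\<in>Q. p \<le> q \<longrightarrow> (\<forall>x\<in>obj M p. e q (arr M p q x) = arr M p q (e p x)))"

lemma endoI:
  assumes "\<And>p x. p \<in> Q \<Longrightarrow> x \<in> obj M p \<Longrightarrow> e p x \<in> obj M p"
    and "\<And>p x y. p \<in> Q \<Longrightarrow> x \<in> obj M p \<Longrightarrow> y \<in> obj M p \<Longrightarrow> e p (x + y) = e p x + e p y"
    and "\<And>p x c. p \<in> Q \<Longrightarrow> x \<in> obj M p \<Longrightarrow> e p (scl M c x) = scl M c (e p x)"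
    and "\<And>p q x. p \<in> Q \<Longrightarrow> q \<in> Q \<Longrightarrow> p \<le> q \<Longrightarrow> x \<in> obj M p \<Longrightarrow>
      e q (arr M p q x) = arr M p q (e p x)"
  shows "endo Q M e"
  using assms unfolding endo_def by blast

lemma endo_in: "endo Q M e \<Longrightarrow> p \<in> Q \<Longrightarrow> x \<in> obj M p \<Longrightarrow> e p x \<in> obj M p"
  and endo_add: "endo Q M e \<Longrightarrow> p \<in> Q \<Longrightarrow> x \<in> obj M p \<Longrightarrow> y \<in> obj M p \<Longrightarrow>
    e p (x + y) = e p x + e p y"
  and endo_scl: "endo Q M e \<Longrightarrow> p \<in> Q \<Longrightarrow> x \<in> obj M p \<Longrightarrow> e p (scl M c x) = scl M c (e p x)"
  and endo_arr: "endo Q M e \<Longrightarrow> p \<in> Q \<Longrightarrow> q \<in> Q \<Longrightarrow> p \<le> q \<Longrightarrow> x \<in> obj M p \<Longrightarrow>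
      e q (arr M p q x) = arr M p q (e p x)"
  by (simp_all add: endo_def)

definition idem :: "'p set \<Rightarrow> ('p, 'k::field, 'v::ab_group_add) persmod \<Rightarrow>
    ('p \<Rightarrow> 'v \<Rightarrow> 'v) \<Rightarrow> bool" where
  "idem Q M e \<longleftrightarrow> (\<forall>p\<in>Q. \<forall>x\<in>obj M p. e p (e p x) = e p x)"

text \<open>For an idempotent endomorphism \<open>e\<close> this is the direct summand that it cuts
  out. The structure maps of \<open>M\<close> are kept, so nothing has to be transported along an
  isomorphism.\<close>

definition image_mod :: "('p, 'k::field, 'v::ab_group_add) persmod \<Rightarrow> ('p \<Rightarrow> 'v \<Rightarrow> 'v) \<Rightarrow>
    ('p, 'k, 'v) persmod" where
  "image_mod M e = M\<lparr>obj := \<lambda>p. e p ` obj M p\<rparr>"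

lemma image_mod_simps [simp]:
  "scl (image_mod M e) = scl M" "arr (image_mod M e) = arr M"
  "obj (image_mod M e) = (\<lambda>p. e p ` obj M p)"
  by (simp_all add: image_mod_def)

text \<open>The zero module satisfies this too, so nonvanishing is assumed separately where it
  matters.\<close>

definition indecomposable :: "'p::order set \<Rightarrow> ('p, 'k::field, 'v::ab_group_add) persmod \<Rightarrow> bool" where
  "indecomposable Q M \<longleftrightarrow> (\<forall>e. endo Q M e \<and> idem Q M e \<longrightarrow>
    (\<forall>p\<in>Q. \<forall>x\<in>obj M p. e p x = 0) \<or> (\<forall>p\<in>Q. \<forall>x\<in>obj M p. e p x = x))"

lemma persistence_module_subset:
  assumes "persistence_module Q M" "G \<subseteq> Q"
  shows "persistence_module G M"
proof -
  interpret persistence_module Q M by fact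
  show ?thesis
    using assms(2) subspace_obj arr_in arr_add arr_scl arr_id arr_comp
    by unfold_locales (simp_all add: subset_eq algebra_simps)
qed

section \<open>Elementary properties of structure maps, endomorphisms and their images\<close>

context persistence_module
begin

lemma zero_in: "q \<in> Q \<Longrightarrow> 0 \<in> obj M q"
  by (rule subspace_0[OF subspace_obj])

lemma add_in: "q \<in> Q \<Longrightarrow> x \<in> obj M q \<Longrightarrow> y \<in> obj M q \<Longrightarrow> x + y \<in> obj M q"
  by (rule subspace_add[OF subspace_obj])

lemma scl_in: "q \<in> Q \<Longrightarrow> x \<in> obj M q \<Longrightarrow> scl M c x \<in> obj M q"
  by (rule subspace_scale[OF subspace_obj])

lemma diff_in: "q \<in> Q \<Longrightarrow> x \<in> obj M q \<Longrightarrow> y \<in> obj M q \<Longrightarrow> x - y \<in> obj M q"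
  by (rule subspace_diff[OF subspace_obj])

lemma neg_in: "q \<in> Q \<Longrightarrow> x \<in> obj M q \<Longrightarrow> - x \<in> obj M q"
  by (rule subspace_neg[OF subspace_obj])

lemma sum_in: "q \<in> Q \<Longrightarrow> (\<And>i. i \<in> A \<Longrightarrow> f i \<in> obj M q) \<Longrightarrow> sum f A \<in> obj M q"
  using subspace_obj subspace_sum by blast

lemma arr_zero: "p \<in> Q \<Longrightarrow> q \<in> Q \<Longrightarrow> p \<le> q \<Longrightarrow> arr M p q 0 = 0"
  using arr_add[of p q 0 0] zero_in by simp

lemma arr_neg: "p \<in> Q \<Longrightarrow> q \<in> Q \<Longrightarrow> p \<le> q \<Longrightarrow> x \<in> obj M p \<Longrightarrow> arr M p q (- x) = - arr M p q x"
  using arr_add[of p q x "- x"] arr_zero neg_in by (metis ab_left_minus eq_neg_iff_add_eq_0 add.commute)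

lemma arr_diff: "p \<in> Q \<Longrightarrow> q \<in> Q \<Longrightarrow> p \<le> q \<Longrightarrow> x \<in> obj M p \<Longrightarrow> y \<in> obj M p \<Longrightarrow>
    arr M p q (x - y) = arr M p q x - arr M p q y"
  using arr_add[of p q x "- y"] arr_neg neg_in by simp

lemma arr_sum:
  assumes pq: "p \<in> Q" "q \<in> Q" "p \<le> q" and f: "\<And>i. i \<in> A \<Longrightarrow> f i \<in> obj M p"
  shows "arr M p q (sum f A) = (\<Sum>i\<in>A. arr M p q (f i))"
  using f
proof (induction A rule: infinite_finite_induct)
  case (insert a A)
  then show ?case using arr_add[OF pq, of "f a" "sum f A"] sum_in[of p A f] pq by simp
qed (use arr_zero[OF pq] in auto)

lemma endo_zero: "endo Q M e \<Longrightarrow> p \<in> Q \<Longrightarrow> e p 0 = 0"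
  using endo_add[of Q M e p 0 0] zero_in by simp

lemma endo_neg: "endo Q M e \<Longrightarrow> p \<in> Q \<Longrightarrow> x \<in> obj M p \<Longrightarrow> e p (- x) = - e p x"
  using endo_add[of Q M e p x "- x"] endo_zero neg_in
  by (metis ab_left_minus eq_neg_iff_add_eq_0 add.commute)

lemma endo_diff: "endo Q M e \<Longrightarrow> p \<in> Q \<Longrightarrow> x \<in> obj M p \<Longrightarrow> y \<in> obj M p \<Longrightarrow>
    e p (x - y) = e p x - e p y"
  using endo_add[of Q M e p x "- y"] endo_neg neg_in by simp

lemma endo_sum:
  assumes e: "endo Q M e" "p \<in> Q" and f: "\<And>i. i \<in> A \<Longrightarrow> f i \<in> obj M p"
  shows "e p (sum f A) = (\<Sum>i\<in>A. e p (f i))"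
  using f
proof (induction A rule: infinite_finite_induct)
  case (insert a A)
  then show ?case using endo_add[OF e, of "f a" "sum f A"] sum_in[of p A f] e by simp
qed (use endo_zero[OF e] in auto)

lemma endo_id: "endo Q M (\<lambda>p x. x)"
  by (auto simp: endo_def)

lemma endo_comp: "endo Q M e \<Longrightarrow> endo Q M f \<Longrightarrow> endo Q M (\<lambda>p x. e p (f p x))"
  by (simp add: endo_def)

lemma endo_minus: "endo Q M e \<Longrightarrow> endo Q M f \<Longrightarrow> endo Q M (\<lambda>p x. e p x - f p x)"
  by (simp add: endo_def diff_in arr_diff scale_right_diff_distrib)

lemma subspace_endo_image:
  assumes e: "endo Q M e" and p: "p \<in> Q"
  shows "subspace (e p ` obj M p)"
proof (rule subspaceI)
  show "0 \<in> e p ` obj M p" using endo_zero[OF e p] zero_in[OF p] by (metis imageI)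
  fix x y c assume "x \<in> e p ` obj M p"
  then obtain x' where x': "x = e p x'" "x' \<in> obj M p" by blast
  then show "scl M c x \<in> e p ` obj M p"
    using endo_scl[OF e p x'(2), of c, symmetric] scl_in[OF p] by simp
  assume "y \<in> e p ` obj M p"
  then obtain y' where y': "y = e p y'" "y' \<in> obj M p" by blast
  then show "x + y \<in> e p ` obj M p"
    using x' endo_add[OF e p x'(2) y'(2), symmetric] add_in[OF p] by simp
qed

lemma persistence_module_image:
  assumes e: "endo Q M e"
  shows "persistence_module Q (image_mod M e)"
proof -
  have sub: "e p ` obj M p \<subseteq> obj M p" if "p \<in> Q" for p using endo_in[OF e that] by blast
  have "persistence_module_axioms Q (image_mod M e)"
  proof (rule persistence_module_axioms.intro, goal_cases)
    case (1 q)
    then show ?case using subspace_endo_image[OF e] by simp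
  next
    case (2 p q x)
    then obtain y where y: "y \<in> obj M p" "x = e p y" by auto
    then have "arr M p q x = e q (arr M p q y)" using endo_arr[OF e 2(1-3)] by simp
    then show ?case using arr_in[OF 2(1-3) y(1)] by simp
  next
    case (3 p q x y)
    then show ?case using subsetD[OF sub, of p x] subsetD[OF sub, of p y] arr_add[of p q x y] by simp
  next
    case (4 p q x c)
    then show ?case using subsetD[OF sub, of p x] arr_scl[of p q x c] by simp
  next
    case (5 p x)
    then show ?case using subsetD[OF sub, of p x] arr_id[of p x] by simp
  next
    case (6 p q r x)
    then show ?case using subsetD[OF sub, of p x] arr_comp[of p q r x] by simp
  qed
  then show ?thesis by (simp add: persistence_module_def vector_space_axioms)
qed

lemma pfd_image:
  assumes e: "endo Q M e" and M: "pfd Q M"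
  shows "pfd Q (image_mod M e)"
  unfolding pfd_def
proof
  fix q assume q: "q \<in> Q"
  then have "fin_dim (obj M q)" using M unfolding pfd_def by blast
  moreover have "e q ` obj M q \<subseteq> obj M q" using endo_in[OF e q] by blast
  ultimately show "linear_space.fin_dim (scl (image_mod M e)) (obj (image_mod M e) q)"
    using fin_dim_subset by simp
qed

end

section \<open>Projections onto summands and Fitting's lemma\<close>

context persistence_module
begin

text \<open>The component in \<open>I\<close> of a vector is unique because \<open>I\<close> and
  \<open>K\<close> meet in 0. Hence any choice of components is linear and natural: both sides of
  each required equation are components of the same vector.\<close>

lemma endo_projection:
  assumes I: "\<And>p. p \<in> Q \<Longrightarrow> subspace (I p)" "\<And>p. p \<in> Q \<Longrightarrow> I p \<subseteq> obj M p"
    and K: "\<And>p. p \<in> Q \<Longrightarrow> subspace (K p)" "\<And>p. p \<in> Q \<Longrightarrow> K p \<subseteq> obj M p"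
    and arrI: "\<And>p q x. p \<in> Q \<Longrightarrow> q \<in> Q \<Longrightarrow> p \<le> q \<Longrightarrow> x \<in> I p \<Longrightarrow> arr M p q x \<in> I q"
    and arrK: "\<And>p q x. p \<in> Q \<Longrightarrow> q \<in> Q \<Longrightarrow> p \<le> q \<Longrightarrow> x \<in> K p \<Longrightarrow> arr M p q x \<in> K q"
    and int: "\<And>p. p \<in> Q \<Longrightarrow> I p \<inter> K p \<subseteq> {0}"
    and dec: "\<And>p x. p \<in> Q \<Longrightarrow> x \<in> obj M p \<Longrightarrow> \<exists>y\<in>I p. x - y \<in> K p"
  obtains e where "endo Q M e" "idem Q M e" "\<And>p x. p \<in> Q \<Longrightarrow> x \<in> I p \<Longrightarrow> e p x = x"
    "\<And>p x. p \<in> Q \<Longrightarrow> x \<in> K p \<Longrightarrow> e p x = 0"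
proof -
  define e where "e p x = (SOME y. y \<in> I p \<and> x - y \<in> K p)" for p x
  have e: "e p x \<in> I p" "x - e p x \<in> K p" if "p \<in> Q" "x \<in> obj M p" for p x
    using someI_ex[of "\<lambda>y. y \<in> I p \<and> x - y \<in> K p"] dec[OF that] unfolding e_def by blast+
  have eqI: "e p x = y" if "p \<in> Q" "x \<in> obj M p" "y \<in> I p" "x - y \<in> K p" for p x y
  proof -
    have "e p x - y \<in> I p" using subspace_diff[OF I(1)[OF that(1)] e(1)[OF that(1,2)] that(3)] .
    moreover have "e p x - y \<in> K p"
      using subspace_diff[OF K(1)[OF that(1)] that(4) e(2)[OF that(1,2)]] by simp
    ultimately show ?thesis using int[OF that(1)] by auto
  qed
  have "endo Q M e"
  proof (rule endoI)
    fix p x assume px: "p \<in> Q" "x \<in> obj M p"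
    then show "e p x \<in> obj M p" using e(1) I(2) by blast
    show "e p (scl M c x) = scl M c (e p x)" for c
      using px e[OF px] scl_in subspace_scale[OF I(1)[OF px(1)]] subspace_scale[OF K(1)[OF px(1)]]
      by (intro eqI) (auto simp flip: scale_right_diff_distrib)
    show "e p (x + y) = e p x + e p y" if "y \<in> obj M p" for y
      using px that e[OF px] e[OF px(1) that] add_in subspace_add[OF I(1)[OF px(1)]]
        subspace_add[OF K(1)[OF px(1)], of "x - e p x" "y - e p y"]
      by (intro eqI) (auto simp: algebra_simps)
    fix q assume q: "q \<in> Q" "p \<le> q"
    have "e p x \<in> obj M p" using e(1)[OF px] I(2) px by blast
    then show "e q (arr M p q x) = arr M p q (e p x)"
      using px q e[OF px] arr_in arrI[OF px(1) q] arrK[OF px(1) q]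
      by (intro eqI) (auto simp flip: arr_diff)
  qed
  moreover have fixI: "e p x = x" if "p \<in> Q" "x \<in> I p" for p x
    using that I(2)[of p] subspace_0[OF K(1)[of p]] by (intro eqI) auto
  moreover have "e p x = 0" if "p \<in> Q" "x \<in> K p" for p x
    using that K(2)[of p] subspace_0[OF I(1)[of p]] by (intro eqI) auto
  moreover have "idem Q M e" unfolding idem_def using fixI e(1) by blast
  ultimately show ?thesis using that by blast
qed

lemma endo_funpow: "endo Q M f \<Longrightarrow> endo Q M (\<lambda>p. f p ^^ n)"
proof (induction n)
  case 0 then show ?case using endo_id by (simp add: id_def)
next
  case (Suc n) then show ?case using endo_comp[of f "\<lambda>p. f p ^^ n"] by (simp add: comp_def)
qed

text \<open>Images and kernels of the powers of \<open>f\<close> stabilise at every point, but with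
  an exponent that depends on the point, so no single power serves the whole module. The
  intersection of all images and the union of all kernels are still submodules, and they are
  complementary at every point. The fixed vector \<open>x0\<close> makes the first one nonzero, so
  indecomposability makes the second one zero.\<close>

lemma fitting_injective:
  assumes fd: "pfd Q M" and ind: "indecomposable Q M" and f: "endo Q M f"
    and p0: "p0 \<in> Q" "x0 \<in> obj M p0" "f p0 x0 = x0" "x0 \<noteq> 0"
    and p: "p \<in> Q" "x \<in> obj M p" "f p x = 0"
  shows "x = 0"
proof -
  define I where "I p = (\<Inter>n. (f p ^^ n) ` obj M p)" for p
  define K where "K p = {x \<in> obj M p. \<exists>n. (f p ^^ n) x = 0}" for p
  note fn = endo_funpow[OF f]
  have fadd: "(f p ^^ (m + n)) x = (f p ^^ m) ((f p ^^ n) x)" for p m n x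
    by (simp add: funpow_add)
  have I1: "subspace (I p)" if "p \<in> Q" for p
    unfolding I_def using subspace_endo_image[OF fn that] by (auto intro: subspace_Inter)
  have I2: "I p \<subseteq> obj M p" for p unfolding I_def by (auto dest: INT_D[of _ _ _ 0])
  have K2: "K p \<subseteq> obj M p" for p unfolding K_def by blast
  have kerle: "(f p ^^ m) x = 0" if "p \<in> Q" "(f p ^^ n) x = 0" "n \<le> m" for p m n x
    using that fadd[of "m - n" n p x] endo_zero[OF fn] by simp
  have K1: "subspace (K p)" if "p \<in> Q" for p
  proof (rule subspaceI)
    show "0 \<in> K p" using zero_in[OF that] unfolding K_def by (auto intro: exI[of _ 0])
    fix x y assume x: "x \<in> K p"
    then show "scl M c x \<in> K p" for c
      unfolding K_def using endo_scl[OF fn that] scl_in[OF that] by auto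
    assume "y \<in> K p"
    with x obtain m n where "(f p ^^ m) x = 0" "(f p ^^ n) y = 0" "x \<in> obj M p" "y \<in> obj M p"
      unfolding K_def by blast
    then have "(f p ^^ (max m n)) (x + y) = 0"
      using endo_add[OF fn that] kerle[OF that] by (metis add_0 max.cobounded1 max.cobounded2)
    then show "x + y \<in> K p"
      unfolding K_def using \<open>x \<in> obj M p\<close> \<open>y \<in> obj M p\<close> add_in[OF that] by blast
  qed
  have arrI: "arr M p q x \<in> I q" if pq: "p \<in> Q" "q \<in> Q" "p \<le> q" and xI: "x \<in> I p" for p q x
    unfolding I_def
  proof
    fix n
    obtain y where "y \<in> obj M p" "x = (f p ^^ n) y" using xI unfolding I_def by blast
    then show "arr M p q x \<in> (f q ^^ n) ` obj M q"
      using endo_arr[OF fn pq, of y n, symmetric] arr_in[OF pq, of y] by simp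
  qed
  have arrK: "arr M p q x \<in> K q" if pq: "p \<in> Q" "q \<in> Q" "p \<le> q" and xK: "x \<in> K p" for p q x
  proof -
    obtain n where n: "x \<in> obj M p" "(f p ^^ n) x = 0" using xK unfolding K_def by blast
    then have "(f q ^^ n) (arr M p q x) = 0"
      using endo_arr[OF fn pq n(1), of n] arr_zero[OF pq] by simp
    then show ?thesis unfolding K_def using arr_in[OF pq n(1)] by blast
  qed
  have stab: "I p \<inter> K p \<subseteq> {0}" "\<And>x. x \<in> obj M p \<Longrightarrow> \<exists>y\<in>I p. x - y \<in> K p" if p: "p \<in> Q" for p
  proof -
    have fdp: "fin_dim (obj M p)" using fd p unfolding pfd_def by blast
    obtain U where U: "U \<in> range (\<lambda>n. (f p ^^ n) ` obj M p)"
      "\<And>U'. U' \<in> range (\<lambda>n. (f p ^^ n) ` obj M p) \<Longrightarrow> U' \<subseteq> U \<Longrightarrow> U' = U"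
    proof (rule fin_dim_minimal[OF fdp, of "range (\<lambda>n. (f p ^^ n) ` obj M p)"])
      fix U assume "U \<in> range (\<lambda>n. (f p ^^ n) ` obj M p)"
      then obtain n where "U = (f p ^^ n) ` obj M p" by blast
      then show "subspace U \<and> U \<subseteq> obj M p"
        using subspace_endo_image[OF fn p] endo_in[OF fn p] by blast
    qed auto
    then obtain n where n: "U = (f p ^^ n) ` obj M p" by blast
    have dec: "(f p ^^ m) ` obj M p \<subseteq> (f p ^^ k) ` obj M p" if km: "k \<le> m" for k m
    proof
      fix y assume "y \<in> (f p ^^ m) ` obj M p"
      then obtain z where "z \<in> obj M p" "y = (f p ^^ m) z" by blast
      then have "y = (f p ^^ k) ((f p ^^ (m - k)) z)" "(f p ^^ (m - k)) z \<in> obj M p"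
        using fadd[of k "m - k" p z] km endo_in[OF fn p, of z] by auto
      then show "y \<in> (f p ^^ k) ` obj M p" by blast
    qed
    have st: "(f p ^^ m) ` obj M p = (f p ^^ n) ` obj M p" if "n \<le> m" for m
      using U(2)[of "(f p ^^ m) ` obj M p"] dec[OF that] n by blast
    have Ieq: "I p = (f p ^^ n) ` obj M p"
    proof
      show "(f p ^^ n) ` obj M p \<subseteq> I p"
        unfolding I_def
      proof (rule INT_greatest)
        fix m show "(f p ^^ n) ` obj M p \<subseteq> (f p ^^ m) ` obj M p"
          using dec[of m n] st[of m] by (cases "m \<le> n") auto
      qed
    qed (auto simp: I_def)
    define L where "L n = {x \<in> obj M p. (f p ^^ n) x = 0}" for n
    have Lsub: "subspace (L n)" for n
      using endo_add[OF fn p] endo_scl[OF fn p] endo_zero[OF fn p] zero_in[OF p] add_in[OF p]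
        scl_in[OF p] unfolding L_def by (intro subspaceI) auto
    obtain W where W: "W \<in> range L" "\<And>U'. U' \<in> range L \<Longrightarrow> W \<subseteq> U' \<Longrightarrow> U' = W"
      using fin_dim_maximal[OF fdp, of "range L"] Lsub by (auto simp: L_def)
    then obtain k where k: "W = L k" by blast
    have Lst: "L m = L k" if "k \<le> m" for m
    proof -
      have "L k \<subseteq> L m" using kerle[OF p _ that] unfolding L_def by blast
      then show ?thesis using W(2)[of "L m"] k by blast
    qed
    show "I p \<inter> K p \<subseteq> {0}"
    proof
      fix x assume x: "x \<in> I p \<inter> K p"
      then obtain m where m: "(f p ^^ m) x = 0" unfolding K_def by blast
      obtain y where y: "y \<in> obj M p" "x = (f p ^^ k) y" using x unfolding I_def by blast
      have "y \<in> L (m + k)" using m y fadd[of m k p y] unfolding L_def by simp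
      then have "y \<in> L k" using Lst[of "m + k"] by simp
      then show "x \<in> {0}" using y unfolding L_def by simp
    qed
    show "\<exists>y\<in>I p. x - y \<in> K p" if x: "x \<in> obj M p" for x
    proof -
      \<comment> \<open>Stability of the images gives \<open>y\<close> with the same value after
        \<open>n\<close> steps as \<open>x\<close> needs after \<open>2n\<close>; then
        \<open>(f p ^^ n) y\<close> is the component of \<open>x\<close> in
        \<open>I p\<close>.\<close>
      have "(f p ^^ n) x \<in> (f p ^^ (n + n)) ` obj M p" using st[of "n + n"] x by simp
      then obtain y where y: "y \<in> obj M p" "(f p ^^ n) x = (f p ^^ (n + n)) y" by blast
      have "(f p ^^ n) (x - (f p ^^ n) y) = 0"
        using y endo_diff[OF fn p x, of "(f p ^^ n) y" n] endo_in[OF fn p y(1)] fadd[of n n p y]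
        by simp
      then have "x - (f p ^^ n) y \<in> K p"
        unfolding K_def using diff_in[OF p x endo_in[OF fn p y(1)]] by blast
      then show ?thesis using Ieq y(1) by blast
    qed
  qed
  obtain e where e: "endo Q M e" "idem Q M e" "\<And>p x. p \<in> Q \<Longrightarrow> x \<in> I p \<Longrightarrow> e p x = x"
    "\<And>p x. p \<in> Q \<Longrightarrow> x \<in> K p \<Longrightarrow> e p x = 0"
    using endo_projection[of I K, OF I1 I2 K1 K2 arrI arrK stab] by blast
  have "(f p0 ^^ n) x0 = x0" for n by (induction n) (use p0 in auto)
  then have "x0 \<in> I p0" unfolding I_def using p0(2) by (metis INT_I imageI)
  then have "e p0 x0 \<noteq> 0" using e(3) p0 by simp
  then have "e p x = x" using ind e(1,2) p0 p unfolding indecomposable_def by blast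
  moreover have "x \<in> K p" unfolding K_def using p by (auto intro: exI[of _ 1])
  ultimately show ?thesis using e(4) p(1) by simp
qed

end

section \<open>Decomposition into indecomposables\<close>

text \<open>
  The summands are the atoms of a maximal set of commuting idempotents. Such a set is closed under
  infima of arbitrary nonempty multiplicative subsets, because such an infimum is attained at
  each point.
\<close>

locale maximal_commuting = persistence_module Q M
  for Q :: "'p::order set" and M :: "('p, 'k::field, 'v::ab_group_add) persmod" +
  fixes BB :: "('p \<Rightarrow> 'v \<Rightarrow> 'v) set"
  assumes pfd: "pfd Q M"
    and BB_endo: "b \<in> BB \<Longrightarrow> endo Q M b"
    and BB_idem: "b \<in> BB \<Longrightarrow> p \<in> Q \<Longrightarrow> x \<in> obj M p \<Longrightarrow> b p (b p x) = b p x"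
    and BB_comm: "b \<in> BB \<Longrightarrow> c \<in> BB \<Longrightarrow> p \<in> Q \<Longrightarrow> x \<in> obj M p \<Longrightarrow> b p (c p x) = c p (b p x)"
    and BB_max: "endo Q M e \<Longrightarrow> idem Q M e \<Longrightarrow>
      (\<And>b p x. b \<in> BB \<Longrightarrow> p \<in> Q \<Longrightarrow> x \<in> obj M p \<Longrightarrow> e p (b p x) = b p (e p x)) \<Longrightarrow> e \<in> BB"
begin

lemma BB_in: "b \<in> BB \<Longrightarrow> p \<in> Q \<Longrightarrow> x \<in> obj M p \<Longrightarrow> b p x \<in> obj M p"
  using endo_in[OF BB_endo] by blast

lemma BB_id: "(\<lambda>p x. x) \<in> BB"
  by (rule BB_max[OF endo_id]) (auto simp: idem_def)

lemma BB_comp: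
  assumes b: "b \<in> BB" and c: "c \<in> BB"
  shows "(\<lambda>p x. b p (c p x)) \<in> BB"
proof (rule BB_max)
  show "endo Q M (\<lambda>p x. b p (c p x))" by (rule endo_comp[OF BB_endo[OF b] BB_endo[OF c]])
  show "idem Q M (\<lambda>p x. b p (c p x))"
    unfolding idem_def
    using BB_idem[OF b] BB_idem[OF c] BB_comm[OF b c] BB_in[OF b] BB_in[OF c] by simp
  show "b p (c p (d p x)) = d p (b p (c p x))" if "d \<in> BB" "p \<in> Q" "x \<in> obj M p" for d p x
    using that BB_comm[OF b that(1,2)] BB_comm[OF c that(1,2)] BB_in[OF c] BB_in[OF b] by simp
qed

lemma BB_diff:
  assumes b: "b \<in> BB" and c: "c \<in> BB"
    and bc: "\<And>p x. p \<in> Q \<Longrightarrow> x \<in> obj M p \<Longrightarrow> b p (c p x) = c p x"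
  shows "(\<lambda>p x. b p x - c p x) \<in> BB"
proof (rule BB_max)
  show "endo Q M (\<lambda>p x. b p x - c p x)" by (rule endo_minus[OF BB_endo[OF b] BB_endo[OF c]])
  have cb: "c p (b p x) = c p x" if "p \<in> Q" "x \<in> obj M p" for p x
    using BB_comm[OF c b that] bc[OF that] by simp
  show "idem Q M (\<lambda>p x. b p x - c p x)"
    unfolding idem_def
    using endo_diff[OF BB_endo[OF b]] endo_diff[OF BB_endo[OF c]] BB_in[OF b] BB_in[OF c]
      BB_idem[OF b] BB_idem[OF c] bc cb by simp
  show "b p (d p x) - c p (d p x) = d p (b p x - c p x)"
    if "d \<in> BB" "p \<in> Q" "x \<in> obj M p" for d p x
    using that BB_comm[OF b that] BB_comm[OF c that] endo_diff[OF BB_endo[OF that(1)] that(2)]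
      BB_in[OF b that(2,3)] BB_in[OF c that(2,3)] by simp
qed

lemma BB_complement: "b \<in> BB \<Longrightarrow> (\<lambda>p x. x - b p x) \<in> BB"
  using BB_diff[OF BB_id] by simp

text \<open>This is minimality among the nonzero members of \<open>BB\<close>, written as a
  dichotomy: of the two parts of \<open>e\<close> cut out by \<open>c\<close> and its complement,
  one vanishes.\<close>

definition atom :: "('p \<Rightarrow> 'v \<Rightarrow> 'v) \<Rightarrow> bool" where
  "atom e \<longleftrightarrow> e \<in> BB \<and> (\<exists>p\<in>Q. \<exists>x\<in>obj M p. e p x \<noteq> 0) \<and>
    (\<forall>c\<in>BB. (\<forall>p\<in>Q. \<forall>x\<in>obj M p. c p (e p x) = e p x) \<or> (\<forall>p\<in>Q. \<forall>x\<in>obj M p. c p (e p x) = 0))"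

lemma subspace_image: "b \<in> BB \<Longrightarrow> p \<in> Q \<Longrightarrow> subspace (b p ` obj M p) \<and> b p ` obj M p \<subseteq> obj M p"
  using subspace_endo_image[OF BB_endo] BB_in by blast

lemma fin_dim_obj: "p \<in> Q \<Longrightarrow> fin_dim (obj M p)"
  using pfd unfolding pfd_def by blast

text \<open>At each point take a member \<open>m\<close> with smallest image. For any other member
  \<open>c\<close> the product \<open>c m\<close> is again in \<open>S\<close> and its image lies in
  that of \<open>m\<close>, hence equals it, so \<open>c\<close> fixes the image of
  \<open>m\<close>.\<close>

lemma infimum_in_BB:
  assumes S: "S \<subseteq> BB" "S \<noteq> {}"
    and comp: "\<forall>b\<in>S. \<forall>c\<in>S. (\<lambda>p x. b p (c p x)) \<in> S"
  shows "\<exists>e\<in>BB. (\<forall>c\<in>S. \<forall>q\<in>Q. \<forall>x\<in>obj M q. c q (e q x) = e q x) \<and>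
    (\<forall>q\<in>Q. \<exists>m\<in>S. \<forall>x\<in>obj M q. e q x = m q x)"
proof -
  have ex: "\<exists>m\<in>S. \<forall>c\<in>S. \<forall>x\<in>obj M q. c q (m q x) = m q x" if q: "q \<in> Q" for q
  proof -
    obtain U where U: "U \<in> (\<lambda>c. c q ` obj M q) ` S"
      "\<And>U'. U' \<in> (\<lambda>c. c q ` obj M q) ` S \<Longrightarrow> U' \<subseteq> U \<Longrightarrow> U' = U"
    proof (rule fin_dim_minimal[OF fin_dim_obj[OF q], of "(\<lambda>c. c q ` obj M q) ` S"])
      show "(\<lambda>c. c q ` obj M q) ` S \<noteq> {}" using S(2) by blast
      fix U assume "U \<in> (\<lambda>c. c q ` obj M q) ` S"
      then obtain c where "c \<in> S" "U = c q ` obj M q" by blast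
      then show "subspace U \<and> U \<subseteq> obj M q" using subspace_image[OF _ q] S(1) by blast
    qed blast
    then obtain m where m: "m \<in> S" "U = m q ` obj M q" by blast
    have "c q (m q x) = m q x" if c: "c \<in> S" and x: "x \<in> obj M q" for c x
    proof -
      have cB: "c \<in> BB" "m \<in> BB" using c m S by blast+
      have "(\<lambda>x. c q (m q x)) ` obj M q \<subseteq> U"
      proof
        fix y assume "y \<in> (\<lambda>x. c q (m q x)) ` obj M q"
        then obtain z where z: "z \<in> obj M q" "y = c q (m q z)" by blast
        then show "y \<in> U" using BB_comm[OF cB q z(1)] BB_in[OF cB(1) q z(1)] m(2) by simp
      qed
      then have "(\<lambda>x. c q (m q x)) ` obj M q = U"
        using U(2) bspec[OF bspec[OF comp c] m(1)] by blast
      then obtain y where "y \<in> obj M q" "m q x = c q (m q y)"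
        using m(2) x by blast
      then show ?thesis using BB_idem[OF cB(1) q BB_in[OF cB(2) q]] by simp
    qed
    then show ?thesis using m(1) by blast
  qed
  have "\<forall>q\<in>Q. \<exists>m. m \<in> S \<and> (\<forall>c\<in>S. \<forall>x\<in>obj M q. c q (m q x) = m q x)"
    using ex by blast
  from bchoice[OF this] obtain m where m:
    "\<And>q. q \<in> Q \<Longrightarrow> m q \<in> S"
    "\<And>q c x. q \<in> Q \<Longrightarrow> c \<in> S \<Longrightarrow> x \<in> obj M q \<Longrightarrow> c q (m q q x) = m q q x"
    by blast
  have mB: "m q \<in> BB" if "q \<in> Q" for q using m(1)[OF that] S(1) by blast
  show ?thesis
  proof (rule bexI[of _ "\<lambda>q x. m q q x"])
    show "(\<lambda>q x. m q q x) \<in> BB"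
    proof (rule BB_max)
      show "endo Q M (\<lambda>q x. m q q x)"
      proof (rule endoI)
        fix p q x assume pq: "p \<in> Q" "q \<in> Q" "p \<le> q" and x: "x \<in> obj M p"
        have a: "arr M p q x \<in> obj M q" by (rule arr_in[OF pq x])
        \<comment> \<open>The members chosen at \<open>p\<close> and at \<open>q\<close> may differ.
          Their product coincides with \<open>m q\<close> at the point \<open>q\<close> and with
          \<open>m p\<close> at the point \<open>p\<close>, and a product of natural maps is
          natural.\<close>
        have "m q q (arr M p q x) = m p q (m q q (arr M p q x))"
          using m(2)[OF pq(2) m(1)[OF pq(1)] a] by simp
        also have "\<dots> = arr M p q (m p p (m q p x))"
          using endo_arr[OF BB_endo[OF mB[OF pq(2)]] pq x]
            endo_arr[OF BB_endo[OF mB[OF pq(1)]] pq BB_in[OF mB[OF pq(2)] pq(1) x]] by simp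
        also have "m p p (m q p x) = m p p x"
          using BB_comm[OF mB[OF pq(1)] mB[OF pq(2)] pq(1) x] m(2)[OF pq(1) m(1)[OF pq(2)] x]
          by simp
        finally show "m q q (arr M p q x) = arr M p q (m p p x)" .
      qed (use mB BB_in endo_add[OF BB_endo[OF mB]] endo_scl[OF BB_endo[OF mB]] in auto)
      show "idem Q M (\<lambda>q x. m q q x)" unfolding idem_def using mB BB_idem by simp
      show "m p p (b p x) = b p (m p p x)" if "b \<in> BB" "p \<in> Q" "x \<in> obj M p" for b p x
        using BB_comm[OF mB that(1)] that by simp
    qed
  qed (use m in auto)
qed

text \<open>A member with smallest nonzero image \<open>V\<close> at \<open>p\<close> may still be
  divisible at other points. The infimum \<open>e\<close> of all members fixing \<open>V\<close> is
  not: a member \<open>c\<close> that is nonzero on \<open>V\<close> fixes \<open>V\<close> by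
  minimality and so lies in \<open>S\<close>, and if \<open>c\<close> kills \<open>V\<close> then
  its complement lies in \<open>S\<close>.\<close>

lemma atom_below:
  assumes b: "b \<in> BB" and p: "p \<in> Q" and x: "x \<in> obj M p" "b p x \<noteq> 0"
  obtains e where "atom e" "\<exists>x\<in>obj M p. e p x \<noteq> 0"
    "\<And>q x. q \<in> Q \<Longrightarrow> x \<in> obj M q \<Longrightarrow> b q (e q x) = e q x"
proof -
  define C where "C = {c \<in> BB. (\<exists>x\<in>obj M p. c p x \<noteq> 0) \<and>
    (\<forall>q\<in>Q. \<forall>x\<in>obj M q. b q (c q x) = c q x)}"
  have bC: "b \<in> C" using assms BB_idem unfolding C_def by blast
  obtain V where V: "V \<in> (\<lambda>c. c p ` obj M p) ` C"
    "\<And>U'. U' \<in> (\<lambda>c. c p ` obj M p) ` C \<Longrightarrow> U' \<subseteq> V \<Longrightarrow> U' = V"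
  proof (rule fin_dim_minimal[OF fin_dim_obj[OF p], of "(\<lambda>c. c p ` obj M p) ` C"])
    show "(\<lambda>c. c p ` obj M p) ` C \<noteq> {}" using bC by blast
    fix U assume "U \<in> (\<lambda>c. c p ` obj M p) ` C"
    then obtain c where "c \<in> C" "U = c p ` obj M p" by blast
    then show "subspace U \<and> U \<subseteq> obj M p" using subspace_image[OF _ p] unfolding C_def by blast
  qed blast
  then obtain a where a: "a \<in> C" "V = a p ` obj M p" by blast
  have aB: "a \<in> BB" and ba: "\<And>q x. q \<in> Q \<Longrightarrow> x \<in> obj M q \<Longrightarrow> b q (a q x) = a q x"
    using a(1) unfolding C_def by blast+
  have Vin: "V \<subseteq> obj M p" using subspace_image[OF aB p] a(2) by blast
  define S where "S = {c \<in> BB. \<forall>v\<in>V. c p v = v}"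
  have aS: "a \<in> S" using aB a(2) BB_idem[OF aB p] unfolding S_def by blast
  have bS: "b \<in> S" using b a(2) ba[OF p] unfolding S_def by blast
  have SB: "S \<subseteq> BB" unfolding S_def by blast
  have Sc: "\<forall>c\<in>S. \<forall>d\<in>S. (\<lambda>p x. c p (d p x)) \<in> S"
    using BB_comp unfolding S_def by simp
  have "S \<noteq> {}" using bS by blast
  obtain e where e: "e \<in> BB" "\<And>c q x. c \<in> S \<Longrightarrow> q \<in> Q \<Longrightarrow> x \<in> obj M q \<Longrightarrow> c q (e q x) = e q x"
    "\<And>q. q \<in> Q \<Longrightarrow> \<exists>m\<in>S. \<forall>x\<in>obj M q. e q x = m q x"
    using infimum_in_BB[OF SB \<open>S \<noteq> {}\<close> Sc] by auto
  obtain m where m: "m \<in> S" "\<forall>x\<in>obj M p. e p x = m p x" using e(3)[OF p] by blast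
  have eV: "e p v = v" if "v \<in> V" for v using m that Vin unfolding S_def by auto
  obtain y where y: "y \<in> obj M p" "a p y \<noteq> 0" using a(1) unfolding C_def by blast
  have e0: "\<exists>x\<in>obj M p. e p x \<noteq> 0"
    using eV[of "a p y"] y a(2) Vin by (intro bexI[of _ "a p y"]) auto
  have "atom e"
    unfolding atom_def
  proof (intro conjI ballI e(1))
    show "\<exists>p\<in>Q. \<exists>x\<in>obj M p. e p x \<noteq> 0" using e0 p by blast
    fix c assume c: "c \<in> BB"
    show "(\<forall>p\<in>Q. \<forall>x\<in>obj M p. c p (e p x) = e p x) \<or> (\<forall>p\<in>Q. \<forall>x\<in>obj M p. c p (e p x) = 0)"
    proof (cases "\<exists>x\<in>obj M p. c p (a p x) \<noteq> 0")
      case True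
      have "(\<lambda>p x. c p (a p x)) \<in> C"
        unfolding C_def using True BB_comp[OF c aB] BB_comm[OF b c _ BB_in[OF aB]] ba by simp
      moreover have "(\<lambda>x. c p (a p x)) ` obj M p \<subseteq> V"
        using BB_comm[OF c aB p] BB_in[OF c p] a(2) by auto
      ultimately have Veq: "(\<lambda>x. c p (a p x)) ` obj M p = V" using V(2) by blast
      have "c p v = v" if v: "v \<in> V" for v
      proof -
        obtain z where "z \<in> obj M p" "v = c p (a p z)" using Veq v by blast
        then show ?thesis using BB_idem[OF c p BB_in[OF aB p]] by simp
      qed
      then have "c \<in> S" unfolding S_def using c by blast
      then show ?thesis using e(2) by blast
    next
      case False
      have "(\<lambda>p x. x - c p x) \<in> S"
        unfolding S_def using BB_complement[OF c] False a(2) by auto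
      then have "e q x - c q (e q x) = e q x" if "q \<in> Q" "x \<in> obj M q" for q x
        using e(2) that by blast
      then show ?thesis by simp
    qed
  qed
  then show ?thesis using that e0 e(2)[OF bS] by blast
qed

text \<open>An idempotent \<open>g\<close> of the summand extends to \<open>M\<close> as
  \<open>g\<close> after \<open>e\<close>. Every member of \<open>BB\<close> acts on the image of
  \<open>e\<close> as zero or as the identity, so the extension commutes with all of
  \<open>BB\<close> and belongs to it by maximality. The dichotomy for atoms then makes it
  trivial.\<close>

lemma atom_indecomposable:
  assumes e: "atom e"
  shows "indecomposable Q (image_mod M e)"
  unfolding indecomposable_def
proof (intro allI impI)
  fix g assume g: "endo Q (image_mod M e) g \<and> idem Q (image_mod M e) g"
  have eB: "e \<in> BB" using e unfolding atom_def by blast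
  have g_in: "\<exists>y\<in>obj M p. g p (e p x) = e p y" if "p \<in> Q" "x \<in> obj M p" for p x
    using endo_in[OF conjunct1[OF g], of p "e p x"] that by auto
  have eg: "e p (g p (e p x)) = g p (e p x)" if "p \<in> Q" "x \<in> obj M p" for p x
    using g_in[OF that] BB_idem[OF eB that(1)] by auto
  have ge_in: "g p (e p x) \<in> obj M p" if "p \<in> Q" "x \<in> obj M p" for p x
    using g_in[OF that] BB_in[OF eB that(1)] by auto
  have g0: "g p 0 = 0" if "p \<in> Q" for p
    using persistence_module.endo_zero[OF persistence_module_image[OF BB_endo[OF eB]]] g that by blast
  have "(\<lambda>p x. g p (e p x)) \<in> BB"
  proof (rule BB_max)
    show "endo Q M (\<lambda>p x. g p (e p x))"
    proof (rule endoI)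
      fix p x assume p: "p \<in> Q" and x: "x \<in> obj M p"
      show "g p (e p x) \<in> obj M p" by (rule ge_in[OF p x])
      show "g p (e p (scl M c x)) = scl M c (g p (e p x))" for c
        using endo_scl[OF BB_endo[OF eB] p x] endo_scl[OF conjunct1[OF g] p, of "e p x"] x by simp
      show "g p (e p (x + y)) = g p (e p x) + g p (e p y)" if "y \<in> obj M p" for y
        using endo_add[OF BB_endo[OF eB] p x that] endo_add[OF conjunct1[OF g] p, of "e p x" "e p y"]
          x that by simp
      show "g q (e q (arr M p q x)) = arr M p q (g p (e p x))" if q: "q \<in> Q" "p \<le> q" for q
        using endo_arr[OF BB_endo[OF eB] p q x] endo_arr[OF conjunct1[OF g] p q, of "e p x"] x by simp
    qed
    have "g p (g p (e p x)) = g p (e p x)" if "p \<in> Q" "x \<in> obj M p" for p x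
      using g that unfolding idem_def by auto
    then show "idem Q M (\<lambda>p x. g p (e p x))" unfolding idem_def using eg by simp
    fix c p x assume c: "c \<in> BB" and p: "p \<in> Q" and x: "x \<in> obj M p"
    obtain y where y: "y \<in> obj M p" "g p (e p x) = e p y" using g_in[OF p x] by blast
    have "(\<forall>p\<in>Q. \<forall>x\<in>obj M p. c p (e p x) = e p x) \<or> (\<forall>p\<in>Q. \<forall>x\<in>obj M p. c p (e p x) = 0)"
      using e c unfolding atom_def by blast
    then show "g p (e p (c p x)) = c p (g p (e p x))"
      using BB_comm[OF eB c p x] p x y g0[OF p] by auto
  qed
  note mem = this
  have at: "\<forall>c\<in>BB. (\<forall>p\<in>Q. \<forall>x\<in>obj M p. c p (e p x) = e p x) \<or>
      (\<forall>p\<in>Q. \<forall>x\<in>obj M p. c p (e p x) = 0)"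
    using e unfolding atom_def by blast
  note bspec[OF at mem]
  then show "(\<forall>p\<in>Q. \<forall>x\<in>obj (image_mod M e) p. g p x = 0) \<or>
      (\<forall>p\<in>Q. \<forall>x\<in>obj (image_mod M e) p. g p x = x)"
    using BB_idem[OF eB] by auto
qed

lemma atoms_orthogonal_or_equal:
  assumes e: "atom e" and f: "atom f" and pq: "p \<in> Q" "q \<in> Q" and x: "x \<in> obj M p" and y: "y \<in> obj M q"
    and ne: "e p x \<noteq> f p x"
  shows "e q (f q y) = 0"
proof (rule ccontr)
  assume n0: "e q (f q y) \<noteq> 0"
  have eB: "e \<in> BB" and fB: "f \<in> BB" using e f unfolding atom_def by blast+
  have "\<forall>p\<in>Q. \<forall>x\<in>obj M p. e p (f p x) = f p x" using f eB n0 pq y unfolding atom_def by blast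
  moreover have "\<forall>p\<in>Q. \<forall>x\<in>obj M p. f p (e p x) = e p x"
    using e fB n0 pq y BB_comm[OF eB fB pq(2) y] unfolding atom_def by auto
  ultimately show False using ne BB_comm[OF eB fB pq(1) x] pq x by simp
qed

text \<open>Extensional functions, so that distinct atoms are orthogonal.\<close>

definition ext_atoms :: "('p \<Rightarrow> 'v \<Rightarrow> 'v) set" where
  "ext_atoms = {e. atom e \<and> (\<forall>p x. p \<notin> Q \<or> x \<notin> obj M p \<longrightarrow> e p x = 0)}"

lemma ext_atomE:
  assumes e: "atom e"
  obtains f where "f \<in> ext_atoms" "\<And>p x. p \<in> Q \<Longrightarrow> x \<in> obj M p \<Longrightarrow> f p x = e p x"
proof
  let ?f = "\<lambda>p x. if p \<in> Q \<and> x \<in> obj M p then e p x else 0"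
  have eB: "e \<in> BB" using e unfolding atom_def by blast
  have "?f \<in> BB"
  proof (rule BB_max)
    show "endo Q M ?f"
      using BB_endo[OF eB] add_in scl_in arr_in unfolding endo_def by simp
    show "idem Q M ?f" unfolding idem_def using BB_idem[OF eB] BB_in[OF eB] by simp
    show "?f p (b p x) = b p (?f p x)" if "b \<in> BB" "p \<in> Q" "x \<in> obj M p" for b p x
      using that BB_comm[OF eB that] BB_in[OF that] by simp
  qed
  then show "?f \<in> ext_atoms" using e unfolding ext_atoms_def atom_def by simp
qed simp

lemma ext_atoms_orthogonal:
  assumes "e \<in> ext_atoms" "f \<in> ext_atoms" "e \<noteq> f" "q \<in> Q" "y \<in> obj M q"
  shows "e q (f q y) = 0"
proof -
  obtain p x where px: "e p x \<noteq> f p x" using assms(3) by (meson ext)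
  have "p \<in> Q \<and> x \<in> obj M p"
  proof (rule ccontr)
    assume "\<not> (p \<in> Q \<and> x \<in> obj M p)"
    then have "e p x = 0" "f p x = 0" using assms(1,2) unfolding ext_atoms_def by auto
    then show False using px by simp
  qed
  then show ?thesis using atoms_orthogonal_or_equal px assms unfolding ext_atoms_def by blast
qed

text \<open>Split atoms off the identity one at a time, with remainder \<open>b\<close>. An atom
  below \<open>b\<close> that is nonzero at \<open>p\<close> makes the image of the remainder at
  \<open>p\<close> strictly smaller, so a remainder with minimal image vanishes at
  \<open>p\<close>.\<close>

lemma ext_atoms_complete:
  assumes p: "p \<in> Q"
  obtains S where "S \<subseteq> ext_atoms" "finite S" "\<And>x. x \<in> obj M p \<Longrightarrow> x = (\<Sum>e\<in>S. e p x)"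
proof -
  define W where "W = {(S, b). S \<subseteq> ext_atoms \<and> finite S \<and> b \<in> BB \<and>
    (\<forall>x\<in>obj M p. x = (\<Sum>e\<in>S. e p x) + b p x) \<and>
    (\<forall>e\<in>S. \<forall>q\<in>Q. \<forall>x\<in>obj M q. e q (b q x) = 0)}"
  have W0: "({}, \<lambda>p x. x) \<in> W" unfolding W_def using BB_id by simp
  obtain U where U: "U \<in> (\<lambda>(S, b). b p ` obj M p) ` W"
    "\<And>U'. U' \<in> (\<lambda>(S, b). b p ` obj M p) ` W \<Longrightarrow> U' \<subseteq> U \<Longrightarrow> U' = U"
  proof (rule fin_dim_minimal[OF fin_dim_obj[OF p], of "(\<lambda>(S, b). b p ` obj M p) ` W"])
    show "(\<lambda>(S, b). b p ` obj M p) ` W \<noteq> {}" using W0 by blast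
    fix U assume "U \<in> (\<lambda>(S, b). b p ` obj M p) ` W"
    then obtain b where "b \<in> BB" "U = b p ` obj M p" unfolding W_def by auto
    then show "subspace U \<and> U \<subseteq> obj M p" using subspace_image[OF _ p] by blast
  qed blast
  from U(1) obtain S b where Sb: "(S, b) \<in> W" and Ub: "U = b p ` obj M p"
    by (elim imageE) auto
  have S: "S \<subseteq> ext_atoms" "finite S" and bB: "b \<in> BB"
    and dec: "\<And>x. x \<in> obj M p \<Longrightarrow> x = (\<Sum>e\<in>S. e p x) + b p x"
    and orth: "\<And>e q x. e \<in> S \<Longrightarrow> q \<in> Q \<Longrightarrow> x \<in> obj M q \<Longrightarrow> e q (b q x) = 0"
    using Sb unfolding W_def by blast+
  have "b p x = 0" if x: "x \<in> obj M p" for x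
  proof (rule ccontr)
    assume "b p x \<noteq> 0"
    then obtain e' where e': "atom e'" "\<exists>x\<in>obj M p. e' p x \<noteq> 0"
      "\<And>q x. q \<in> Q \<Longrightarrow> x \<in> obj M q \<Longrightarrow> b q (e' q x) = e' q x"
      using atom_below[OF bB p x] by blast
    obtain e where e: "e \<in> ext_atoms" "\<And>p x. p \<in> Q \<Longrightarrow> x \<in> obj M p \<Longrightarrow> e p x = e' p x"
      using ext_atomE[OF e'(1)] by blast
    have eB: "e \<in> BB" using e(1) unfolding ext_atoms_def atom_def by blast
    have be: "b q (e q x) = e q x" if "q \<in> Q" "x \<in> obj M q" for q x
      using e'(3) e(2) that by simp
    have eb: "e q (b q x) = e q x" if "q \<in> Q" "x \<in> obj M q" for q x
      using be[OF that] BB_comm[OF eB bB that] by simp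
    obtain z where z: "z \<in> obj M p" "e p z \<noteq> 0" using e'(2) e(2)[OF p] by auto
    have eS: "e \<notin> S" using orth[OF _ p z(1), of e] eb[OF p z(1)] z(2) by auto
    let ?b = "\<lambda>q x. b q x - e q x"
    have "?b \<in> BB" by (rule BB_diff[OF bB eB be])
    moreover have "e'' q (b q x - e q x) = 0" if "e'' \<in> insert e S" "q \<in> Q" "x \<in> obj M q" for e'' q x
    proof (cases "e'' = e")
      case True
      then show ?thesis
        using endo_diff[OF BB_endo[OF eB] that(2)] BB_in[OF bB that(2,3)] BB_in[OF eB that(2,3)]
          eb[OF that(2,3)] BB_idem[OF eB that(2,3)] by simp
    next
      case False
      then have e'': "e'' \<in> S" "e'' \<in> BB" using that(1) S(1) unfolding ext_atoms_def atom_def by auto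
      then show ?thesis
        using endo_diff[OF BB_endo[OF e''(2)] that(2)] BB_in[OF bB that(2,3)] BB_in[OF eB that(2,3)]
          orth[OF e''(1) that(2,3)] orth[OF e''(1) that(2) BB_in[OF eB that(2,3)]] be[OF that(2,3)]
        by simp
    qed
    moreover have "x = (\<Sum>e\<in>insert e S. e p x) + (b p x - e p x)" if "x \<in> obj M p" for x
      using dec[OF that] S(2) eS by simp
    ultimately have "(insert e S, ?b) \<in> W"
      unfolding W_def using S e(1) by blast
    then have "?b p ` obj M p \<in> (\<lambda>(S, b). b p ` obj M p) ` W" by (force intro: image_eqI)
    moreover have "?b p ` obj M p \<subseteq> U"
    proof
      fix y assume "y \<in> ?b p ` obj M p"
      then obtain x where x: "x \<in> obj M p" "y = b p x - e p x" by blast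
      then have "y = b p (x - e p x)"
        using endo_diff[OF BB_endo[OF bB] p x(1) BB_in[OF eB p x(1)]] be[OF p x(1)] by simp
      then show "y \<in> U" using Ub diff_in[OF p x(1) BB_in[OF eB p x(1)]] by blast
    qed
    ultimately have eq: "?b p ` obj M p = U" by (rule U(2))
    \<comment> \<open>If the image had not shrunk, the nonzero vector \<open>e p z\<close> would
      have the form \<open>b p y - e p y\<close>. But \<open>e\<close> kills such vectors and fixes
      \<open>e p z\<close>.\<close>
    have "e p z \<in> U" using Ub be[OF p z(1), symmetric] BB_in[OF eB p z(1)] by blast
    then obtain y where y: "y \<in> obj M p" "e p z = b p y - e p y" using eq by blast
    have "e p (e p z) = 0"
      unfolding y(2) using endo_diff[OF BB_endo[OF eB] p] BB_in[OF bB p y(1)] BB_in[OF eB p y(1)]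
          eb[OF p y(1)] BB_idem[OF eB p y(1)] by simp
    then show False using z BB_idem[OF eB p z(1)] by simp
  qed
  then show ?thesis using that[OF S] dec by simp
qed

end

context persistence_module
begin

theorem decomposition_into_indecomposables:
  assumes pfd: "pfd Q M"
  obtains A where
    "\<And>e. e \<in> A \<Longrightarrow> endo Q M e" "\<And>e. e \<in> A \<Longrightarrow> idem Q M e"
    "\<And>e. e \<in> A \<Longrightarrow> indecomposable Q (image_mod M e)"
    "\<And>e. e \<in> A \<Longrightarrow> \<exists>p\<in>Q. \<exists>x\<in>obj M p. e p x \<noteq> 0"
    "\<And>e f p x. e \<in> A \<Longrightarrow> f \<in> A \<Longrightarrow> e \<noteq> f \<Longrightarrow> p \<in> Q \<Longrightarrow> x \<in> obj M p \<Longrightarrow> e p (f p x) = 0"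
    "\<And>p. p \<in> Q \<Longrightarrow> \<exists>S\<subseteq>A. finite S \<and> (\<forall>x\<in>obj M p. x = (\<Sum>e\<in>S. e p x))"
proof -
  define comm where "comm b c \<longleftrightarrow> (\<forall>p\<in>Q. \<forall>x\<in>obj M p. b p (c p x) = c p (b p x))" for b c
  define F where "F = {B. (\<forall>b\<in>B. endo Q M b \<and> idem Q M b) \<and> (\<forall>b\<in>B. \<forall>c\<in>B. comm b c)}"
  have "\<exists>B\<in>F. \<forall>X\<in>F. B \<subseteq> X \<longrightarrow> X = B"
  proof (rule subset_Zorn')
    fix C assume C: "subset.chain F C"
    have CF: "X \<in> F" if "X \<in> C" for X using C that unfolding subset_chain_def by blast
    have "comm b c" if "b \<in> X" "X \<in> C" "c \<in> Y" "Y \<in> C" for b c X Y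
    proof -
      have "X \<subseteq> Y \<or> Y \<subseteq> X" using C that unfolding subset_chain_def by blast
      then show ?thesis using CF that unfolding F_def by blast
    qed
    then show "\<Union> C \<in> F" using CF unfolding F_def by blast
  qed
  then obtain B where B: "B \<in> F" "\<And>X. X \<in> F \<Longrightarrow> B \<subseteq> X \<Longrightarrow> X = B" by blast
  interpret maximal_commuting Q M B
  proof unfold_locales
    fix e assume e: "endo Q M e" "idem Q M e"
      and c: "\<And>b p x. b \<in> B \<Longrightarrow> p \<in> Q \<Longrightarrow> x \<in> obj M p \<Longrightarrow> e p (b p x) = b p (e p x)"
    have "insert e B \<in> F" using B(1) e c unfolding F_def comm_def by simp
    then show "e \<in> B" using B(2) by blast
  qed (use B(1) pfd in \<open>auto simp: F_def comm_def idem_def\<close>)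
  have at: "atom e" "e \<in> B" if "e \<in> ext_atoms" for e
    using that unfolding ext_atoms_def atom_def by blast+
  show ?thesis
  proof (rule that[of ext_atoms])
    show "\<exists>S\<subseteq>ext_atoms. finite S \<and> (\<forall>x\<in>obj M p. x = (\<Sum>e\<in>S. e p x))" if "p \<in> Q" for p
      using ext_atoms_complete[OF that] by metis
  next
    fix e assume e: "e \<in> ext_atoms"
    show "endo Q M e" "indecomposable Q (image_mod M e)"
      using at[OF e] BB_endo atom_indecomposable by blast+
    show "\<exists>p\<in>Q. \<exists>x\<in>obj M p. e p x \<noteq> 0" using at[OF e] unfolding atom_def by blast
    show "idem Q M e" using at[OF e] B(1) unfolding F_def by blast
  qed (use ext_atoms_orthogonal in blast)
qed

end

section \<open>Linear compactness\<close>

text \<open>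
  \<open>W G\<close> is the solution space of the homogeneous linear constraints supported on the finite set
  \<open>G\<close> of variables.
\<close>

locale linear_constraints = linear_space scale
  for scale :: "'a::field \<Rightarrow> 'b::ab_group_add \<Rightarrow> 'b" +
  fixes V :: "'x \<Rightarrow> 'b set" and W :: "'x set \<Rightarrow> ('x \<Rightarrow> 'b) set"
  assumes V: "fin_dim (V x)"
    and WV: "w \<in> W G \<Longrightarrow> w x \<in> V x"
    and W_antimono: "G \<subseteq> G' \<Longrightarrow> W G' \<subseteq> W G"
    and W_zero: "(\<lambda>x. 0) \<in> W G"
    and W_add: "w \<in> W G \<Longrightarrow> w' \<in> W G \<Longrightarrow> (\<lambda>x. w x + w' x) \<in> W G"
    and W_scale: "w \<in> W G \<Longrightarrow> (\<lambda>x. scale c (w x)) \<in> W G"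
begin

lemma W_diff: "w \<in> W G \<Longrightarrow> w' \<in> W G \<Longrightarrow> (\<lambda>x. w x - w' x) \<in> W G"
  using W_add[of w G "\<lambda>x. scale (- 1) (w' x)"] W_scale[of w' G "- 1"] by simp

text \<open>The values at \<open>y\<close> of solutions vanishing on \<open>S\<close> form subspaces
  of \<open>V y\<close> that shrink as \<open>G\<close> grows. Once this subspace is minimal,
  further constraints do not remove any value.\<close>

lemma stable_values:
  fixes S :: "'x set" and y :: 'x
  shows "\<exists>G. finite G \<and> y \<in> G \<and>
    (\<forall>G' w. finite G' \<longrightarrow> G \<subseteq> G' \<longrightarrow> w \<in> W G \<longrightarrow> (\<forall>x\<in>S \<inter> G. w x = 0) \<longrightarrow>
      (\<exists>w'\<in>W G'. (\<forall>x\<in>S \<inter> G'. w' x = 0) \<and> w' y = w y))"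
proof -
  define L where "L G = {w y |w. w \<in> W G \<and> (\<forall>x\<in>S \<inter> G. w x = 0)}" for G
  have sub: "subspace (L G) \<and> L G \<subseteq> V y" for G
  proof
    show "subspace (L G)"
    proof (rule subspaceI)
      show "0 \<in> L G" unfolding L_def using W_zero[of G] by (auto intro!: exI[of _ "\<lambda>x. 0"])
      fix a b c assume "a \<in> L G"
      then obtain w where w: "w \<in> W G" "\<forall>x\<in>S \<inter> G. w x = 0" "a = w y" unfolding L_def by blast
      then show "scale c a \<in> L G"
        unfolding L_def using W_scale[of w G c] by (auto intro!: exI[of _ "\<lambda>x. scale c (w x)"])
      assume "b \<in> L G"
      then obtain w' where w': "w' \<in> W G" "\<forall>x\<in>S \<inter> G. w' x = 0" "b = w' y"
        unfolding L_def by blast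
      then show "a + b \<in> L G"
        unfolding L_def using w W_add[of w G w'] by (auto intro!: exI[of _ "\<lambda>x. w x + w' x"])
    qed
    show "L G \<subseteq> V y" using WV unfolding L_def by blast
  qed
  obtain U where U: "U \<in> L ` {G. finite G \<and> y \<in> G}"
    "\<And>U'. U' \<in> L ` {G. finite G \<and> y \<in> G} \<Longrightarrow> U' \<subseteq> U \<Longrightarrow> U' = U"
  proof (rule fin_dim_minimal[OF V[of y], of "L ` {G. finite G \<and> y \<in> G}"])
    have "{y} \<in> {G. finite G \<and> y \<in> G}" by simp
    then show "L ` {G. finite G \<and> y \<in> G} \<noteq> {}" by blast
    show "subspace U \<and> U \<subseteq> V y" if "U \<in> L ` {G. finite G \<and> y \<in> G}" for U
      using that sub by auto
  qed (rule that)
  then obtain G where G: "finite G" "y \<in> G" "U = L G" by blast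
  show ?thesis
  proof (intro exI conjI allI impI, rule G(1), rule G(2))
    fix G' w assume G': "finite G'" "G \<subseteq> G'" and w: "w \<in> W G" "\<forall>x\<in>S \<inter> G. w x = 0"
    have "L G' \<subseteq> L G" unfolding L_def using W_antimono[OF G'(2)] G'(2) by blast
    then have "L G' = L G" using U(2)[of "L G'"] G G' by blast
    moreover have "w y \<in> L G" unfolding L_def using w by blast
    ultimately have "w y \<in> L G'" by simp
    then show "\<exists>w'\<in>W G'. (\<forall>x\<in>S \<inter> G'. w' x = 0) \<and> w' y = w y"
      unfolding L_def by auto
  qed
qed

text \<open>The new value is \<open>w0 y\<close> for a solution \<open>w0\<close> over a set
  \<open>G0\<close> at which the values at \<open>y\<close> have stabilised. A solution
  \<open>w1\<close> over a larger set is corrected at \<open>y\<close> by a solution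
  \<open>w2\<close> vanishing on \<open>S\<close>; the difference of \<open>w0\<close> and
  \<open>w1\<close> shows that the required correction is an admissible value.\<close>

lemma finitely_solvable_extend:
  assumes good: "\<And>G. finite G \<Longrightarrow> \<exists>w\<in>W G. \<forall>x\<in>S \<inter> G. w x = v x"
  shows "\<exists>b. \<forall>G. finite G \<longrightarrow> (\<exists>w\<in>W G. \<forall>x\<in>insert y S \<inter> G. w x = (if x \<in> S then v x else b))"
proof -
  obtain G0 where G0: "finite G0" "\<forall>G' w. finite G' \<longrightarrow> G0 \<subseteq> G' \<longrightarrow> w \<in> W G0 \<longrightarrow>
      (\<forall>x\<in>S \<inter> G0. w x = 0) \<longrightarrow> (\<exists>w'\<in>W G'. (\<forall>x\<in>S \<inter> G'. w' x = 0) \<and> w' y = w y)"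
    using stable_values[of y S] by (elim exE conjE)
  obtain w0 where w0: "w0 \<in> W G0" "\<forall>x\<in>S \<inter> G0. w0 x = v x" using good[OF G0(1)] by blast
  have "\<exists>w\<in>W G. \<forall>x\<in>insert y S \<inter> G. w x = (if x \<in> S then v x else w0 y)" if G: "finite G" for G
  proof -
    have fin: "finite (G \<union> G0)" using G G0(1) by blast
    obtain w1 where w1: "w1 \<in> W (G \<union> G0)" "\<forall>x\<in>S \<inter> (G \<union> G0). w1 x = v x"
      using good[OF fin] by blast
    have "w1 \<in> W G0" using w1(1) W_antimono[of G0 "G \<union> G0"] by blast
    then have d: "(\<lambda>x. w0 x - w1 x) \<in> W G0" by (rule W_diff[OF w0(1)])
    have "w0 x - w1 x = 0" if "x \<in> S \<inter> G0" for x using w0(2) w1(2) that by auto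
    then obtain w2 where w2: "w2 \<in> W (G \<union> G0)" "\<forall>x\<in>S \<inter> (G \<union> G0). w2 x = 0" "w2 y = w0 y - w1 y"
      using G0(2)[rule_format, OF fin _ d] by auto
    have "(\<lambda>x. w1 x + w2 x) \<in> W G"
      using W_add[OF w1(1) w2(1)] W_antimono[of G "G \<union> G0"] by blast
    moreover have "w1 x + w2 x = (if x \<in> S then v x else w0 y)" if "x \<in> insert y S \<inter> G" for x
      using that w1(2) w2(2,3) by auto
    ultimately show ?thesis by (intro bexI[of _ "\<lambda>x. w1 x + w2 x"] ballI) auto
  qed
  then show ?thesis by blast
qed

text \<open>Zorn's lemma applied to graphs of partial assignments that remain compatible with every
  finite set of constraints. A maximal one is total by
  \<open>finitely_solvable_extend\<close>.\<close>

lemma finitely_solvable_imp_solvable: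
  assumes good: "\<And>G. finite G \<Longrightarrow> \<exists>w\<in>W G. \<forall>x\<in>S \<inter> G. w x = v x"
  obtains u where "\<And>x. x \<in> S \<Longrightarrow> u x = v x" "\<And>G. finite G \<Longrightarrow> \<exists>w\<in>W G. \<forall>x\<in>G. w x = u x"
proof -
  define P where "P \<Gamma> \<longleftrightarrow> (\<forall>G. finite G \<longrightarrow> (\<exists>w\<in>W G. \<forall>x b. (x, b) \<in> \<Gamma> \<and> x \<in> G \<longrightarrow> w x = b))"
    for \<Gamma>
  define \<Gamma>0 where "\<Gamma>0 = {(x, v x) |x. x \<in> S}"
  define F where "F = {\<Gamma>. \<Gamma>0 \<subseteq> \<Gamma> \<and> P \<Gamma>}"
  have "P \<Gamma>0"
    unfolding P_def
  proof (intro allI impI)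
    fix G :: "'x set" assume "finite G"
    then obtain w where "w \<in> W G" "\<forall>x\<in>S \<inter> G. w x = v x" using good by blast
    then show "\<exists>w\<in>W G. \<forall>x b. (x, b) \<in> \<Gamma>0 \<and> x \<in> G \<longrightarrow> w x = b"
      unfolding \<Gamma>0_def by (intro bexI[of _ w]) auto
  qed
  then have "\<Gamma>0 \<in> F" unfolding F_def by blast
  \<comment> \<open>Testing against the one-element set \<open>{x}\<close> already forces the
    relation to be single-valued.\<close>
  have sv: "b = b'" if "P \<Gamma>" "(x, b) \<in> \<Gamma>" "(x, b') \<in> \<Gamma>" for \<Gamma> x b b'
  proof -
    have "\<exists>w\<in>W {x}. \<forall>z b. (z, b) \<in> \<Gamma> \<and> z \<in> {x} \<longrightarrow> w z = b"
      using that(1) unfolding P_def by blast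
    then show ?thesis using that(2,3) by blast
  qed
  have "\<exists>\<Gamma>\<in>F. \<forall>X\<in>F. \<Gamma> \<subseteq> X \<longrightarrow> X = \<Gamma>"
  proof (rule subset_Zorn_nonempty)
    show "F \<noteq> {}" using \<open>\<Gamma>0 \<in> F\<close> by blast
    fix C assume C: "C \<noteq> {}" "subset.chain F C"
    have CF: "X \<in> F" if "X \<in> C" for X using C(2) that unfolding subset_chain_def by blast
    have svU: "b = b'" if bb: "(x, b) \<in> \<Union>C" "(x, b') \<in> \<Union>C" for x b b'
    proof -
      obtain X Y where XY: "(x, b) \<in> X" "X \<in> C" "(x, b') \<in> Y" "Y \<in> C" using bb by blast
      then have "X \<subseteq> Y \<or> Y \<subseteq> X" using C(2) unfolding subset_chain_def by blast
      then obtain Z where Z: "Z \<in> C" "(x, b) \<in> Z" "(x, b') \<in> Z" using XY by blast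
      have "P Z" using CF[OF Z(1)] unfolding F_def by simp
      then show ?thesis using Z(2,3) by (rule sv)
    qed
    have "P (\<Union>C)"
      unfolding P_def
    proof (intro allI impI)
      fix G :: "'x set" assume G: "finite G"
      \<comment> \<open>Since the union is single-valued, only finitely many of its pairs lie over
        \<open>G\<close>, so one member of the chain contains them all.\<close>
      define D where "D = {z \<in> \<Union>C. fst z \<in> G}"
      have "inj_on fst D"
      proof (rule inj_onI)
        fix z z' assume zD: "z \<in> D" "z' \<in> D" and eq: "fst z = fst z'"
        obtain x b where z: "z = (x, b)" by (cases z)
        obtain b' where z': "z' = (x, b')" using eq z by (cases z') auto
        have "(x, b) \<in> \<Union>C" "(x, b') \<in> \<Union>C" using zD z z' unfolding D_def by blast+
        then show "z = z'" using svU z z' by simp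
      qed
      moreover have "finite (fst ` D)" by (rule finite_subset[OF _ G]) (auto simp: D_def)
      ultimately have "finite D" by (rule finite_imageD[rotated])
      moreover have "D \<subseteq> \<Union>C" unfolding D_def by blast
      ultimately obtain X where X: "X \<in> C" "D \<subseteq> X"
        using finite_subset_Union_chain[OF _ _ C] by blast
      have "P X" using CF[OF X(1)] unfolding F_def by simp
      then obtain w where w: "w \<in> W G" "\<forall>x b. (x, b) \<in> X \<and> x \<in> G \<longrightarrow> w x = b"
        using G unfolding P_def by blast
      have "(x, b) \<in> X" if "(x, b) \<in> \<Union>C" "x \<in> G" for x b
        using X(2) that unfolding D_def by auto
      then show "\<exists>w\<in>W G. \<forall>x b. (x, b) \<in> \<Union>C \<and> x \<in> G \<longrightarrow> w x = b" using w by blast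
    qed
    moreover have "\<Gamma>0 \<subseteq> \<Union>C" using CF C(1) unfolding F_def by blast
    ultimately show "\<Union>C \<in> F" unfolding F_def by blast
  qed
  then obtain \<Gamma> where \<Gamma>: "\<Gamma> \<in> F" "\<And>X. X \<in> F \<Longrightarrow> \<Gamma> \<subseteq> X \<Longrightarrow> X = \<Gamma>" by blast
  have P\<Gamma>: "P \<Gamma>" and \<Gamma>0: "\<Gamma>0 \<subseteq> \<Gamma>" using \<Gamma>(1) unfolding F_def by blast+
  define u where "u x = (SOME b. (x, b) \<in> \<Gamma>)" for x
  have u: "u x = b" if "(x, b) \<in> \<Gamma>" for x b
    unfolding u_def using sv[OF P\<Gamma> someI[of "\<lambda>b. (x, b) \<in> \<Gamma>", OF that] that] .
  have dom: "\<exists>b. (y, b) \<in> \<Gamma>" for y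
  proof (rule ccontr)
    assume y: "\<nexists>b. (y, b) \<in> \<Gamma>"
    have "\<exists>w\<in>W G. \<forall>x\<in>fst ` \<Gamma> \<inter> G. w x = u x" if G: "finite G" for G
    proof -
      obtain w where w: "w \<in> W G" "\<forall>x b. (x, b) \<in> \<Gamma> \<and> x \<in> G \<longrightarrow> w x = b"
        using P\<Gamma> G unfolding P_def by blast
      then show ?thesis using u by (intro bexI[of _ w]) auto
    qed
    from finitely_solvable_extend[OF this]
    obtain b where b: "\<forall>G. finite G \<longrightarrow>
        (\<exists>w\<in>W G. \<forall>x\<in>insert y (fst ` \<Gamma>) \<inter> G. w x = (if x \<in> fst ` \<Gamma> then u x else b))"
      by blast
    have "P (insert (y, b) \<Gamma>)"
      unfolding P_def
    proof (intro allI impI)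
      fix G :: "'x set" assume "finite G"
      then obtain w where w: "w \<in> W G"
        "\<forall>x\<in>insert y (fst ` \<Gamma>) \<inter> G. w x = (if x \<in> fst ` \<Gamma> then u x else b)" using b by blast
      have "w x = c" if "(x, c) \<in> insert (y, b) \<Gamma>" "x \<in> G" for x c
      proof (cases "(x, c) \<in> \<Gamma>")
        case True
        then have "x \<in> fst ` \<Gamma>" by (rule image_eqI[rotated]) simp
        then show ?thesis using w(2) that(2) u[OF True] by simp
      next
        case False
        then have "x = y" "c = b" using that by auto
        moreover have "y \<notin> fst ` \<Gamma>" using y by auto
        ultimately show ?thesis using w(2) that(2) by simp
      qed
      then show "\<exists>w\<in>W G. \<forall>x c. (x, c) \<in> insert (y, b) \<Gamma> \<and> x \<in> G \<longrightarrow> w x = c" using w(1) by blast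
    qed
    then have "insert (y, b) \<Gamma> \<in> F" using \<Gamma>0 unfolding F_def by blast
    then have "insert (y, b) \<Gamma> = \<Gamma>" using \<Gamma>(2) by blast
    then show False using y by blast
  qed
  show ?thesis
  proof (rule that[of u])
    show "u x = v x" if "x \<in> S" for x using u \<Gamma>0 that unfolding \<Gamma>0_def by blast
    fix G :: "'x set" assume "finite G"
    then obtain w where w: "w \<in> W G" "\<forall>x b. (x, b) \<in> \<Gamma> \<and> x \<in> G \<longrightarrow> w x = b"
      using P\<Gamma> unfolding P_def by blast
    have "w x = u x" if "x \<in> G" for x
    proof -
      obtain b where "(x, b) \<in> \<Gamma>" using dom by blast
      then show ?thesis using w(2) u that by auto
    qed
    then show "\<exists>w\<in>W G. \<forall>x\<in>G. w x = u x" using w(1) by blast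
  qed
qed

text \<open>A Mittag-Leffler property: on a finite set of variables, finitely many constraints
  detect which values extend. By induction, the value at the new variable is corrected by a solution
  that vanishes on the old ones.\<close>

lemma stable_restrictions:
  assumes "finite X"
  shows "\<exists>G0. finite G0 \<and> (\<forall>w\<in>W G0. \<forall>G. finite G \<longrightarrow> (\<exists>w'\<in>W G. \<forall>x\<in>X. w' x = w x))"
  using assms
proof (induction X rule: finite_induct)
  case empty
  then show ?case using W_zero by (intro exI[of _ "{}"]) blast
next
  case (insert y X)
  from insert.IH obtain G0 where G0: "finite G0"
    "\<forall>w\<in>W G0. \<forall>G. finite G \<longrightarrow> (\<exists>w'\<in>W G. \<forall>x\<in>X. w' x = w x)" by (elim exE conjE)
  obtain G1 where G1: "finite G1" "\<forall>G' w. finite G' \<longrightarrow> G1 \<subseteq> G' \<longrightarrow> w \<in> W G1 \<longrightarrow>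
      (\<forall>x\<in>X \<inter> G1. w x = 0) \<longrightarrow> (\<exists>w'\<in>W G'. (\<forall>x\<in>X \<inter> G'. w' x = 0) \<and> w' y = w y)"
    using stable_values[of y X] by (elim exE conjE)
  have "\<exists>w'\<in>W G. \<forall>x\<in>insert y X. w' x = w x" if w: "w \<in> W (G0 \<union> G1)" and G: "finite G" for w G
  proof -
    let ?G = "G \<union> G0 \<union> G1 \<union> X"
    have fin: "finite ?G" using G G0(1) G1(1) insert(1) by blast
    have wG: "w \<in> W G0" "w \<in> W G1"
      using w W_antimono[of G0 "G0 \<union> G1"] W_antimono[of G1 "G0 \<union> G1"] by blast+
    obtain w1 where w1: "w1 \<in> W ?G" "\<forall>x\<in>X. w1 x = w x"
      using G0(2)[rule_format, OF wG(1) fin] by blast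
    have "w1 \<in> W G1" using w1(1) W_antimono[of G1 ?G] by blast
    then have d: "(\<lambda>x. w x - w1 x) \<in> W G1" by (rule W_diff[OF wG(2)])
    have "w x - w1 x = 0" if "x \<in> X \<inter> G1" for x using w1(2) that by auto
    then obtain w2 where w2: "w2 \<in> W ?G" "\<forall>x\<in>X \<inter> ?G. w2 x = 0" "w2 y = w y - w1 y"
      using G1(2)[rule_format, OF fin _ d] by auto
    have "(\<lambda>x. w1 x + w2 x) \<in> W G"
      using W_add[OF w1(1) w2(1)] W_antimono[of G ?G] by blast
    moreover have "w1 x + w2 x = w x" if "x \<in> insert y X" for x
      using that w1(2) w2(2,3) by auto
    ultimately show ?thesis by (intro bexI[of _ "\<lambda>x. w1 x + w2 x"] ballI) auto
  qed
  then show ?case using G0(1) G1(1) by (intro exI[of _ "G0 \<union> G1"] conjI ballI allI impI) simp_all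
qed

end

section \<open>Extension of endomorphisms from finite subsets\<close>

context persistence_module
begin

text \<open>The unknowns are the values \<open>f p y\<close>, one variable for each point and
  vector. Additivity, homogeneity and naturality are homogeneous linear constraints, each on
  finitely many unknowns. Prescribing \<open>f\<close> on \<open>F\<close> means prescribing it on
  finitely many basis vectors, and by \<open>stable_restrictions\<close> finitely many constraints
  decide whether this extends; \<open>R\<close> consists of \<open>F\<close> and the points that
  these constraints mention.\<close>

theorem endo_extension:
  assumes pfd: "pfd Q M" and F: "finite F" "F \<subseteq> Q"
  obtains R where "finite R" "F \<subseteq> R" "R \<subseteq> Q"
    "\<And>R' e. R \<subseteq> R' \<Longrightarrow> R' \<subseteq> Q \<Longrightarrow> endo R' M e \<Longrightarrow>
      \<exists>f. endo Q M f \<and> (\<forall>p\<in>F. \<forall>x\<in>obj M p. f p x = e p x)"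
proof -
  \<comment> \<open>Pairs that are not vectors of the module receive the zero space, so that every
    variable has a finite-dimensional range.\<close>
  define V where "V = (\<lambda>(p, y). if p \<in> Q \<and> y \<in> obj M p then obj M p else {0})"
  define W where "W G = {w. (\<forall>z. w z \<in> V z) \<and>
      (\<forall>p y y'. p \<in> Q \<and> y \<in> obj M p \<and> y' \<in> obj M p \<and> (p, y) \<in> G \<and> (p, y') \<in> G \<and> (p, y + y') \<in> G
        \<longrightarrow> w (p, y + y') = w (p, y) + w (p, y')) \<and>
      (\<forall>p y c. p \<in> Q \<and> y \<in> obj M p \<and> (p, y) \<in> G \<and> (p, scl M c y) \<in> G
        \<longrightarrow> w (p, scl M c y) = scl M c (w (p, y))) \<and>
      (\<forall>p q y. p \<in> Q \<and> q \<in> Q \<and> p \<le> q \<and> y \<in> obj M p \<and> (p, y) \<in> G \<and> (q, arr M p q y) \<in> G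
        \<longrightarrow> w (q, arr M p q y) = arr M p q (w (p, y)))}" for G
  have V_sub: "subspace (V z)" for z
    using subspace_obj by (cases z) (simp add: V_def)
  have V_fd: "fin_dim (V z)" for z
    using pfd fin_dim_def by (cases z) (auto simp: V_def pfd_def intro!: exI[of _ "{0}"])
  have V_obj: "V (p, y) = obj M p" if "p \<in> Q" "y \<in> obj M p" for p y
    using that by (simp add: V_def)
  have W1: "w \<in> W G \<Longrightarrow> w z \<in> V z" for w :: "'p \<times> 'v \<Rightarrow> 'v" and G and z :: "'p \<times> 'v" by (cases z) (simp add: W_def)
  have W2: "w (p, y + y') = w (p, y) + w (p, y')"
    if "w \<in> W G" "p \<in> Q" "y \<in> obj M p" "y' \<in> obj M p" "(p, y) \<in> G" "(p, y') \<in> G" "(p, y + y') \<in> G"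
    for w G p y y' using that by (simp add: W_def)
  have W3: "w (p, scl M c y) = scl M c (w (p, y))"
    if "w \<in> W G" "p \<in> Q" "y \<in> obj M p" "(p, y) \<in> G" "(p, scl M c y) \<in> G"
    for w G p y c using that by (simp add: W_def)
  have W4: "w (q, arr M p q y) = arr M p q (w (p, y))"
    if "w \<in> W G" "p \<in> Q" "q \<in> Q" "p \<le> q" "y \<in> obj M p" "(p, y) \<in> G" "(q, arr M p q y) \<in> G"
    for w G p q y using that by (simp add: W_def)
  have W5: "W G' \<subseteq> W G" if "G \<subseteq> G'" for G G'
    using that unfolding W_def by (auto simp: subset_eq)
  have W6: "(\<lambda>z. 0) \<in> W G" for G
    unfolding W_def using subspace_0[OF V_sub] arr_zero by simp
  have W7: "(\<lambda>z. w z + w' z) \<in> W G" if w: "w \<in> W G" and w': "w' \<in> W G" for w w' G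
  proof -
    have "w (p, y) \<in> obj M p" "w' (p, y) \<in> obj M p" if "p \<in> Q" "y \<in> obj M p" for p y
      using W1[OF w, of "(p, y)"] W1[OF w', of "(p, y)"] V_obj[OF that] by auto
    then show ?thesis
      unfolding W_def[of G]
      using subspace_add[OF V_sub W1[OF w] W1[OF w']] W2[OF w] W2[OF w'] W3[OF w] W3[OF w']
        W4[OF w] W4[OF w'] arr_add by (simp add: scale_right_distrib)
  qed
  have W8: "(\<lambda>z. scl M c (w z)) \<in> W G" if w: "w \<in> W G" for w c G
  proof -
    have "w (p, y) \<in> obj M p" if "p \<in> Q" "y \<in> obj M p" for p y
      using W1[OF w, of "(p, y)"] V_obj[OF that] by auto
    then show ?thesis
      unfolding W_def[of G]
      using subspace_scale[OF V_sub W1[OF w]] W2[OF w] W3[OF w] W4[OF w] arr_scl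
      by (simp add: scale_right_distrib mult.commute)
  qed
  interpret C: linear_constraints "scl M" V W
    by unfold_locales (fact V_fd, fact W1, fact W5, fact W6, fact W7, fact W8)
  have "\<exists>B. finite B \<and> B \<subseteq> obj M p \<and> obj M p \<subseteq> span B" if p: "p \<in> F" for p
  proof -
    obtain B where B: "B \<subseteq> obj M p" "independent B" "obj M p \<subseteq> span B"
      using maximal_independent_subset[of "obj M p"] by blast
    have "fin_dim (obj M p)" using pfd F(2) p unfolding pfd_def by blast
    then have "finite B" using B(1,2) by (rule fin_dim_independent_finite)
    then show ?thesis using B(1,3) by blast
  qed
  then have "\<forall>p\<in>F. \<exists>B. finite B \<and> B \<subseteq> obj M p \<and> obj M p \<subseteq> span B" by blast
  from bchoice[OF this] obtain B where
    "\<forall>p\<in>F. finite (B p) \<and> B p \<subseteq> obj M p \<and> obj M p \<subseteq> span (B p)" ..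
  then have B: "\<And>p. p \<in> F \<Longrightarrow> finite (B p)" "\<And>p. p \<in> F \<Longrightarrow> B p \<subseteq> obj M p"
    "\<And>p. p \<in> F \<Longrightarrow> obj M p \<subseteq> span (B p)" by simp_all
  define X where "X = Sigma F B"
  have "finite X" unfolding X_def using F(1) B(1) by blast
  from C.stable_restrictions[OF this]
  obtain G0 where G0: "finite G0"
    "\<forall>w\<in>W G0. \<forall>G. finite G \<longrightarrow> (\<exists>w'\<in>W G. \<forall>x\<in>X. w' x = w x)" by (elim exE conjE)
  show ?thesis
  proof (rule that[of "F \<union> (fst ` G0 \<inter> Q)"])
    show "finite (F \<union> (fst ` G0 \<inter> Q))" using F(1) G0(1) by blast
    show "F \<union> (fst ` G0 \<inter> Q) \<subseteq> Q" using F(2) by blast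
    fix R e assume R: "F \<union> (fst ` G0 \<inter> Q) \<subseteq> R" "R \<subseteq> Q" and e: "endo R M e"
    \<comment> \<open>The value 0 off \<open>R\<close> is harmless, because every constraint of
      \<open>W G0\<close> concerns points of \<open>R\<close> only.\<close>
    define w where "w = (\<lambda>(p, y). if p \<in> R \<and> y \<in> obj M p then e p y else 0)"
    have wV: "w (p, y) \<in> V (p, y)" for p y
      using endo_in[OF e, of p y] R(2) subspace_0[OF V_sub, of "(p, y)"]
      by (auto simp: w_def V_def)
    have wR: "w (p, y) = e p y" if "p \<in> R" "y \<in> obj M p" for p y using that by (simp add: w_def)
    have R0: "p \<in> R" if "p \<in> Q" "(p, y) \<in> G0" for p y using that R(1) by force
    have "w \<in> W G0"
      unfolding W_def
    proof (intro CollectI conjI allI impI)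
      fix z show "w z \<in> V z" using wV by (cases z) blast
    next
      fix p y y' assume A: "p \<in> Q \<and> y \<in> obj M p \<and> y' \<in> obj M p \<and> (p, y) \<in> G0 \<and> (p, y') \<in> G0 \<and> (p, y + y') \<in> G0"
      have PR: "p \<in> R" using A R0 by blast+
      show "w (p, y + y') = w (p, y) + w (p, y')"
        using wR endo_add[OF e] add_in A PR by simp
    next
      fix p y c assume A: "p \<in> Q \<and> y \<in> obj M p \<and> (p, y) \<in> G0 \<and> (p, scl M c y) \<in> G0"
      have PR: "p \<in> R" using A R0 by blast+
      show "w (p, scl M c y) = scl M c (w (p, y))"
        using wR endo_scl[OF e] scl_in A PR by simp
    next
      fix p q y assume A: "p \<in> Q \<and> q \<in> Q \<and> p \<le> q \<and> y \<in> obj M p \<and> (p, y) \<in> G0 \<and> (q, arr M p q y) \<in> G0"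
      have PR: "p \<in> R" "q \<in> R" using A R0 by blast+
      show "w (q, arr M p q y) = arr M p q (w (p, y))"
        using wR endo_arr[OF e] arr_in A PR by simp
    qed
    then have "\<forall>G. finite G \<longrightarrow> (\<exists>w'\<in>W G. \<forall>x\<in>X. w' x = w x)"
      by (rule bspec[OF G0(2)])
    then have "\<exists>w'\<in>W G. \<forall>x\<in>X \<inter> G. w' x = w x" if "finite G" for G
      using that by blast
    from C.finitely_solvable_imp_solvable[OF this]
    obtain u where u: "\<And>x. x \<in> X \<Longrightarrow> u x = w x" "\<And>G. finite G \<Longrightarrow> \<exists>w\<in>W G. \<forall>x\<in>G. w x = u x"
      by blast
    define f where "f p y = u (p, y)" for p y
    have f: "endo Q M f"
    proof (rule endoI)
      fix p y assume p: "p \<in> Q" and y: "y \<in> obj M p"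
      obtain w' where "w' \<in> W {(p, y)}" "\<forall>x\<in>{(p, y)}. w' x = u x" using u(2)[of "{(p, y)}"] by auto
      then show "f p y \<in> obj M p" using W1[of w' "{(p, y)}" "(p, y)"] V_obj[OF p y] by (simp add: f_def)
      show "f p (y + y') = f p y + f p y'" if y': "y' \<in> obj M p" for y'
      proof -
        let ?G = "{(p, y), (p, y'), (p, y + y')}"
        obtain w' where w': "w' \<in> W ?G" "\<forall>x\<in>?G. w' x = u x" using u(2)[of ?G] by blast
        have eq: "u x = w' x" if "x \<in> ?G" for x using w'(2)[THEN bspec, OF that] by simp
        show ?thesis
          unfolding f_def using W2[OF w'(1) p y y'] by (simp add: eq)
      qed
      show "f p (scl M c y) = scl M c (f p y)" for c
      proof -
        let ?G = "{(p, y), (p, scl M c y)}"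
        obtain w' where w': "w' \<in> W ?G" "\<forall>x\<in>?G. w' x = u x" using u(2)[of ?G] by blast
        have eq: "u x = w' x" if "x \<in> ?G" for x using w'(2)[THEN bspec, OF that] by simp
        show ?thesis
          unfolding f_def using W3[OF w'(1) p y] by (simp add: eq)
      qed
      show "f q (arr M p q y) = arr M p q (f p y)" if q: "q \<in> Q" "p \<le> q" for q
      proof -
        let ?G = "{(p, y), (q, arr M p q y)}"
        obtain w' where w': "w' \<in> W ?G" "\<forall>x\<in>?G. w' x = u x" using u(2)[of ?G] by blast
        have eq: "u x = w' x" if "x \<in> ?G" for x using w'(2)[THEN bspec, OF that] by simp
        show ?thesis
          unfolding f_def using W4[OF w'(1) p q y] by (simp add: eq)
      qed
    qed
    have "f p x = e p x" if p: "p \<in> F" and x: "x \<in> obj M p" for p x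
    proof -
      have pR: "p \<in> R" "p \<in> Q" using p R by blast+
      have "subspace {x \<in> obj M p. f p x = e p x}"
        using zero_in[OF pR(2)] add_in[OF pR(2)] scl_in[OF pR(2)] endo_zero[OF f pR(2)]
          persistence_module.endo_zero[OF persistence_module_subset[OF persistence_module_axioms R(2)] e pR(1)]
          endo_add[OF f pR(2)] endo_add[OF e pR(1)] endo_scl[OF f pR(2)] endo_scl[OF e pR(1)]
        by (intro subspaceI) auto
      moreover have "B p \<subseteq> {x \<in> obj M p. f p x = e p x}"
      proof
        fix b assume b: "b \<in> B p"
        then have "b \<in> obj M p" "(p, b) \<in> X" using B(2)[OF p] p unfolding X_def by auto
        then show "b \<in> {x \<in> obj M p. f p x = e p x}"
          using u(1)[of "(p, b)"] wR[OF pR(1)] by (simp add: f_def)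
      qed
      ultimately show ?thesis using span_minimal B(3)[OF p] x by blast
    qed
    then show "\<exists>f. endo Q M f \<and> (\<forall>p\<in>F. \<forall>x\<in>obj M p. f p x = e p x)" using f by blast
  qed blast
qed

end

section \<open>Modules over finite grids\<close>

lemma PiE_upd_in: "p \<in> PiE I T \<Longrightarrow> i \<in> I \<Longrightarrow> s \<in> T i \<Longrightarrow> p(i := s) \<in> PiE I T"
  by (auto simp: PiE_def extensional_def)

lemma PiE_le_iff:
  fixes p q :: "'i \<Rightarrow> 'a::order"
  assumes "p \<in> PiE I T" "q \<in> PiE I T"
  shows "p \<le> q \<longleftrightarrow> (\<forall>i\<in>I. p i \<le> q i)"
proof
  assume le: "\<forall>i\<in>I. p i \<le> q i"
  show "p \<le> q"
  proof (rule le_funI)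
    fix i show "p i \<le> q i"
      using le PiE_arb[OF assms(1)] PiE_arb[OF assms(2)] by (cases "i \<in> I") auto
  qed
qed (simp add: le_fun_def)

lemma le_upd: "p i \<le> s \<Longrightarrow> p \<le> p(i := s)" for p :: "'i \<Rightarrow> 'a::order"
  by (simp add: le_fun_def)

lemma upd_le: "s \<le> p i \<Longrightarrow> p(i := s) \<le> p" for p :: "'i \<Rightarrow> 'a::order"
  by (simp add: le_fun_def)

lemma upd_mono: "p \<le> q \<Longrightarrow> s \<le> s' \<Longrightarrow> p(i := s) \<le> q(i := s')" for p q :: "'i \<Rightarrow> 'a::order"
  by (simp add: le_fun_def)

text \<open>In the Koszul complex of the cube spanned by \<open>J\<close> and \<open>i\<close>, this
  is exactness in degree \<open>k - 1\<close> for a cycle concentrated at the vertex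
  \<open>{i}\<close>. For empty \<open>J\<close> it would say that structure maps are
  surjective.\<close>

definition kernels_lift :: "'i set \<Rightarrow> ('i \<Rightarrow> 'a::linorder set) \<Rightarrow>
    ('i \<Rightarrow> 'a, 'k::field, 'v::ab_group_add) persmod \<Rightarrow> bool" where
  "kernels_lift I T M \<longleftrightarrow> (\<forall>p i s J r y.
    p \<in> PiE I T \<and> i \<in> I \<and> s \<in> T i \<and> p i \<le> s \<and> J \<subseteq> I \<and> J \<noteq> {} \<and> i \<notin> J \<and>
    (\<forall>j\<in>J. r j \<in> T j \<and> p j \<le> r j) \<and> y \<in> obj M (p(i := s)) \<and>
    (\<forall>j\<in>J. arr M (p(i := s)) (p(i := s, j := r j)) y = 0) \<longrightarrow>
    (\<exists>z\<in>obj M p. arr M p (p(i := s)) z = y \<and> (\<forall>j\<in>J. arr M p (p(j := r j)) z = 0)))"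

text \<open>Here \<open>p\<close> is the vertex \<open>J\<close> of the cube. Up to signs,
  \<open>y\<close> and the \<open>w j\<close> form a cycle in degree 1, with \<open>w j\<close> at
  the vertex that misses only \<open>j\<close>. For empty \<open>J\<close> the statement would say
  that structure maps are injective.\<close>

definition cokernels_embed :: "'i set \<Rightarrow> ('i \<Rightarrow> 'a::linorder set) \<Rightarrow>
    ('i \<Rightarrow> 'a, 'k::field, 'v::ab_group_add) persmod \<Rightarrow> bool" where
  "cokernels_embed I T M \<longleftrightarrow> (\<forall>p i s J l y w.
    p \<in> PiE I T \<and> i \<in> I \<and> s \<in> T i \<and> p i \<le> s \<and> J \<subseteq> I \<and> J \<noteq> {} \<and> i \<notin> J \<and>
    (\<forall>j\<in>J. l j \<in> T j \<and> l j \<le> p j) \<and> y \<in> obj M p \<and>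
    (\<forall>j\<in>J. w j \<in> obj M (p(i := s, j := l j))) \<and>
    arr M p (p(i := s)) y = (\<Sum>j\<in>J. arr M (p(i := s, j := l j)) (p(i := s)) (w j)) \<longrightarrow>
    (\<exists>v. (\<forall>j\<in>J. v j \<in> obj M (p(j := l j))) \<and> y = (\<Sum>j\<in>J. arr M (p(j := l j)) p (v j))))"

lemma kernels_liftD:
  assumes "kernels_lift I T M" "p \<in> PiE I T" "i \<in> I" "s \<in> T i" "p i \<le> s" "J \<subseteq> I" "J \<noteq> {}" "i \<notin> J"
    and "\<forall>j\<in>J. r j \<in> T j \<and> p j \<le> r j" "y \<in> obj M (p(i := s))"
    and "\<forall>j\<in>J. arr M (p(i := s)) (p(i := s, j := r j)) y = 0"
  shows "\<exists>z\<in>obj M p. arr M p (p(i := s)) z = y \<and> (\<forall>j\<in>J. arr M p (p(j := r j)) z = 0)"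
  using assms(1)[unfolded kernels_lift_def, rule_format, of p i s J r y] assms(2-) by simp

lemma cokernels_embedD:
  assumes "cokernels_embed I T M" "p \<in> PiE I T" "i \<in> I" "s \<in> T i" "p i \<le> s" "J \<subseteq> I" "J \<noteq> {}" "i \<notin> J"
    and "\<forall>j\<in>J. l j \<in> T j \<and> l j \<le> p j" "y \<in> obj M p" "\<forall>j\<in>J. w j \<in> obj M (p(i := s, j := l j))"
    and "arr M p (p(i := s)) y = (\<Sum>j\<in>J. arr M (p(i := s, j := l j)) (p(i := s)) (w j))"
  shows "\<exists>v. (\<forall>j\<in>J. v j \<in> obj M (p(j := l j))) \<and> y = (\<Sum>j\<in>J. arr M (p(j := l j)) p (v j))"
  using assms(1)[unfolded cokernels_embed_def, rule_format, of p i s J l y w] assms(2-) by simp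

lemma kernels_lift_subset:
  assumes M: "kernels_lift I T M" and F: "\<And>i. i \<in> I \<Longrightarrow> F i \<subseteq> T i"
  shows "kernels_lift I F M"
  unfolding kernels_lift_def
proof (intro allI impI, elim conjE, goal_cases)
  case (1 p i s J r y)
  have "p \<in> PiE I T" using 1(1) PiE_mono[of I F T] F by blast
  then show ?case by (rule kernels_liftD[OF M]) (use 1 F in \<open>auto simp: subset_iff\<close>)
qed

lemma cokernels_embed_subset:
  assumes M: "cokernels_embed I T M" and F: "\<And>i. i \<in> I \<Longrightarrow> F i \<subseteq> T i"
  shows "cokernels_embed I F M"
  unfolding cokernels_embed_def
proof (intro allI impI, elim conjE, goal_cases)
  case (1 p i s J l y w)
  have "p \<in> PiE I T" using 1(1) PiE_mono[of I F T] F by blast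
  then show ?case
    by (rule cokernels_embedD[OF M _ _ _ _ _ _ _ _ _ _ 1(11)]) (use 1 F in \<open>auto simp: subset_iff\<close>)
qed

text \<open>Lift in \<open>M\<close> and apply \<open>e\<close>: it commutes with the structure maps
  and fixes \<open>y\<close>. The cokernel condition passes to summands in the same way.\<close>

lemma kernels_lift_image:
  assumes pm: "persistence_module (PiE I T) M" and M: "kernels_lift I T M"
    and e: "endo (PiE I T) M e" "idem (PiE I T) M e"
  shows "kernels_lift I T (image_mod M e)"
  unfolding kernels_lift_def
proof (intro allI impI, elim conjE, goal_cases)
  case (1 p i s J r y)
  interpret persistence_module "PiE I T" M by (rule pm)
  have s: "p(i := s) \<in> PiE I T" "p \<le> p(i := s)"
    using PiE_upd_in[OF 1(1-3)] le_upd[of p i s] 1(4) by simp_all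
  have r: "p(j := r j) \<in> PiE I T" "p \<le> p(j := r j)" if "j \<in> J" for j
    using PiE_upd_in[OF 1(1) subsetD[OF 1(5) that]] le_upd[of p j "r j"]
      1(8)[THEN bspec, OF that] by simp_all
  obtain y0 where y0: "y0 \<in> obj M (p(i := s))" "y = e (p(i := s)) y0" using 1(9) by auto
  have y: "y \<in> obj M (p(i := s))" using endo_in[OF e(1) s(1) y0(1)] y0(2) by simp
  have ey: "e (p(i := s)) y = y" using e(2) s(1) y0 unfolding idem_def by simp
  have "\<exists>z\<in>obj M p. arr M p (p(i := s)) z = y \<and> (\<forall>j\<in>J. arr M p (p(j := r j)) z = 0)"
    by (rule kernels_liftD[OF M 1(1-8) y]) (use 1(10) in simp)
  then obtain z where z: "z \<in> obj M p" "arr M p (p(i := s)) z = y"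
    "\<forall>j\<in>J. arr M p (p(j := r j)) z = 0" by blast
  have "arr M p (p(i := s)) (e p z) = y"
    using endo_arr[OF e(1) 1(1) s z(1)] z(2) ey by simp
  moreover have "arr M p (p(j := r j)) (e p z) = 0" if "j \<in> J" for j
    using endo_arr[OF e(1) 1(1) r[OF that] z(1)] z(3) that endo_zero[OF e(1) r(1)[OF that]] by simp
  ultimately show ?case using z(1) by auto
qed

lemma cokernels_embed_image:
  assumes pm: "persistence_module (PiE I T) M" and M: "cokernels_embed I T M"
    and e: "endo (PiE I T) M e" "idem (PiE I T) M e"
  shows "cokernels_embed I T (image_mod M e)"
  unfolding cokernels_embed_def
proof (intro allI impI, elim conjE, goal_cases)
  case (1 p i s J l y w)
  interpret persistence_module "PiE I T" M by (rule pm)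
  have s: "p(i := s) \<in> PiE I T" by (rule PiE_upd_in[OF 1(1-3)])
  have l: "p(j := l j) \<in> PiE I T" "p(j := l j) \<le> p" "p(i := s, j := l j) \<in> PiE I T" if "j \<in> J" for j
    using PiE_upd_in[OF 1(1) subsetD[OF 1(5) that]] PiE_upd_in[OF s subsetD[OF 1(5) that]]
      upd_le[of "l j" p j] 1(8)[THEN bspec, OF that] by simp_all
  obtain y0 where y0: "y0 \<in> obj M p" "y = e p y0" using 1(9) by auto
  have y: "y \<in> obj M p" using endo_in[OF e(1) 1(1) y0(1)] y0(2) by simp
  have ey: "e p y = y" using e(2) 1(1) y0 unfolding idem_def by simp
  have "w j \<in> obj M (p(i := s, j := l j))" if "j \<in> J" for j
    using 1(10)[THEN bspec, OF that] endo_in[OF e(1) l(3)[OF that]] by auto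
  then have w: "\<forall>j\<in>J. w j \<in> obj M (p(i := s, j := l j))" by blast
  have "\<exists>v. (\<forall>j\<in>J. v j \<in> obj M (p(j := l j))) \<and> y = (\<Sum>j\<in>J. arr M (p(j := l j)) p (v j))"
    by (rule cokernels_embedD[OF M 1(1-8) y w]) (use 1(11) in simp)
  then obtain v where v: "\<forall>j\<in>J. v j \<in> obj M (p(j := l j))"
    "y = (\<Sum>j\<in>J. arr M (p(j := l j)) p (v j))" by blast
  have "y = e p (\<Sum>j\<in>J. arr M (p(j := l j)) p (v j))" using ey v(2) by simp
  also have "\<dots> = (\<Sum>j\<in>J. e p (arr M (p(j := l j)) p (v j)))"
    by (rule endo_sum[OF e(1) 1(1)]) (use v(1) l 1(1) arr_in in blast)
  also have "\<dots> = (\<Sum>j\<in>J. arr M (p(j := l j)) p (e (p(j := l j)) (v j)))"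
    by (rule sum.cong[OF refl]) (use v(1) l 1(1) endo_arr[OF e(1)] in blast)
  finally show ?case
    using v(1) by (intro exI[of _ "\<lambda>j. e (p(j := l j)) (v j)"]) auto
qed

text \<open>The vector \<open>x\<close> describes a map from the interval module of
  \<open>[u, d]\<close> to \<open>M\<close> and the functional \<open>f\<close> a map back; the
  value 1 says that they compose to the identity of the interval module. Composed in the other order
  they give \<open>split_endo\<close>.\<close>

definition splits :: "'p::order set \<Rightarrow> ('p, 'k::field, 'v::ab_group_add) persmod \<Rightarrow>
    'p \<Rightarrow> 'p \<Rightarrow> 'v \<Rightarrow> ('v \<Rightarrow> 'k) \<Rightarrow> bool" where
  "splits Q M u d x f \<longleftrightarrow> u \<in> Q \<and> d \<in> Q \<and> u \<le> d \<and> x \<in> obj M u \<and>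
    (\<forall>q\<in>Q. u \<le> q \<and> \<not> q \<le> d \<longrightarrow> arr M u q x = 0) \<and>
    (\<forall>a\<in>obj M d. \<forall>b\<in>obj M d. f (a + b) = f a + f b) \<and>
    (\<forall>c. \<forall>a\<in>obj M d. f (scl M c a) = c * f a) \<and>
    f (arr M u d x) = 1 \<and>
    (\<forall>q\<in>Q. q \<le> d \<and> \<not> u \<le> q \<longrightarrow> (\<forall>y\<in>obj M q. f (arr M q d y) = 0))"

definition split_endo :: "('p::order, 'k::field, 'v::ab_group_add) persmod \<Rightarrow>
    'p \<Rightarrow> 'p \<Rightarrow> 'v \<Rightarrow> ('v \<Rightarrow> 'k) \<Rightarrow> 'p \<Rightarrow> 'v \<Rightarrow> 'v" where
  "split_endo M u d x f q y = (if u \<le> q \<and> q \<le> d then scl M (f (arr M q d y)) (arr M u q x) else 0)"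

context persistence_module
begin

text \<open>Naturality across the boundary of \<open>[u, d]\<close> is what the two vanishing
  conditions provide: \<open>x\<close> dies on leaving the down-set of \<open>d\<close>, and
  \<open>f\<close> kills whatever enters the up-set of \<open>u\<close>.\<close>

lemma split_endo:
  assumes s: "splits Q M u d x f"
  shows "endo Q M (split_endo M u d x f)"
    and "idem Q M (split_endo M u d x f)"
    and "split_endo M u d x f u x = x" "x \<noteq> 0"
    and "q \<in> Q \<Longrightarrow> u \<le> q \<Longrightarrow> q \<le> d \<Longrightarrow> arr M u q x \<noteq> 0"
proof -
  let ?e = "split_endo M u d x f"
  have u: "u \<in> Q" and d: "d \<in> Q" and ud: "u \<le> d" and x: "x \<in> obj M u"
    and kill: "\<And>q. q \<in> Q \<Longrightarrow> u \<le> q \<Longrightarrow> \<not> q \<le> d \<Longrightarrow> arr M u q x = 0"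
    and fadd: "\<And>a b. a \<in> obj M d \<Longrightarrow> b \<in> obj M d \<Longrightarrow> f (a + b) = f a + f b"
    and fscl: "\<And>c a. a \<in> obj M d \<Longrightarrow> f (scl M c a) = c * f a"
    and f1: "f (arr M u d x) = 1"
    and f0: "\<And>q y. q \<in> Q \<Longrightarrow> q \<le> d \<Longrightarrow> \<not> u \<le> q \<Longrightarrow> y \<in> obj M q \<Longrightarrow> f (arr M q d y) = 0"
    using s unfolding splits_def by auto
  have fzero: "f 0 = 0" using fscl[OF zero_in[OF d], of 0] by simp
  have xq: "arr M u q x \<in> obj M q" if "q \<in> Q" "u \<le> q" for q by (rule arr_in[OF u that x])
  have qd: "arr M q d y \<in> obj M d" if "q \<in> Q" "q \<le> d" "y \<in> obj M q" for q y
    using arr_in[OF that(1) d that(2,3)] .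
  have fxq: "f (arr M q d (arr M u q x)) = 1" if "q \<in> Q" "u \<le> q" "q \<le> d" for q
    using arr_comp[OF u that(1) d that(2,3) x] f1 by simp
  show "endo Q M ?e"
  proof (rule endoI)
    fix p y assume p: "p \<in> Q" and y: "y \<in> obj M p"
    show "?e p y \<in> obj M p"
      using xq[OF p] scl_in[OF p] zero_in[OF p] by (simp add: split_endo_def)
    show "?e p (y + z) = ?e p y + ?e p z" if "z \<in> obj M p" for z
      using arr_add[OF p d _ y that] fadd qd[OF p] y that
      by (simp add: split_endo_def scale_left_distrib)
    show "?e p (scl M c y) = scl M c (?e p y)" for c
      using arr_scl[OF p d _ y] fscl qd[OF p] y by (simp add: split_endo_def)
    fix q assume q: "q \<in> Q" "p \<le> q"
    show "?e q (arr M p q y) = arr M p q (?e p y)"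
    proof (cases "q \<le> d")
      case True
      have pd: "p \<le> d" using q(2) True by simp
      have comp: "arr M q d (arr M p q y) = arr M p d y"
        by (rule arr_comp[OF p q(1) d q(2) True y])
      show ?thesis
      proof (cases "u \<le> p")
        case up: True
        then have uq: "u \<le> q" using q(2) by simp
        show ?thesis
          using True pd up uq comp arr_scl[OF p q xq[OF p up]] arr_comp[OF u p q(1) up q(2) x]
          by (simp add: split_endo_def)
      next
        case False
        then show ?thesis
          using True pd comp f0[OF p pd False y] arr_zero[OF p q] by (simp add: split_endo_def)
      qed
    next
      case False
      have "arr M p q (scl M c (arr M u p x)) = 0" if "u \<le> p" for c
      proof -
        have "u \<le> q" using that q(2) by simp
        then show ?thesis
          using arr_scl[OF p q xq[OF p that]] arr_comp[OF u p q(1) that q(2) x]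
            kill[OF q(1) _ False] by simp
      qed
      then show ?thesis using False arr_zero[OF p q] by (simp add: split_endo_def)
    qed
  qed
  show "idem Q M ?e"
    unfolding idem_def
  proof (intro ballI)
    fix q y assume q: "q \<in> Q" and y: "y \<in> obj M q"
    show "?e q (?e q y) = ?e q y"
      using arr_scl[OF q d _ xq[OF q]] fxq[OF q] fscl qd[OF q _ xq[OF q]]
      by (simp add: split_endo_def)
  qed
  show "?e u x = x" using ud f1 arr_id[OF u x] by (simp add: split_endo_def)
  show nz: "arr M u q x \<noteq> 0" if "q \<in> Q" "u \<le> q" "q \<le> d" for q
    using fxq[OF that] arr_zero[OF that(1) d that(3)] fzero by auto
  show "x \<noteq> 0" using nz[OF u order_refl ud] arr_id[OF u x] by simp
qed

end

section \<open>Lifting kernels and cokernels along grid paths\<close>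

locale grid_module = persistence_module "PiE I T" M
  for I :: "'i set" and T :: "'i \<Rightarrow> 'a::linorder set"
    and M :: "('i \<Rightarrow> 'a, 'k::field, 'v::ab_group_add) persmod" +
  assumes fin_I: "finite I" and fin_T: "i \<in> I \<Longrightarrow> finite (T i)" and T_ne: "i \<in> I \<Longrightarrow> T i \<noteq> {}"
    and lift: "kernels_lift I T M" and embed: "cokernels_embed I T M"
begin

abbreviation "Q \<equiv> PiE I T"

definition lo :: "'i \<Rightarrow> 'a" where "lo = (\<lambda>i\<in>I. Min (T i))"
definition hi :: "'i \<Rightarrow> 'a" where "hi = (\<lambda>i\<in>I. Max (T i))"

lemma lo_in [simp]: "lo \<in> Q" and hi_in [simp]: "hi \<in> Q"
  unfolding lo_def hi_def using fin_T T_ne by auto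

lemma lo_mem: "i \<in> I \<Longrightarrow> lo i \<in> T i" and hi_mem: "i \<in> I \<Longrightarrow> hi i \<in> T i"
  using lo_in hi_in by (auto simp del: lo_in hi_in)

lemma lo_min: "i \<in> I \<Longrightarrow> s \<in> T i \<Longrightarrow> lo i \<le> s" and hi_max: "i \<in> I \<Longrightarrow> s \<in> T i \<Longrightarrow> s \<le> hi i"
  using fin_T by (simp_all add: lo_def hi_def)

lemma lo_le: "q \<in> Q \<Longrightarrow> lo \<le> q" and le_hi: "q \<in> Q \<Longrightarrow> q \<le> hi"
  using PiE_le_iff[of lo I T q] PiE_le_iff[of q I T hi] lo_min hi_max by (auto simp: PiE_mem)

lemma finite_Q: "finite Q"
  using fin_I fin_T by (rule finite_PiE)

text \<open>Extends the kernel condition to \<open>i \<in> J\<close>, provided that \<open>J\<close>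
  has another direction. Since \<open>s \<le> r i\<close>, the map in direction \<open>i\<close>
  factors through \<open>p(i := s)\<close>, where the lift becomes \<open>y\<close> and is
  killed.\<close>

lemma kernel_step:
  assumes p: "p \<in> Q" and i: "i \<in> I" "s \<in> T i" "p i \<le> s"
    and J: "J \<subseteq> I" "J - {i} \<noteq> {}"
    and r: "\<forall>j\<in>J. r j \<in> T j \<and> (p(i := s)) j \<le> r j"
    and y: "y \<in> obj M (p(i := s))" "\<forall>j\<in>J. arr M (p(i := s)) (p(i := s, j := r j)) y = 0"
  shows "\<exists>z\<in>obj M p. arr M p (p(i := s)) z = y \<and> (\<forall>j\<in>J. arr M p (p(j := r j)) z = 0)"
proof -
  have "\<forall>j\<in>J - {i}. r j \<in> T j \<and> p j \<le> r j"
  proof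
    fix j assume "j \<in> J - {i}"
    then show "r j \<in> T j \<and> p j \<le> r j" using r[THEN bspec, of j] by simp
  qed
  from kernels_liftD[OF lift p i _ J(2) _ this y(1)]
  obtain z where z: "z \<in> obj M p" "arr M p (p(i := s)) z = y"
    "\<forall>j\<in>J - {i}. arr M p (p(j := r j)) z = 0"
    using J(1) y(2) by auto
  have "arr M p (p(i := r i)) z = 0" if iJ: "i \<in> J"
  proof -
    have ri: "r i \<in> T i" "s \<le> r i" using r iJ by auto
    have "arr M p (p(i := r i)) z = arr M (p(i := s)) (p(i := r i)) (arr M p (p(i := s)) z)"
      using PiE_upd_in[OF p i(1)] i ri le_upd[of p i s] upd_mono[of p p s "r i" i]
      by (intro arr_comp[symmetric] z(1) p) auto
    also have "\<dots> = 0" using y(2) iJ z(2) by auto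
    finally show ?thesis .
  qed
  then show ?thesis using z by auto
qed

text \<open>Extends the cokernel condition to \<open>i \<in> J\<close>. As
  \<open>l i \<le> p i\<close>, the contribution of direction \<open>i\<close> already arrives at
  \<open>p\<close>; subtract it from \<open>y\<close> and use the condition for
  \<open>J - {i}\<close>.\<close>

lemma cokernel_step:
  assumes p: "p \<in> Q" and i: "i \<in> I" "s \<in> T i" "p i \<le> s"
    and J: "J \<subseteq> I" "J - {i} \<noteq> {}" and l: "\<forall>j\<in>J. l j \<in> T j \<and> l j \<le> p j"
    and y: "y \<in> obj M p" and w: "\<forall>j\<in>J. w j \<in> obj M (p(i := s, j := l j))"
    and eq: "arr M p (p(i := s)) y = (\<Sum>j\<in>J. arr M (p(i := s, j := l j)) (p(i := s)) (w j))"
  shows "\<exists>v. (\<forall>j\<in>J. v j \<in> obj M (p(j := l j))) \<and> y = (\<Sum>j\<in>J. arr M (p(j := l j)) p (v j))"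
proof (cases "i \<in> J")
  case False
  then show ?thesis using cokernels_embedD[OF embed p i J(1) _ False l y w eq] J(2) by auto
next
  case True
  have finJ: "finite J" using fin_I J(1) finite_subset by blast
  have li: "l i \<in> T i" "l i \<le> p i" using l True by auto
  have wi: "w i \<in> obj M (p(i := l i))" using w True by auto
  note pl = PiE_upd_in[OF p i(1) li(1)] and ps = PiE_upd_in[OF p i(1,2)]
  have lp: "p(i := l i) \<le> p" and sp: "p \<le> p(i := s)"
    using upd_le[of "l i" p i] le_upd[of p i s] li(2) i(3) by simp_all
  let ?a = "arr M (p(i := l i)) p (w i)"
  have a: "?a \<in> obj M p" by (rule arr_in[OF pl p lp wi])
  have "arr M p (p(i := s)) ?a = arr M (p(i := l i)) (p(i := s)) (w i)"
    by (rule arr_comp[OF pl p ps lp sp wi])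
  then have "arr M p (p(i := s)) (y - ?a) =
      (\<Sum>j\<in>J - {i}. arr M (p(i := s, j := l j)) (p(i := s)) (w j))"
    using arr_diff[OF p ps sp y a] eq
      sum.remove[OF finJ True, of "\<lambda>j. arr M (p(i := s, j := l j)) (p(i := s)) (w j)"] by simp
  from cokernels_embedD[OF embed p i _ J(2) _ _ diff_in[OF p y a] _ this]
  obtain v where v: "\<forall>j\<in>J - {i}. v j \<in> obj M (p(j := l j))"
    "y - ?a = (\<Sum>j\<in>J - {i}. arr M (p(j := l j)) p (v j))"
    using J(1) l w by auto
  have "y = (\<Sum>j\<in>J. arr M (p(j := l j)) p ((v(i := w i)) j))"
    using v(2) sum.remove[OF finJ True, of "\<lambda>j. arr M (p(j := l j)) p ((v(i := w i)) j)"]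
    by (simp add: algebra_simps)
  moreover have "\<forall>j\<in>J. (v(i := w i)) j \<in> obj M (p(j := l j))" using v(1) wi by auto
  ultimately show ?thesis by blast
qed

lemma mix_in: "p \<in> Q \<Longrightarrow> q \<in> Q \<Longrightarrow> (\<lambda>i. if i \<in> A then p i else q i) \<in> Q"
  by (auto simp: PiE_def extensional_def)

text \<open>Moves the lift from \<open>d\<close> towards \<open>b\<close>, one coordinate of
  \<open>A\<close> at a time. A coordinate may be changed only if \<open>J\<close> has a direction
  other than it, which is the assumption on \<open>A\<close>.\<close>

lemma kernel_path:
  assumes b: "b \<in> Q" and d: "d \<in> Q" and bd: "b \<le> d"
    and A: "A \<subseteq> I" "\<And>i. i \<in> A \<Longrightarrow> J - {i} \<noteq> {}"
    and J: "J \<subseteq> I" and r: "\<forall>j\<in>J. r j \<in> T j \<and> d j \<le> r j"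
    and y: "y \<in> obj M d" "\<forall>j\<in>J. arr M d (d(j := r j)) y = 0"
    and c: "c = (\<lambda>i. if i \<in> A then b i else d i)"
  shows "\<exists>z\<in>obj M c. arr M c d z = y \<and> (\<forall>j\<in>J. arr M c (c(j := r j)) z = 0)"
proof -
  have "finite A" using A(1) fin_I finite_subset by blast
  then show ?thesis using A c
  proof (induction A arbitrary: c rule: finite_induct)
    case empty
    have "c = d" using empty.prems(3) by simp
    then show ?case using y arr_id[OF d y(1)] by blast
  next
    case (insert i A)
    define c' where "c' = (\<lambda>i. if i \<in> A then b i else d i)"
    have c'Q: "c' \<in> Q" and cQ: "c \<in> Q"
      unfolding c'_def insert.prems(3) by (rule mix_in[OF b d])+
    have c': "c' = c(i := d i)" unfolding c'_def insert.prems(3) using insert.hyps(2) by auto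
    have iI: "i \<in> I" using insert.prems(1) by blast
    have "c i = b i" unfolding insert.prems(3) by simp
    then have ci: "c i \<le> d i" using bd by (simp add: le_fun_def)
    have diT: "d i \<in> T i" using d iI by (rule PiE_mem)
    have c'd: "c' \<le> d" unfolding c'_def using bd by (simp add: le_fun_def)
    have "\<exists>z\<in>obj M c'. arr M c' d z = y \<and> (\<forall>j\<in>J. arr M c' (c'(j := r j)) z = 0)"
      by (rule insert.IH[OF _ _ c'_def]) (use insert.prems in auto)
    then obtain z where z: "z \<in> obj M c'" "arr M c' d z = y"
      "\<forall>j\<in>J. arr M c' (c'(j := r j)) z = 0" by blast
    have r': "\<forall>j\<in>J. r j \<in> T j \<and> (c(i := d i)) j \<le> r j"
      using r c'd unfolding c'[symmetric] by (auto simp: le_fun_def intro: order_trans)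
    have "J - {i} \<noteq> {}" by (rule insert.prems(2)) simp
    from kernel_step[OF cQ iI diT ci J this r'] z(1,3)
    obtain x where x: "x \<in> obj M c" "arr M c c' x = z" "\<forall>j\<in>J. arr M c (c(j := r j)) x = 0"
      unfolding c' by blast
    have "arr M c d x = arr M c' d (arr M c c' x)"
      using le_upd[of c i "d i"] ci c'd unfolding c'[symmetric]
      by (intro arr_comp[symmetric] cQ c'Q d x(1)) auto
    then have "arr M c d x = y" using x(2) z(2) by simp
    then show ?case using x(1,3) by blast
  qed
qed

text \<open>Dual to \<open>kernel_path\<close>: a representation as a sum of images is pulled back
  from \<open>c\<close> to \<open>u\<close>, undoing one coordinate of \<open>A\<close> at a
  time.\<close>

lemma cokernel_path:
  assumes u: "u \<in> Q" and v: "v \<in> Q" and uv: "u \<le> v"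
    and A: "A \<subseteq> I" "\<And>i. i \<in> A \<Longrightarrow> J - {i} \<noteq> {}"
    and J: "J \<subseteq> I" and l: "\<forall>j\<in>J. l j \<in> T j \<and> l j \<le> u j"
    and y: "y \<in> obj M u" and c: "c = (\<lambda>i. if i \<in> A then v i else u i)"
    and w: "\<forall>j\<in>J. w j \<in> obj M (c(j := l j))"
    and eq: "arr M u c y = (\<Sum>j\<in>J. arr M (c(j := l j)) c (w j))"
  shows "\<exists>w. (\<forall>j\<in>J. w j \<in> obj M (u(j := l j))) \<and> y = (\<Sum>j\<in>J. arr M (u(j := l j)) u (w j))"
proof -
  have "finite A" using A(1) fin_I finite_subset by blast
  then show ?thesis using A c w eq
  proof (induction A arbitrary: c w rule: finite_induct)
    case empty
    then have "c = u" by simp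
    then show ?case using empty.prems(4,5) arr_id[OF u y] by auto
  next
    case (insert i A)
    define c' where "c' = (\<lambda>i. if i \<in> A then v i else u i)"
    have c'Q: "c' \<in> Q" and cQ: "c \<in> Q"
      unfolding c'_def insert.prems(3) by (rule mix_in[OF v u])+
    have c': "c = c'(i := v i)" unfolding c'_def insert.prems(3) by auto
    have iI: "i \<in> I" using insert.prems(1) by blast
    have c'i: "c' i \<le> v i" unfolding c'_def using uv by (simp add: le_fun_def)
    have viT: "v i \<in> T i" using v iI by (rule PiE_mem)
    have uc': "u \<le> c'" unfolding c'_def using uv by (simp add: le_fun_def)
    have c'c: "c' \<le> c" unfolding c' using le_upd[of c' i "v i"] c'i by simp
    have l': "\<forall>j\<in>J. l j \<in> T j \<and> l j \<le> c' j"
      using l uc' by (auto simp: le_fun_def intro: order_trans)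
    have y': "arr M u c' y \<in> obj M c'" by (rule arr_in[OF u c'Q uc' y])
    have "arr M c' c (arr M u c' y) = (\<Sum>j\<in>J. arr M (c(j := l j)) c (w j))"
      unfolding arr_comp[OF u c'Q cQ uc' c'c y] by (rule insert.prems(5))
    then have "arr M c' (c'(i := v i)) (arr M u c' y) =
        (\<Sum>j\<in>J. arr M (c'(i := v i, j := l j)) (c'(i := v i)) (w j))"
      unfolding c' .
    moreover have "\<forall>j\<in>J. w j \<in> obj M (c'(i := v i, j := l j))"
      using insert.prems(4) unfolding c' .
    moreover have "J - {i} \<noteq> {}" by (rule insert.prems(2)) simp
    ultimately have "\<exists>w. (\<forall>j\<in>J. w j \<in> obj M (c'(j := l j))) \<and>
        arr M u c' y = (\<Sum>j\<in>J. arr M (c'(j := l j)) c' (w j))"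
      using cokernel_step[OF c'Q iI viT c'i J _ l' y'] by blast
    then obtain w' where w': "\<forall>j\<in>J. w' j \<in> obj M (c'(j := l j))"
        "arr M u c' y = (\<Sum>j\<in>J. arr M (c'(j := l j)) c' (w' j))" by blast
    show ?case
      by (rule insert.IH[OF _ _ c'_def w']) (use insert.prems in auto)
  qed
qed

text \<open>The points \<open>d(j := l j)\<close> dominate every point below \<open>d\<close> that
  is not above \<open>u\<close>. So it is enough that \<open>f\<close> kills the span
  \<open>S\<close> of their images, and such an \<open>f\<close> with value 1 at the image of
  \<open>x\<close> exists because this image is outside \<open>S\<close>.\<close>

lemma splits_if_not_in_images:
  assumes u: "u \<in> Q" and d: "d \<in> Q" and ud: "u \<le> d" and x: "x \<in> obj M u"
    and kill: "\<And>q. q \<in> Q \<Longrightarrow> u \<le> q \<Longrightarrow> \<not> q \<le> d \<Longrightarrow> arr M u q x = 0"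
    and J: "J \<subseteq> I" and l: "\<forall>j\<in>J. l j \<in> T j \<and> l j \<le> d j"
    and below: "\<And>q. q \<in> Q \<Longrightarrow> q \<le> d \<Longrightarrow> \<not> u \<le> q \<Longrightarrow> \<exists>j\<in>J. q j \<le> l j"
    and ni: "\<And>w. \<forall>j\<in>J. w j \<in> obj M (d(j := l j)) \<Longrightarrow>
      arr M u d x \<noteq> (\<Sum>j\<in>J. arr M (d(j := l j)) d (w j))"
  shows "\<exists>f. splits Q M u d x f"
proof -
  define S where "S = {(\<Sum>j\<in>J. arr M (d(j := l j)) d (w j)) |w. \<forall>j\<in>J. w j \<in> obj M (d(j := l j))}"
  have dl: "d(j := l j) \<in> Q" "d(j := l j) \<le> d" if "j \<in> J" for j
    using PiE_upd_in[OF d subsetD[OF J that]] upd_le[of "l j" d j] l[THEN bspec, OF that]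
    by simp_all
  have SI: "s \<in> S" if "\<forall>j\<in>J. w j \<in> obj M (d(j := l j))" "s = (\<Sum>j\<in>J. arr M (d(j := l j)) d (w j))"
    for s w unfolding S_def using that by blast
  have "subspace S"
  proof (rule subspaceI)
    have "(\<Sum>j\<in>J. arr M (d(j := l j)) d 0) = 0"
      by (rule sum.neutral) (use dl arr_zero d in blast)
    then show "0 \<in> S" using SI[of "\<lambda>j. 0" 0] dl zero_in by simp
    fix a b c assume "a \<in> S"
    then obtain w where w: "\<forall>j\<in>J. w j \<in> obj M (d(j := l j))"
      "a = (\<Sum>j\<in>J. arr M (d(j := l j)) d (w j))" unfolding S_def by blast
    have "scl M c a = (\<Sum>j\<in>J. arr M (d(j := l j)) d (scl M c (w j)))"
      unfolding w(2) scale_sum_right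
      by (rule sum.cong[OF refl]) (use w(1) dl arr_scl d in simp)
    moreover have "\<forall>j\<in>J. scl M c (w j) \<in> obj M (d(j := l j))" using w(1) dl scl_in by blast
    ultimately show "scl M c a \<in> S" by (intro SI[of "\<lambda>j. scl M c (w j)"])
    assume "b \<in> S"
    then obtain w' where w': "\<forall>j\<in>J. w' j \<in> obj M (d(j := l j))"
      "b = (\<Sum>j\<in>J. arr M (d(j := l j)) d (w' j))" unfolding S_def by blast
    have "a + b = (\<Sum>j\<in>J. arr M (d(j := l j)) d (w j + w' j))"
      unfolding w(2) w'(2) sum.distrib[symmetric]
      by (rule sum.cong[OF refl]) (use w(1) w'(1) dl arr_add d in simp)
    moreover have "\<forall>j\<in>J. w j + w' j \<in> obj M (d(j := l j))" using w(1) w'(1) dl add_in by blast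
    ultimately show "a + b \<in> S" by (intro SI[of "\<lambda>j. w j + w' j"])
  qed
  moreover have "arr M u d x \<notin> S" using ni unfolding S_def by blast
  ultimately obtain f :: "'v \<Rightarrow> 'k" where f: "\<And>a b. f (a + b) = f a + f b"
    "\<And>c a. f (scl M c a) = c * f a" "f (arr M u d x) = 1" "\<And>w. w \<in> S \<Longrightarrow> f w = 0"
    by (rule separating_functional) blast
  have "f (arr M q d y) = 0" if q: "q \<in> Q" "q \<le> d" "\<not> u \<le> q" and y: "y \<in> obj M q" for q y
  proof -
    obtain j where j: "j \<in> J" "q j \<le> l j" using below[OF q] by blast
    have le: "q \<le> d(j := l j)" using q(2) j(2) by (simp add: le_fun_def)
    define a where "a = arr M q (d(j := l j)) y"
    have a: "a \<in> obj M (d(j := l j))" unfolding a_def by (rule arr_in[OF q(1) dl(1)[OF j(1)] le y])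
    have "arr M q d y = arr M (d(j := l j)) d a"
      unfolding a_def using arr_comp[OF q(1) dl(1)[OF j(1)] d le dl(2)[OF j(1)] y] by simp
    also have "\<dots> = (\<Sum>k\<in>J. arr M (d(k := l k)) d (if k = j then a else 0))"
    proof -
      have "finite J" using J fin_I finite_subset by blast
      moreover have "(\<Sum>k\<in>J. arr M (d(k := l k)) d (if k = j then a else 0)) =
          (\<Sum>k\<in>J. if k = j then arr M (d(j := l j)) d a else 0)"
        by (rule sum.cong[OF refl]) (use dl arr_zero d in auto)
      ultimately show ?thesis using j(1) by simp
    qed
    also have "\<dots> \<in> S"
      using a dl zero_in by (intro SI[of "\<lambda>k. if k = j then a else 0"]) auto
    finally show ?thesis by (rule f(4))
  qed
  then show ?thesis
    unfolding splits_def using u d ud x kill f(1-3) by (intro exI[of _ f]) simp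
qed

end

text \<open>The shapes in which blocks meet a finite grid: intervals from the least vertex,
  intervals up to the greatest vertex, and intervals restricted along at most one axis.\<close>

definition grid_corners :: "'i set \<Rightarrow> ('i \<Rightarrow> 'a::linorder set) \<Rightarrow> ('i \<Rightarrow> 'a) \<Rightarrow> ('i \<Rightarrow> 'a) \<Rightarrow> bool" where
  "grid_corners I T u d \<longleftrightarrow> (\<forall>i\<in>I. u i = Min (T i)) \<or> (\<forall>i\<in>I. d i = Max (T i)) \<or>
    (\<exists>i\<in>I. \<forall>j\<in>I - {i}. u j = Min (T j) \<and> d j = Max (T j))"

section \<open>Interval summands of grid modules\<close>

context grid_module
begin

lemma next_ex:
  assumes j: "j \<in> I" "s < hi j"
  shows "\<exists>r. r \<in> T j \<and> s < r \<and> (\<forall>t\<in>T j. s < t \<longrightarrow> r \<le> t)"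
proof -
  have "finite {t \<in> T j. s < t}" using fin_T[OF j(1)] by simp
  moreover have "{t \<in> T j. s < t} \<noteq> {}" using hi_mem[OF j(1)] j(2) by blast
  ultimately show ?thesis
    using Min_in[of "{t \<in> T j. s < t}"] Min_le[of "{t \<in> T j. s < t}"]
    by (intro exI[of _ "Min {t \<in> T j. s < t}"]) auto
qed

lemma prev_ex:
  assumes j: "j \<in> I" "lo j < s"
  shows "\<exists>r. r \<in> T j \<and> r < s \<and> (\<forall>t\<in>T j. t < s \<longrightarrow> t \<le> r)"
proof -
  have "finite {t \<in> T j. t < s}" using fin_T[OF j(1)] by simp
  moreover have "{t \<in> T j. t < s} \<noteq> {}" using lo_mem[OF j(1)] j(2) by blast
  ultimately show ?thesis
    using Max_in[of "{t \<in> T j. t < s}"] Max_ge[of "{t \<in> T j. t < s}"]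
    by (intro exI[of _ "Max {t \<in> T j. t < s}"]) auto
qed

lemma mix_eq:
  assumes p: "p \<in> Q" and q: "q \<in> Q" and eq: "\<And>i. i \<in> I \<Longrightarrow> i \<notin> A \<Longrightarrow> q i = p i"
  shows "p = (\<lambda>i. if i \<in> A then p i else q i)"
proof
  fix i show "p i = (if i \<in> A then p i else q i)"
    using eq[of i] PiE_arb[OF p, of i] PiE_arb[OF q, of i] by (cases "i \<in> I") auto
qed

lemma not_le_ex: "p \<in> Q \<Longrightarrow> q \<in> Q \<Longrightarrow> \<not> p \<le> q \<Longrightarrow> \<exists>i\<in>I. q i < p i"
  using PiE_le_iff[of p I T q] by (auto simp: not_le)

text \<open>By maximality of \<open>d\<close>, the image \<open>y\<close> of \<open>z\<close> dies
  one step beyond \<open>d\<close> in every direction, but \<open>z\<close> itself may survive at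
  points incomparable with \<open>d\<close>. Lifting \<open>y\<close> back to the least vertex with
  the same kernels replaces \<open>z\<close> by a generator \<open>x\<close> without this
  defect.\<close>

lemma splits_from_lo:
  assumes z0: "z0 \<in> obj M lo" "z0 \<noteq> 0"
  shows "\<exists>d x f. splits Q M lo d x f"
proof -
  define D where "D = {q \<in> Q. \<exists>z\<in>obj M lo. arr M lo q z \<noteq> 0}"
  have "lo \<in> D" unfolding D_def using z0 arr_id[OF lo_in z0(1)] lo_in
    by (intro CollectI conjI bexI[of _ z0]) simp_all
  then have "D \<noteq> {}" by blast
  have "finite D" unfolding D_def using finite_Q by simp
  from finite_has_maximal[OF this \<open>D \<noteq> {}\<close>]
  obtain d where dD: "d \<in> D" and dmax: "\<forall>q\<in>D. d \<le> q \<longrightarrow> d = q" by blast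
  then obtain z where d: "d \<in> Q" and z: "z \<in> obj M lo" "arr M lo d z \<noteq> 0" unfolding D_def by blast
  define J where "J = {j \<in> I. d j < hi j}"
  have JI: "J \<subseteq> I" unfolding J_def by blast
  have "\<forall>j\<in>J. \<exists>r. r \<in> T j \<and> d j < r \<and> (\<forall>t\<in>T j. d j < t \<longrightarrow> r \<le> t)"
    using next_ex unfolding J_def by blast
  from bchoice[OF this] obtain r where
    r: "\<forall>j\<in>J. r j \<in> T j \<and> d j < r j \<and> (\<forall>t\<in>T j. d j < t \<longrightarrow> r j \<le> t)" ..
  have lod: "lo \<le> d" by (rule lo_le[OF d])
  define y where "y = arr M lo d z"
  have y: "y \<in> obj M d" unfolding y_def by (rule arr_in[OF lo_in d lod z(1)])
  have ykill: "\<forall>j\<in>J. arr M d (d(j := r j)) y = 0"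
  proof
    fix j assume j: "j \<in> J"
    then have rj: "r j \<in> T j" "d j < r j" using r by blast+
    have q: "d(j := r j) \<in> Q" using PiE_upd_in[OF d] j JI rj(1) by blast
    have dq: "d \<le> d(j := r j)" using le_upd[of d j "r j"] rj(2) by simp
    have "d \<noteq> d(j := r j)" using rj(2) by (metis fun_upd_same less_irrefl)
    then have "d(j := r j) \<notin> D" using dmax dq by blast
    then have "arr M lo (d(j := r j)) z = 0" using q z(1) unfolding D_def by blast
    then show "arr M d (d(j := r j)) y = 0"
      unfolding y_def using arr_comp[OF lo_in d q lod dq z(1)] by simp
  qed
  have r': "\<forall>j\<in>J. r j \<in> T j \<and> d j \<le> r j" using r by (auto simp: less_imp_le)
  have "\<exists>x\<in>obj M lo. arr M lo d x = y \<and> (\<forall>j\<in>J. arr M lo (lo(j := r j)) x = 0)"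
  \<comment> \<open>If \<open>J\<close> has at least two elements, \<open>kernel_path\<close> may
    lower every coordinate. If \<open>J = {i}\<close>, it lowers all coordinates except
    \<open>i\<close> and stops at \<open>c\<close>. The remaining stretch along \<open>i\<close>
    uses the cokernel condition, since \<open>y\<close> is known to come from the point
    \<open>b\<close> below \<open>d\<close> with least \<open>i\<close>-th coordinate.\<close>
  proof (cases "\<forall>i. J - {i} \<noteq> {}")
    case True
    show ?thesis
      by (rule kernel_path[OF lo_in d lod subset_refl _ JI r' y ykill mix_eq[OF lo_in d]])
        (use True in auto)
  next
    case False
    then consider "J = {}" | i where "J = {i}" by blast
    then show ?thesis
    proof cases
      case 1
      then show ?thesis using z(1) y_def by auto
    next
      case (2 i)
      have iI: "i \<in> I" using 2 JI by blast
      have diT: "d i \<in> T i" using d iI by (rule PiE_mem)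
      have ri: "r i \<in> T i" "d i \<le> r i" using r' 2 by auto
      define c where "c = lo(i := d i)"
      have c: "c \<in> Q" unfolding c_def by (rule PiE_upd_in[OF lo_in iI diT])
      have loc: "lo \<le> c" by (rule lo_le[OF c])
      have cd: "c \<le> d" unfolding c_def using lod by (simp add: le_fun_def)
      have cmix: "c = (\<lambda>k. if k \<in> I - {i} then lo k else d k)"
      proof
        fix k show "c k = (if k \<in> I - {i} then lo k else d k)"
          unfolding c_def using PiE_arb[OF lo_in, of k] PiE_arb[OF d, of k] by auto
      qed
      have "\<exists>x\<in>obj M c. arr M c d x = y \<and> (\<forall>j\<in>J. arr M c (c(j := r j)) x = 0)"
        by (rule kernel_path[OF lo_in d lod _ _ JI r' y ykill cmix]) (use 2 in auto)
      then obtain x where x: "x \<in> obj M c" "arr M c d x = y" "arr M c (c(i := r i)) x = 0"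
        using 2 by auto
      define b where "b = d(i := lo i)"
      have b: "b \<in> Q" unfolding b_def by (rule PiE_upd_in[OF d iI lo_mem[OF iI]])
      have bd: "b \<le> d" unfolding b_def using lod by (simp add: le_fun_def)
      have dmix: "d = (\<lambda>k. if k \<in> I - {i} then d k else c k)"
        by (rule mix_eq[OF d c]) (auto simp: c_def)
      have cl: "c(i := lo i) = lo" unfolding c_def by simp
      have "\<exists>w. (\<forall>j\<in>{i}. w j \<in> obj M (c(j := lo j))) \<and>
          x = (\<Sum>j\<in>{i}. arr M (c(j := lo j)) c (w j))"
      proof (rule cokernel_path[OF c d cd _ _ _ _ x(1) dmix])
        show "\<forall>j\<in>{i}. arr M lo b z \<in> obj M (d(j := lo j))"
          using arr_in[OF lo_in b lo_le[OF b] z(1)] by (simp add: b_def)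
        have "arr M b d (arr M lo b z) = y"
          unfolding y_def by (rule arr_comp[OF lo_in b d lo_le[OF b] bd z(1)])
        then show "arr M c d x = (\<Sum>j\<in>{i}. arr M (d(j := lo j)) d (arr M lo b z))"
          using x(2) by (simp add: b_def)
        show "\<forall>j\<in>{i}. lo j \<in> T j \<and> lo j \<le> c j"
          using lo_mem[OF iI] lod by (simp add: c_def le_fun_def)
      qed (use iI in auto)
      then obtain w where w: "w \<in> obj M lo" "x = arr M lo c w" using cl by auto
      have "arr M lo d w = y" using arr_comp[OF lo_in c d loc cd w(1)] w(2) x(2) by simp
      moreover have "arr M lo (lo(i := r i)) w = 0"
      proof -
        have "lo(i := r i) \<in> Q" by (rule PiE_upd_in[OF lo_in iI ri(1)])
        then show ?thesis
          using arr_comp[OF lo_in c _ loc _ w(1), of "lo(i := r i)"] w(2) x(3) upd_mono[of lo lo "d i" "r i" i] ri(2)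
          by (simp add: c_def)
      qed
      ultimately show ?thesis using w(1) 2 by auto
    qed
  qed
  then obtain x where x: "x \<in> obj M lo" "arr M lo d x = y"
    "\<forall>j\<in>J. arr M lo (lo(j := r j)) x = 0" by blast
  have "\<exists>f. splits Q M lo d x f"
  \<comment> \<open>Every grid point is above \<open>lo\<close>, so the span to be avoided is zero;
    this is the case of empty \<open>J\<close> with an arbitrary \<open>l\<close>.\<close>
  proof (rule splits_if_not_in_images[OF lo_in d lod x(1), where J = "{}" and l = "\<lambda>_. undefined"])
    fix q assume q: "q \<in> Q" "lo \<le> q" "\<not> q \<le> d"
    obtain i where i: "i \<in> I" "d i < q i" using not_le_ex[OF q(1) d q(3)] by blast
    have qi: "q i \<in> T i" using q(1) i(1) by (rule PiE_mem)
    have iJ: "i \<in> J" unfolding J_def using i hi_max[OF i(1) qi] by auto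
    have ri: "r i \<in> T i" "r i \<le> q i" using r iJ qi i(2) by blast+
    have e: "lo(i := r i) \<in> Q" by (rule PiE_upd_in[OF lo_in i(1) ri(1)])
    have eq: "lo(i := r i) \<le> q" using q(2) ri(2) by (simp add: le_fun_def)
    show "arr M lo q x = 0"
      using arr_comp[OF lo_in e q(1) lo_le[OF e] eq x(1)] x(3) iJ arr_zero[OF e q(1) eq] by simp
  qed (use lo_le x(2) z(2) y_def in auto)
  then show ?thesis by blast
qed

text \<open>If the image of \<open>x\<close> at the greatest vertex were a sum of images from the
  points \<open>hi(j := l j)\<close>, the cokernel condition would express \<open>x\<close>, or its
  image further along the only direction of \<open>J\<close>, by vectors from points strictly below
  \<open>u\<close>. These map to 0 by minimality of \<open>u\<close>.\<close>

lemma splits_to_hi: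
  assumes x0: "x0 \<in> obj M hi" "x0 \<noteq> 0"
  shows "\<exists>u x f. splits Q M u hi x f"
proof -
  define D where "D = {q \<in> Q. \<exists>x\<in>obj M q. arr M q hi x \<noteq> 0}"
  have "hi \<in> D" unfolding D_def using x0 arr_id[OF hi_in x0(1)] hi_in
    by (intro CollectI conjI bexI[of _ x0]) simp_all
  then have "D \<noteq> {}" by blast
  have "finite D" unfolding D_def using finite_Q by simp
  from finite_has_minimal[OF this \<open>D \<noteq> {}\<close>]
  obtain u where uD: "u \<in> D" and umin: "\<forall>q\<in>D. q \<le> u \<longrightarrow> u = q" by blast
  then obtain x where u: "u \<in> Q" and x: "x \<in> obj M u" "arr M u hi x \<noteq> 0" unfolding D_def by blast
  define J where "J = {j \<in> I. lo j < u j}"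
  have JI: "J \<subseteq> I" unfolding J_def by blast
  have "\<forall>j\<in>J. \<exists>r. r \<in> T j \<and> r < u j \<and> (\<forall>t\<in>T j. t < u j \<longrightarrow> t \<le> r)"
    using prev_ex unfolding J_def by blast
  from bchoice[OF this] obtain l where
    l: "\<forall>j\<in>J. l j \<in> T j \<and> l j < u j \<and> (\<forall>t\<in>T j. t < u j \<longrightarrow> t \<le> l j)" ..
  have uhi: "u \<le> hi" by (rule le_hi[OF u])
  have small: "arr M (u(j := l j)) hi w = 0" if j: "j \<in> J" and w: "w \<in> obj M (u(j := l j))" for j w
  proof -
    have lj: "l j \<in> T j" "l j < u j" using l j by blast+
    have q: "u(j := l j) \<in> Q" using PiE_upd_in[OF u] j JI lj(1) by blast
    have dq: "u(j := l j) \<le> u" using upd_le[of "l j" u j] lj(2) by simp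
    have "u \<noteq> u(j := l j)" using lj(2) by (metis fun_upd_same less_irrefl)
    then have "u(j := l j) \<notin> D" using umin dq by blast
    then show ?thesis using q w unfolding D_def by blast
  qed
  have l': "\<forall>j\<in>J. l j \<in> T j \<and> l j \<le> u j" using l by (auto simp: less_imp_le)
  have "\<exists>f. splits Q M u hi x f"
  proof (rule splits_if_not_in_images[OF u hi_in uhi x(1) _ JI])
    show "arr M u q x = 0" if "q \<in> Q" "u \<le> q" "\<not> q \<le> hi" for q using that le_hi by blast
    show "\<forall>j\<in>J. l j \<in> T j \<and> l j \<le> hi j" using l JI hi_max by blast
    show "\<exists>j\<in>J. q j \<le> l j" if q: "q \<in> Q" "q \<le> hi" "\<not> u \<le> q" for q
    proof -
      obtain i where i: "i \<in> I" "q i < u i" using not_le_ex[OF u q(1) q(3)] by blast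
      have qi: "q i \<in> T i" using q(1) i(1) by (rule PiE_mem)
      have "i \<in> J" unfolding J_def using i lo_min[OF i(1) qi] by auto
      then show ?thesis using l qi i(2) by blast
    qed
    fix w assume w: "\<forall>j\<in>J. w j \<in> obj M (hi(j := l j))"
    show "arr M u hi x \<noteq> (\<Sum>j\<in>J. arr M (hi(j := l j)) hi (w j))"
    proof
      assume eq: "arr M u hi x = (\<Sum>j\<in>J. arr M (hi(j := l j)) hi (w j))"
      show False
      proof (cases "\<forall>i. J - {i} \<noteq> {}")
        case True
        have "\<exists>w. (\<forall>j\<in>J. w j \<in> obj M (u(j := l j))) \<and> x = (\<Sum>j\<in>J. arr M (u(j := l j)) u (w j))"
          by (rule cokernel_path[OF u hi_in uhi subset_refl _ JI l' x(1) mix_eq[OF hi_in u] w eq])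
            (use True in auto)
        then obtain w' where w': "\<forall>j\<in>J. w' j \<in> obj M (u(j := l j))"
          "x = (\<Sum>j\<in>J. arr M (u(j := l j)) u (w' j))" by blast
        have ul: "u(j := l j) \<in> Q" "u(j := l j) \<le> u" if "j \<in> J" for j
          using PiE_upd_in[OF u subsetD[OF JI that]] upd_le[of "l j" u j] l'[THEN bspec, OF that]
          by simp_all
        have "arr M u hi x = (\<Sum>j\<in>J. arr M u hi (arr M (u(j := l j)) u (w' j)))"
          unfolding w'(2) by (rule arr_sum[OF u hi_in uhi]) (use w'(1) ul u arr_in in blast)
        also have "\<dots> = 0"
        proof (rule sum.neutral, rule ballI)
          fix j assume j: "j \<in> J"
          have "w' j \<in> obj M (u(j := l j))" using w'(1) j by blast
          then show "arr M u hi (arr M (u(j := l j)) u (w' j)) = 0"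
            using arr_comp[OF ul(1)[OF j] u hi_in ul(2)[OF j] uhi] small[OF j] by simp
        qed
        finally show False using x(2) by simp
      next
        case False
        then consider "J = {}" | i where "J = {i}" by blast
        then show False
        proof cases
          case 1 then show False using eq x(2) by simp
        next
          case (2 i)
          have iI: "i \<in> I" using 2 JI by blast
          have li: "l i \<in> T i" "l i \<le> u i" using l' 2 by auto
          \<comment> \<open>With \<open>J = {i}\<close> the cokernel condition cannot move along
            \<open>i\<close>. So \<open>x\<close> is first pushed to the end of axis
            \<open>i\<close> and is then compared with the greatest vertex along the other
            axes.\<close>
          define c where "c = u(i := hi i)"
          have c: "c \<in> Q" unfolding c_def by (rule PiE_upd_in[OF u iI hi_mem[OF iI]])
          have uc: "u \<le> c" unfolding c_def using le_upd[of u i "hi i"] uhi by (simp add: le_fun_def)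
          have chi: "c \<le> hi" by (rule le_hi[OF c])
          define y where "y = arr M u c x"
          have y: "y \<in> obj M c" unfolding y_def by (rule arr_in[OF u c uc x(1)])
          have cl: "c(i := l i) = u(i := l i)" unfolding c_def by simp
          have "\<exists>w. (\<forall>j\<in>{i}. w j \<in> obj M (c(j := l j))) \<and>
              y = (\<Sum>j\<in>{i}. arr M (c(j := l j)) c (w j))"
          proof (rule cokernel_path[OF c hi_in chi _ _ _ _ y])
            show "hi = (\<lambda>k. if k \<in> I - {i} then hi k else c k)"
              by (rule mix_eq[OF hi_in c]) (auto simp: c_def)
            show "\<forall>j\<in>{i}. w j \<in> obj M (hi(j := l j))" using w 2 by simp
            show "arr M c hi y = (\<Sum>j\<in>{i}. arr M (hi(j := l j)) hi (w j))"
              unfolding y_def using arr_comp[OF u c hi_in uc chi x(1)] eq 2 by simp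
            show "\<forall>j\<in>{i}. l j \<in> T j \<and> l j \<le> c j"
              using li(1) hi_max[OF iI li(1)] by (simp add: c_def)
          qed (use iI in auto)
          then obtain w' where w': "w' \<in> obj M (u(i := l i))" "y = arr M (u(i := l i)) c w'"
            using cl by auto
          have ul: "u(i := l i) \<in> Q" by (rule PiE_upd_in[OF u iI li(1)])
          have ulc: "u(i := l i) \<le> c" using upd_le[of "l i" u i] li(2) uc by simp
          have "arr M u hi x = arr M c hi y" unfolding y_def using arr_comp[OF u c hi_in uc chi x(1)] by simp
          also have "\<dots> = arr M (u(i := l i)) hi w'"
            unfolding w'(2) by (rule arr_comp[OF ul c hi_in ulc chi w'(1)])
          also have "\<dots> = 0" by (rule small) (use 2 w'(1) in auto)
          finally show False using x(2) by simp
        qed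
      qed
    qed
  qed
  then show ?thesis by blast
qed

text \<open>The case \<open>J = {i}\<close> of \<open>cokernel_path\<close>: whether a vector on the
  lowest edge in direction \<open>i\<close> comes from position \<open>t\<close> can be tested on
  the opposite edge.\<close>

lemma edge_cokernels_embed:
  assumes iI: "i \<in> I" and s: "s \<in> T i" and t: "t \<in> T i" "t \<le> s"
    and y: "y \<in> obj M (lo(i := s))" and w: "w \<in> obj M (hi(i := t))"
    and eq: "arr M (lo(i := s)) (hi(i := s)) y = arr M (hi(i := t)) (hi(i := s)) w"
  shows "\<exists>w'\<in>obj M (lo(i := t)). y = arr M (lo(i := t)) (lo(i := s)) w'"
proof -
  define u where "u = lo(i := s)"
  define v where "v = hi(i := s)"
  have u: "u \<in> Q" and v: "v \<in> Q"
    unfolding u_def v_def by (rule PiE_upd_in[OF lo_in iI s] PiE_upd_in[OF hi_in iI s])+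
  have uv: "u \<le> v" unfolding u_def v_def by (rule upd_mono[OF lo_le[OF hi_in] order_refl])
  have ut: "u(i := t) = lo(i := t)" and vt: "v(i := t) = hi(i := t)" unfolding u_def v_def by simp_all
  have "\<exists>w. (\<forall>j\<in>{i}. w j \<in> obj M (u(j := t))) \<and> y = (\<Sum>j\<in>{i}. arr M (u(j := t)) u (w j))"
  proof (rule cokernel_path[OF u v uv])
    show "v = (\<lambda>k. if k \<in> I - {i} then v k else u k)"
      by (rule mix_eq[OF v u]) (auto simp: u_def v_def)
    show "arr M u v y = (\<Sum>j\<in>{i}. arr M (v(j := t)) v w)"
      using eq unfolding u_def v_def by simp
    show "\<forall>j\<in>{i}. w \<in> obj M (v(j := t))" using w vt by simp
    show "\<forall>j\<in>{i}. t \<in> T j \<and> t \<le> u j" using t by (simp add: u_def)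
    show "y \<in> obj M u" using y by (simp add: u_def)
  qed (use iI in auto)
  then show ?thesis using ut by (auto simp: u_def)
qed

text \<open>Because the space at the greatest vertex is zero, the cokernel condition shows that the
  space at a point with two or more raised coordinates is spanned by images from smaller points.
  Hence a minimal support point lies on an edge at the least vertex. What remains is a module over
  one totally ordered edge, on which the vector at that point dies before the end or there.\<close>

lemma splits_band:
  assumes lo0: "\<And>x. x \<in> obj M lo \<Longrightarrow> x = 0" and hi0: "\<And>x. x \<in> obj M hi \<Longrightarrow> x = 0"
    and q0: "q0 \<in> Q" "x0 \<in> obj M q0" "x0 \<noteq> 0"
  shows "\<exists>i\<in>I. \<exists>a b x f. splits Q M (lo(i := a)) (hi(i := b)) x f"
proof -
  define D where "D = {q \<in> Q. \<exists>x\<in>obj M q. x \<noteq> 0}"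
  have "q0 \<in> D" unfolding D_def using q0 by blast
  then have "D \<noteq> {}" by blast
  have "finite D" unfolding D_def using finite_Q by simp
  from finite_has_minimal[OF this \<open>D \<noteq> {}\<close>]
  obtain p where pD: "p \<in> D" and pmin: "\<forall>q\<in>D. q \<le> p \<longrightarrow> p = q" by blast
  then obtain x where p: "p \<in> Q" and x: "x \<in> obj M p" "x \<noteq> 0" unfolding D_def by blast
  define J where "J = {j \<in> I. lo j < p j}"
  have JI: "J \<subseteq> I" unfolding J_def by blast
  have plo: "p i = lo i" if "i \<notin> J" for i
    using that lo_min[of i "p i"] PiE_mem[OF p, of i] PiE_arb[OF p, of i] PiE_arb[OF lo_in, of i]
    unfolding J_def by fastforce
  have phi: "p \<le> hi" by (rule le_hi[OF p])
  have "\<exists>i. J = {i}"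
  proof (rule ccontr)
    assume n1: "\<nexists>i. J = {i}"
    have "J \<noteq> {}"
    proof
      assume "J = {}"
      then have "p = lo" using plo by (intro ext) simp
      then show False using lo0 x by blast
    qed
    then have J2: "J - {i} \<noteq> {}" for i using n1 by blast
    have "\<forall>j\<in>J. \<exists>r. r \<in> T j \<and> r < p j \<and> (\<forall>t\<in>T j. t < p j \<longrightarrow> t \<le> r)"
      using prev_ex unfolding J_def by blast
    from bchoice[OF this] obtain l where
      l: "\<forall>j\<in>J. l j \<in> T j \<and> l j < p j \<and> (\<forall>t\<in>T j. t < p j \<longrightarrow> t \<le> l j)" ..
    then have l': "\<forall>j\<in>J. l j \<in> T j \<and> l j \<le> p j" by (auto simp: less_imp_le)
    have pl: "p(j := l j) \<in> Q" "p(j := l j) \<le> p" "p(j := l j) \<noteq> p" if "j \<in> J" for j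
      using PiE_upd_in[OF p subsetD[OF JI that]] upd_le[of "l j" p j] l[THEN bspec, OF that]
      by (auto simp: less_imp_le fun_eq_iff)
    have hl: "hi(j := l j) \<in> Q" if "j \<in> J" for j
      using PiE_upd_in[OF hi_in subsetD[OF JI that]] l[THEN bspec, OF that] by simp
    have "\<exists>w. (\<forall>j\<in>J. w j \<in> obj M (p(j := l j))) \<and> x = (\<Sum>j\<in>J. arr M (p(j := l j)) p (w j))"
    proof (rule cokernel_path[OF p hi_in phi subset_refl J2 JI l' x(1) mix_eq[OF hi_in p]])
      show "\<forall>j\<in>J. 0 \<in> obj M (hi(j := l j))" using hl zero_in by blast
      have "arr M p hi x = 0" by (rule hi0[OF arr_in[OF p hi_in phi x(1)]])
      then show "arr M p hi x = (\<Sum>j\<in>J. arr M (hi(j := l j)) hi 0)"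
        using arr_zero[OF hl hi_in le_hi[OF hl]] by simp
    qed auto
    then obtain w where w: "\<forall>j\<in>J. w j \<in> obj M (p(j := l j))"
      "x = (\<Sum>j\<in>J. arr M (p(j := l j)) p (w j))" by blast
    have "w j = 0" if j: "j \<in> J" for j
    proof (rule ccontr)
      assume "w j \<noteq> 0"
      then have "p(j := l j) \<in> D" unfolding D_def using w(1) j pl(1)[OF j] by blast
      then show False using pmin pl(2,3)[OF j] by (metis)
    qed
    then have "x = 0" using w(2) arr_zero[OF pl(1) p pl(2)] by simp
    then show False using x(2) by simp
  qed
  then obtain i where Ji: "J = {i}" ..
  have iI: "i \<in> I" using Ji JI by blast
  define E where "E s = lo(i := s)" for s
  have E: "E s \<in> Q" if "s \<in> T i" for s unfolding E_def by (rule PiE_upd_in[OF lo_in iI that])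
  have Ele: "E s \<le> E t" if "s \<le> t" for s t unfolding E_def by (rule upd_mono[OF order_refl that])
  have Elo: "E (lo i) = lo" unfolding E_def by simp
  have hiT: "hi i \<in> T i" by (rule hi_mem[OF iI])
  have pE: "p = E (p i)" unfolding E_def using plo Ji by (intro ext) auto
  have piT: "p i \<in> T i" using p iI by (rule PiE_mem)
  have Ecomp: "arr M (E s) (E t) (arr M (E r) (E s) y) = arr M (E r) (E t) y"
    if "r \<in> T i" "s \<in> T i" "t \<in> T i" "r \<le> s" "s \<le> t" "y \<in> obj M (E r)" for r s t y
    by (rule arr_comp[OF E[OF that(1)] E[OF that(2)] E[OF that(3)] Ele[OF that(4)] Ele[OF that(5)] that(6)])
  \<comment> \<open>The band starts at \<open>a\<close>, the first position where some nonzero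
    vector dies along the edge, and stops at the predecessor \<open>b\<close> of \<open>c\<close>,
    the first position where some nonzero vector of \<open>E a\<close> has died. The choice of
    \<open>a\<close> makes the maps from earlier positions to the end of the edge injective, that of
    \<open>c\<close> makes the map from \<open>E a\<close> to \<open>E b\<close> injective. Together
    they keep the image of \<open>y\<close> outside the image from the predecessor \<open>l\<close>
    of \<open>a\<close>.\<close>
  define S1 where "S1 = {s \<in> T i. \<exists>y\<in>obj M (E s). y \<noteq> 0 \<and> arr M (E s) (E (hi i)) y = 0}"
  have "p i \<in> S1"
  proof -
    define x1 where "x1 = arr M p (E (hi i)) x"
    have pEh: "p \<le> E (hi i)" using Ele[OF hi_max[OF iI piT]] pE by simp
    have x1: "x1 \<in> obj M (lo(i := hi i))"
      using arr_in[OF p E[OF hiT] pEh x(1)] unfolding x1_def E_def .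
    have hil: "hi(i := lo i) \<in> Q" by (rule PiE_upd_in[OF hi_in iI lo_mem[OF iI]])
    have "\<exists>w'\<in>obj M (lo(i := lo i)). x1 = arr M (lo(i := lo i)) (lo(i := hi i)) w'"
    proof (rule edge_cokernels_embed[OF iI hiT lo_mem[OF iI] hi_max[OF iI lo_mem[OF iI]] x1])
      show "0 \<in> obj M (hi(i := lo i))" by (rule zero_in[OF hil])
      have "arr M (lo(i := hi i)) hi x1 = 0"
        by (rule hi0[OF arr_in[OF E[OF hiT, unfolded E_def] hi_in le_hi[OF E[OF hiT, unfolded E_def]] x1]])
      then show "arr M (lo(i := hi i)) (hi(i := hi i)) x1 = arr M (hi(i := lo i)) (hi(i := hi i)) 0"
        using arr_zero[OF hil hi_in le_hi[OF hil]] by simp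
    qed
    then obtain w' where w': "w' \<in> obj M lo" "x1 = arr M lo (lo(i := hi i)) w'" by auto
    have "w' = 0" by (rule lo0[OF w'(1)])
    then have "x1 = 0"
      using w'(2) arr_zero[OF lo_in E[OF hiT] lo_le[OF E[OF hiT]]] unfolding E_def by simp
    then show ?thesis
      unfolding S1_def x1_def using x piT pE by (intro CollectI conjI bexI[of _ x]) simp_all
  qed
  moreover have finS1: "finite S1" unfolding S1_def using fin_T[OF iI] by simp
  ultimately have MinS1: "Min S1 \<in> S1" using Min_in by blast
  define a where "a = Min S1"
  have aT: "a \<in> T i" and aex: "\<exists>y\<in>obj M (E a). y \<noteq> 0 \<and> arr M (E a) (E (hi i)) y = 0"
    using MinS1 unfolding S1_def a_def by blast+
  have amin: "y = 0" if "s \<in> T i" "s < a" "y \<in> obj M (E s)" "arr M (E s) (E (hi i)) y = 0" for s y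
  proof (rule ccontr)
    assume "y \<noteq> 0"
    then have "s \<in> S1" unfolding S1_def using that by blast
    then have "a \<le> s" unfolding a_def by (rule Min_le[OF finS1])
    then show False using that(2) by simp
  qed
  have loa: "lo i < a"
  proof -
    have "a \<noteq> lo i" using aex Elo lo0 by auto
    then show ?thesis using lo_min[OF iI aT] by simp
  qed
  define S2 where "S2 = {c \<in> T i. a \<le> c \<and> (\<exists>y\<in>obj M (E a). y \<noteq> 0 \<and> arr M (E a) (E c) y = 0)}"
  have "hi i \<in> S2" unfolding S2_def using aex hiT hi_max[OF iI aT] by blast
  moreover have finS2: "finite S2" unfolding S2_def using fin_T[OF iI] by simp
  ultimately have MinS2: "Min S2 \<in> S2" using Min_in by blast
  define c where "c = Min S2"
  obtain y where cT: "c \<in> T i" and ac: "a \<le> c" and y: "y \<in> obj M (E a)" "y \<noteq> 0"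
    and yc: "arr M (E a) (E c) y = 0"
    using MinS2 unfolding S2_def c_def by blast
  have "a \<noteq> c" using yc y arr_id[OF E[OF aT] y(1)] by auto
  then have ac': "a < c" using ac by simp
  obtain l where l: "l \<in> T i" "l < a" "\<forall>t\<in>T i. t < a \<longrightarrow> t \<le> l" using prev_ex[OF iI loa] by blast
  have "lo i < c" using loa ac' by (rule less_trans)
  then obtain b where b: "b \<in> T i" "b < c" "\<forall>t\<in>T i. t < c \<longrightarrow> t \<le> b"
    using prev_ex[OF iI] by blast
  have ab: "a \<le> b" using b(3) aT ac' by blast
  have d: "hi(i := b) \<in> Q" by (rule PiE_upd_in[OF hi_in iI b(1)])
  have ud: "E a \<le> hi(i := b)" unfolding E_def by (rule upd_mono[OF lo_le[OF hi_in] ab])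
  have "\<exists>f. splits Q M (E a) (hi(i := b)) y f"
  proof (rule splits_if_not_in_images[OF E[OF aT] d ud y(1), where J = "{i}" and l = "\<lambda>_. l"])
    fix q assume q: "q \<in> Q" "E a \<le> q" "\<not> q \<le> hi(i := b)"
    obtain k where k: "k \<in> I" "(hi(i := b)) k < q k" using not_le_ex[OF q(1) d q(3)] by blast
    have qk: "q k \<in> T k" using q(1) k(1) by (rule PiE_mem)
    have "k = i" using k hi_max[OF k(1) qk] by (cases "k = i") auto
    then have "b < q i" "q i \<in> T i" using k qk by auto
    then have cq: "c \<le> q i" using b(3) by (metis leD not_le)
    have Ecq: "E c \<le> q" unfolding E_def using cq lo_le[OF q(1)] by (simp add: le_fun_def)
    show "arr M (E a) q y = 0"
      using arr_comp[OF E[OF aT] E[OF cT] q(1) Ele[OF ac] Ecq y(1)] yc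
        arr_zero[OF E[OF cT] q(1) Ecq] by simp
  next
    show "\<forall>j\<in>{i}. l \<in> T j \<and> l \<le> (hi(i := b)) j" using l ab by auto
  next
    fix q assume q: "q \<in> Q" "q \<le> hi(i := b)" "\<not> E a \<le> q"
    obtain k where k: "k \<in> I" "q k < (E a) k" using not_le_ex[OF E[OF aT] q(1) q(3)] by blast
    have qk: "q k \<in> T k" using q(1) k(1) by (rule PiE_mem)
    have "k = i" using k lo_min[OF k(1) qk] unfolding E_def by (cases "k = i") auto
    then show "\<exists>j\<in>{i}. q j \<le> l" using k qk l(3) unfolding E_def by auto
  next
    fix w assume w: "\<forall>j\<in>{i}. w j \<in> obj M (hi(i := b, j := l))"
    show "arr M (E a) (hi(i := b)) y \<noteq> (\<Sum>j\<in>{i}. arr M (hi(i := b, j := l)) (hi(i := b)) (w j))"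
    proof
      assume "arr M (E a) (hi(i := b)) y = (\<Sum>j\<in>{i}. arr M (hi(i := b, j := l)) (hi(i := b)) (w j))"
      then have eq: "arr M (E a) (hi(i := b)) y = arr M (hi(i := l)) (hi(i := b)) (w i)" by simp
      have lb: "l \<le> b" using l(2) ab by simp
      have Ebd: "E b \<le> hi(i := b)" unfolding E_def by (rule upd_mono[OF lo_le[OF hi_in] order_refl])
      define y' where "y' = arr M (E a) (E b) y"
      have y': "y' \<in> obj M (lo(i := b))"
        using arr_in[OF E[OF aT] E[OF b(1)] Ele[OF ab] y(1)] unfolding y'_def E_def .
      have "arr M (lo(i := b)) (hi(i := b)) y' = arr M (hi(i := l)) (hi(i := b)) (w i)"
        using arr_comp[OF E[OF aT] E[OF b(1)] d Ele[OF ab] Ebd y(1)] eq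
        unfolding y'_def E_def by simp
      from edge_cokernels_embed[OF iI b(1) l(1) lb y' _ this]
      obtain w' where w': "w' \<in> obj M (E l)" "y' = arr M (E l) (E b) w'"
        using w unfolding E_def by auto
      have bc: "b \<le> c" using b(2) by simp
      have ch: "c \<le> hi i" by (rule hi_max[OF iI cT])
      have "arr M (E l) (E c) w' = arr M (E b) (E c) y'"
        unfolding w'(2) using Ecomp[OF l(1) b(1) cT lb bc w'(1)] by simp
      also have "\<dots> = 0"
        unfolding y'_def using Ecomp[OF aT b(1) cT ab bc y(1)] yc by simp
      finally have "arr M (E l) (E c) w' = 0" .
      then have "arr M (E l) (E (hi i)) w' = 0"
        using Ecomp[OF l(1) cT hiT _ ch w'(1)] lb bc arr_zero[OF E[OF cT] E[OF hiT] Ele[OF ch]] by simp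
      then have "w' = 0" by (rule amin[OF l(1,2) w'(1)])
      then have "y' = 0" using w'(2) arr_zero[OF E[OF l(1)] E[OF b(1)] Ele[OF lb]] by simp
      then have "b \<in> S2" unfolding S2_def y'_def using b(1) ab y by blast
      then have "c \<le> b" unfolding c_def by (rule Min_le[OF finS2])
      then show False using b(2) by simp
    qed
  qed (use iI in auto)
  then show ?thesis unfolding E_def using iI by blast
qed

lemma splits_exists:
  assumes "q0 \<in> Q" "x0 \<in> obj M q0" "x0 \<noteq> 0"
  shows "\<exists>u d x f. splits Q M u d x f \<and> grid_corners I T u d"
proof (cases "(\<forall>x\<in>obj M lo. x = 0) \<and> (\<forall>x\<in>obj M hi. x = 0)")
  case True
  then obtain i a b x f where i: "i \<in> I" and s: "splits Q M (lo(i := a)) (hi(i := b)) x f"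
    using splits_band[OF _ _ assms] by blast
  have "grid_corners I T (lo(i := a)) (hi(i := b))"
    unfolding grid_corners_def by (intro disjI2 bexI[OF _ i]) (auto simp: lo_def hi_def)
  then show ?thesis using s by blast
next
  case False
  moreover have "grid_corners I T lo d" "grid_corners I T u hi" for u d
    unfolding grid_corners_def by (simp_all add: lo_def hi_def)
  ultimately show ?thesis using splits_from_lo splits_to_hi by blast
qed

end

text \<open>Induction on the total dimension. The idempotent of an interval that misses
  \<open>p\<close> vanishes at \<open>p\<close>, so \<open>y\<close> survives in the complementary
  summand, which inherits all hypotheses. An interval split off there is split off \<open>M\<close>
  by precomposing its functional with the projection \<open>g\<close>.\<close>

lemma grid_splits_at:
  fixes I :: "'i set" and T :: "'i \<Rightarrow> 'a::linorder set"
    and M :: "('i \<Rightarrow> 'a, 'k::field, 'v::ab_group_add) persmod"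
  assumes fin: "finite I" "\<And>i. i \<in> I \<Longrightarrow> finite (T i)" "\<And>i. i \<in> I \<Longrightarrow> T i \<noteq> {}" and p: "p \<in> PiE I T"
  shows "persistence_module (PiE I T) M \<Longrightarrow> pfd (PiE I T) M \<Longrightarrow> kernels_lift I T M \<Longrightarrow>
    cokernels_embed I T M \<Longrightarrow> y \<in> obj M p \<Longrightarrow> y \<noteq> 0 \<Longrightarrow>
    \<exists>u d x f. splits (PiE I T) M u d x f \<and> grid_corners I T u d \<and> u \<le> p \<and> p \<le> d"
proof (induction "\<Sum>q\<in>PiE I T. vector_space.dim (scl M) (obj M q)" arbitrary: M y rule: less_induct)
  case less
  interpret persistence_module "PiE I T" M by (rule less.prems(1))
  interpret grid_module I T M
    by unfold_locales (fact fin less.prems(3,4))+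
  obtain u0 d0 x0 f0 where s0: "splits Q M u0 d0 x0 f0" and c0: "grid_corners I T u0 d0"
    using splits_exists[OF p less.prems(5,6)] by blast
  show ?case
  proof (cases "u0 \<le> p \<and> p \<le> d0")
    case True
    then show ?thesis using s0 c0 by blast
  next
    case False
    define e where "e = split_endo M u0 d0 x0 f0"
    have e: "endo Q M e" "idem Q M e" and eu: "e u0 x0 = x0" "x0 \<noteq> 0"
      unfolding e_def using split_endo[OF s0] by blast+
    define g where "g = (\<lambda>q z. z - e q z)"
    have g: "endo Q M g" unfolding g_def by (rule endo_minus[OF endo_id e(1)])
    have gi: "idem Q M g"
      unfolding idem_def g_def using endo_diff[OF e(1)] endo_in[OF e(1)] e(2)
      by (simp add: idem_def)
    define C where "C = image_mod M g"
    have C: "scl C = scl M" "arr C = arr M" "\<And>q. obj C q = g q ` obj M q" by (simp_all add: C_def)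
    have Csub: "obj C q \<subseteq> obj M q" if "q \<in> Q" for q
      unfolding C using endo_in[OF g that] by blast
    have Cfix: "g q z = z" if "q \<in> Q" "z \<in> obj C q" for q z
      using that gi unfolding C idem_def by auto
    have fd: "fin_dim (obj M q)" if "q \<in> Q" for q using less.prems(2) that unfolding pfd_def by blast
    have Cs: "subspace (obj C q)" if "q \<in> Q" for q unfolding C by (rule subspace_endo_image[OF g that])
    have u0: "u0 \<in> Q" "x0 \<in> obj M u0" using s0 unfolding splits_def by blast+
    have "x0 \<notin> obj C u0"
    proof
      assume "x0 \<in> obj C u0"
      then have "g u0 x0 = x0" by (rule Cfix[OF u0(1)])
      then show False using eu unfolding g_def by simp
    qed
    then have "obj C u0 \<subset> obj M u0" using Csub u0 by blast
    then have "dim (obj C u0) < dim (obj M u0)" by (rule fin_dim_psubset_dim[OF fd[OF u0(1)] Cs[OF u0(1)]])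
    moreover have "dim (obj C q) \<le> dim (obj M q)" if "q \<in> Q" for q
      by (rule fin_dim_subset_dim[OF fd[OF that] Cs[OF that] Csub[OF that]])
    ultimately have "(\<Sum>q\<in>Q. dim (obj C q)) < (\<Sum>q\<in>Q. dim (obj M q))"
      using finite_Q u0(1) by (intro sum_strict_mono_ex1) auto
    then have lt: "(\<Sum>q\<in>Q. vector_space.dim (scl C) (obj C q)) < (\<Sum>q\<in>Q. dim (obj M q))"
      unfolding C(1) .
    have "e p y = 0" using False unfolding e_def split_endo_def by auto
    then have "g p y = y" unfolding g_def by simp
    then have yC: "y \<in> obj C p" unfolding C using less.prems(5) by (metis imageI)
    have "\<exists>u d x f. splits Q C u d x f \<and> grid_corners I T u d \<and> u \<le> p \<and> p \<le> d"
    proof (rule less.hyps[OF lt _ _ _ _ yC less.prems(6)])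
      show "persistence_module Q C" unfolding C_def by (rule persistence_module_image[OF g])
      show "pfd Q C" unfolding C_def by (rule pfd_image[OF g less.prems(2)])
      show "kernels_lift I T C"
        unfolding C_def by (rule kernels_lift_image[OF less.prems(1,3) g gi])
      show "cokernels_embed I T C"
        unfolding C_def by (rule cokernels_embed_image[OF less.prems(1,4) g gi])
    qed
    then obtain u d x f where s: "splits Q C u d x f" and cor: "grid_corners I T u d" "u \<le> p" "p \<le> d"
      by blast
    have u: "u \<in> Q" and d: "d \<in> Q" and ud: "u \<le> d" and x: "x \<in> obj C u"
      and kill: "\<forall>q\<in>Q. u \<le> q \<and> \<not> q \<le> d \<longrightarrow> arr M u q x = 0"
      and fadd: "\<forall>a\<in>obj C d. \<forall>b\<in>obj C d. f (a + b) = f a + f b"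
      and fscl: "\<forall>c. \<forall>a\<in>obj C d. f (scl M c a) = c * f a"
      and f1: "f (arr M u d x) = 1"
      and f0: "\<forall>q\<in>Q. q \<le> d \<and> \<not> u \<le> q \<longrightarrow> (\<forall>y\<in>obj C q. f (arr M q d y) = 0)"
      using s unfolding splits_def C(1,2) by auto
    have gC: "g q z \<in> obj C q" if "z \<in> obj M q" for q z unfolding C using that by blast
    have xM: "x \<in> obj M u" using x Csub[OF u] by blast
    have "splits Q M u d x (\<lambda>z. f (g d z))"
      unfolding splits_def
    proof (intro conjI ballI allI impI, goal_cases)
      case (6 a b)
      then show ?case using endo_add[OF g d 6] fadd gC by simp
    next
      case (7 c a)
      then show ?case using endo_scl[OF g d 7] fscl gC by simp
    next
      case 8
      then show ?case using endo_arr[OF g u d ud xM] Cfix[OF u x] f1 by simp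
    next
      case (9 q z)
      then have "g d (arr M q d z) = arr M q d (g q z)" using endo_arr[OF g 9(1) d _ 9(3)] by blast
      then show ?case using f0 9 gC by simp
    qed (use u d ud xM kill in auto)
    then show ?thesis using cor by blast
  qed
qed

section \<open>Indecomposable modules are block modules\<close>

text \<open>Each whole axis is one use of rule \<open>induced\<close>; starting from at least two
  axes guarantees its cardinality condition.\<close>

lemma block_extend:
  assumes J: "finite J" "card J \<ge> 2" and b: "block T J (PiE J S)" and K: "finite K" "K \<inter> J = {}"
    and S: "\<And>i. i \<in> K \<Longrightarrow> S i = T i" "\<And>i. i \<in> J \<Longrightarrow> S i \<subseteq> T i"
  shows "block T (K \<union> J) (PiE (K \<union> J) S)"
  using K S
proof (induction K rule: finite_induct)
  case empty
  then show ?case using b by simp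
next
  case (insert k K)
  let ?I = "insert k K \<union> J"
  have IH: "block T (K \<union> J) (PiE (K \<union> J) S)"
    by (rule insert.IH) (use insert.prems in auto)
  have diff: "?I - {k} = K \<union> J" using insert.prems(1) insert.hyps(2) by auto
  have fin: "finite (K \<union> J)" using insert.hyps(1) J(1) by simp
  have "card J \<le> card (K \<union> J)" by (rule card_mono[OF fin]) simp
  moreover have "card ?I = Suc (card (K \<union> J))"
    using card_insert_disjoint[OF fin, of k] insert.prems(1) insert.hyps(2) by auto
  ultimately have card: "card ?I \<ge> 3" using J(2) by simp
  have "block T ?I {x \<in> PiE ?I T. restrict x (?I - {k}) \<in> PiE (K \<union> J) S}"
    by (rule block.induced) (use card fin diff IH in auto)
  moreover have "{x \<in> PiE ?I T. restrict x (?I - {k}) \<in> PiE (K \<union> J) S} = PiE ?I S"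
  proof (rule set_eqI)
    fix x
    have "x \<in> PiE ?I S" if "x \<in> PiE ?I T" "restrict x (K \<union> J) \<in> PiE (K \<union> J) S"
    proof (rule PiE_I)
      fix i assume i: "i \<in> ?I"
      show "x i \<in> S i"
      proof (cases "i = k")
        case True
        then show ?thesis using PiE_mem[OF that(1) i] insert.prems(2) by simp
      next
        case False
        then have "i \<in> K \<union> J" using i by blast
        then show ?thesis using PiE_mem[OF that(2), of i] by simp
      qed
    qed (use PiE_arb[OF that(1)] in simp)
    moreover have "x \<in> PiE ?I T" if "x \<in> PiE ?I S"
      using that PiE_mono[of ?I S T] insert.prems(2,3) by blast
    moreover have "restrict x (K \<union> J) \<in> PiE (K \<union> J) S" if "x \<in> PiE ?I S"
      using PiE_mem[OF that] by auto
    ultimately show "x \<in> {x \<in> PiE ?I T. restrict x (?I - {k}) \<in> PiE (K \<union> J) S} \<longleftrightarrow> x \<in> PiE ?I S"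
      unfolding diff by blast
  qed
  ultimately show ?case by simp
qed

text \<open>\<open>J\<close> collects the axes with a proper factor. If there is at most one, some
  second axis completes it to a band, the whole product being included since a whole axis is an
  interval. Otherwise the factors over \<open>J\<close> are all proper up-sets or all proper
  down-sets. The remaining axes are whole.\<close>

lemma product_is_block:
  fixes T :: "'i \<Rightarrow> 'a::linorder set"
  assumes I: "finite I" "card I \<ge> 2"
    and S: "\<And>i. i \<in> I \<Longrightarrow> S i \<subseteq> T i" "\<And>i. i \<in> I \<Longrightarrow> S i \<noteq> {}"
    and conv: "\<And>i x y z. i \<in> I \<Longrightarrow> x \<in> S i \<Longrightarrow> z \<in> S i \<Longrightarrow> y \<in> T i \<Longrightarrow> x \<le> y \<Longrightarrow> y \<le> z \<Longrightarrow> y \<in> S i"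
    and type: "(\<forall>i\<in>I. \<forall>x\<in>S i. \<forall>y\<in>T i. y \<le> x \<longrightarrow> y \<in> S i) \<or>
      (\<forall>i\<in>I. \<forall>x\<in>S i. \<forall>y\<in>T i. x \<le> y \<longrightarrow> y \<in> S i) \<or> (\<exists>i\<in>I. \<forall>j\<in>I - {i}. S j = T j)"
  shows "block T I (PiE I S)"
proof -
  define J where "J = {i \<in> I. S i \<noteq> T i}"
  have J: "J \<subseteq> I" unfolding J_def by blast
  have finJ: "finite J" using I(1) J finite_subset by blast
  have IJ: "(I - J) \<union> J = I" using J by blast
  show ?thesis
  proof (cases "\<exists>i\<in>I. J \<subseteq> {i}")
    case True
    then obtain i where i: "i \<in> I" "J \<subseteq> {i}" by blast
    have "I - {i} \<noteq> {}"
    proof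
      assume "I - {i} = {}"
      then have "I \<subseteq> {i}" by blast
      then have "card I \<le> card {i}" by (rule card_mono[rotated]) simp
      then show False using I(2) by simp
    qed
    then obtain j where j: "j \<in> I" "i \<noteq> j" by blast
    have Sk: "S k = T k" if "k \<in> I" "k \<noteq> i" for k using i(2) that unfolding J_def by blast
    have "poset_interval (T i) (S i)"
      unfolding poset_interval_def
    proof (intro conjI ballI impI)
      show "S i \<subseteq> T i" "S i \<noteq> {}" using S i(1) by blast+
      show "y \<in> S i" if "x \<in> S i" "z \<in> S i" "y \<in> T i" "x \<le> y \<and> y \<le> z" for x y z
        using conv[OF i(1) that(1,2,3)] that(4) by blast
      fix x y assume "x \<in> S i" "y \<in> S i"
      then show "(x, y) \<in> {(a, b). a \<in> S i \<and> b \<in> S i \<and> (a \<le> b \<or> b \<le> a)}\<^sup>*"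
        using linear[of x y] by (intro r_into_rtrancl) simp
    qed
    then have "block T {i, j} (PiE {i, j} (T(i := S i)))" by (rule block.band[OF j(2)])
    moreover have "PiE {i, j} (T(i := S i)) = PiE {i, j} S"
      by (rule PiE_cong) (use j Sk in auto)
    ultimately have "block T {i, j} (PiE {i, j} S)" by simp
    then have "block T ((I - {i, j}) \<union> {i, j}) (PiE ((I - {i, j}) \<union> {i, j}) S)"
      by (rule block_extend[rotated 2]) (use I(1) j i(1) Sk S(1) in auto)
    moreover have "(I - {i, j}) \<union> {i, j} = I" using i(1) j(1) by blast
    ultimately show ?thesis by simp
  next
    case False
    have "card J \<ge> 2"
    proof (rule ccontr)
      assume "\<not> card J \<ge> 2"
      then consider "card J = 0" | "card J = 1" by linarith
      then show False
      proof cases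
        case 1
        have "I \<noteq> {}" using I(2) by auto
        then show False using 1 finJ False by auto
      next
        case 2
        then obtain k where "J = {k}" by (auto simp: card_1_singleton_iff)
        then show False using False J by blast
      qed
    qed
    have "\<not> (\<exists>i\<in>I. \<forall>j\<in>I - {i}. S j = T j)"
      using False unfolding J_def by blast
    then consider "\<forall>i\<in>I. \<forall>x\<in>S i. \<forall>y\<in>T i. y \<le> x \<longrightarrow> y \<in> S i" |
        "\<forall>i\<in>I. \<forall>x\<in>S i. \<forall>y\<in>T i. x \<le> y \<longrightarrow> y \<in> S i" using type by blast
    then have "block T J (PiE J S)"
    proof cases
      case 1
      show ?thesis
      proof (rule block.death[OF finJ \<open>card J \<ge> 2\<close>])
        fix i assume "i \<in> J"
        then have "i \<in> I" "S i \<noteq> T i" unfolding J_def by blast+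
        then show "proper_downset (T i) (S i)"
          unfolding proper_downset_def using 1 S[of i] by (simp add: psubset_eq)
      qed
    next
      case 2
      show ?thesis
      proof (rule block.birth[OF finJ \<open>card J \<ge> 2\<close>])
        fix i assume "i \<in> J"
        then have "i \<in> I" "S i \<noteq> T i" unfolding J_def by blast+
        then show "proper_upset (T i) (S i)"
          unfolding proper_upset_def using 2 S[of i] by (simp add: psubset_eq)
      qed
    qed
    then have "block T ((I - J) \<union> J) (PiE ((I - J) \<union> J) S)"
      by (rule block_extend[OF finJ \<open>card J \<ge> 2\<close>]) (use I(1) S(1) J in \<open>auto simp: J_def\<close>)
    then show ?thesis unfolding IJ .
  qed
qed

section \<open>The support of an indecomposable module\<close>

locale indecomposable_module = persistence_module "PiE I T" M
  for I :: "'i set" and T :: "'i \<Rightarrow> 'a::linorder set"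
    and M :: "('i \<Rightarrow> 'a, 'k::field, 'v::ab_group_add) persmod" +
  fixes p0 x0
  assumes fin_I: "finite I" and pfd: "pfd (PiE I T) M"
    and lift: "kernels_lift I T M" and embed: "cokernels_embed I T M"
    and indec: "indecomposable (PiE I T) M"
    and p0: "p0 \<in> PiE I T" and x0: "x0 \<in> obj M p0" "x0 \<noteq> 0"
begin

definition supp :: "('i \<Rightarrow> 'a) set" where
  "supp = {q \<in> PiE I T. \<exists>y\<in>obj M q. y \<noteq> 0}"

lemma p0_supp: "p0 \<in> supp"
  using p0 x0 unfolding supp_def by blast

text \<open>
  A block idempotent on a sufficiently large finite grid agrees on \<open>F\<close> with a global endomorphism,
  which is injective by Fitting's lemma. So the idempotent is the identity on \<open>F\<close>.
\<close>

lemma finite_local_structure: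
  assumes F: "finite F" "F \<subseteq> PiE I T"
  shows "\<exists>G u d x. (\<forall>i\<in>I. finite (G i)) \<and> F \<subseteq> PiE I G \<and> grid_corners I G u d \<and>
    u \<in> PiE I T \<and> x \<in> obj M u \<and>
    (\<forall>q\<in>F. q \<in> supp \<longleftrightarrow> u \<le> q \<and> q \<le> d) \<and>
    (\<forall>q\<in>F. q \<in> supp \<longrightarrow> arr M u q x \<noteq> 0 \<and> (\<forall>y\<in>obj M q. \<exists>c. y = scl M c (arr M u q x)))"
proof -
  let ?P = "PiE I T"
  \<comment> \<open>Adding \<open>p0\<close> allows an interval around a point of the support to be
    chosen. There the idempotent fixes a nonzero vector, and so does the endomorphism extending
    it.\<close>
  have "finite (insert p0 F)" "insert p0 F \<subseteq> ?P" using F p0 by auto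
  then obtain R where R: "finite R" "insert p0 F \<subseteq> R" "R \<subseteq> ?P"
    "\<And>R' e. R \<subseteq> R' \<Longrightarrow> R' \<subseteq> ?P \<Longrightarrow> endo R' M e \<Longrightarrow>
      \<exists>f. endo ?P M f \<and> (\<forall>p\<in>insert p0 F. \<forall>x\<in>obj M p. f p x = e p x)"
    by (rule endo_extension[OF pfd]) (rule that)
  define G where "G i = (\<lambda>q. q i) ` R" for i
  have GT: "G i \<subseteq> T i" if "i \<in> I" for i unfolding G_def using R(3) that by auto
  have finG: "finite (G i)" for i unfolding G_def using R(1) by simp
  have Gne: "G i \<noteq> {}" for i unfolding G_def using R(2) by blast
  have RG: "R \<subseteq> PiE I G"
  proof
    fix q assume q: "q \<in> R"
    then have "q \<in> ?P" using R(3) by blast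
    then show "q \<in> PiE I G" using q unfolding G_def by (auto simp: PiE_def)
  qed
  have GP: "PiE I G \<subseteq> ?P" using GT by (rule PiE_mono)
  have p0G: "p0 \<in> PiE I G" using R(2) RG by blast
  have pmG: "persistence_module (PiE I G) M"
    by (rule persistence_module_subset[OF persistence_module_axioms GP])
  have pfdG: "pfd (PiE I G) M" using pfd GP unfolding pfd_def by blast
  have "\<exists>u d x f. splits (PiE I G) M u d x f \<and> grid_corners I G u d \<and> u \<le> p0 \<and> p0 \<le> d"
    by (rule grid_splits_at[OF fin_I finG Gne p0G pmG pfdG kernels_lift_subset[OF lift GT]
        cokernels_embed_subset[OF embed GT] x0])
  then obtain u d x g where s: "splits (PiE I G) M u d x g" and cor: "grid_corners I G u d"
    and up0: "u \<le> p0" "p0 \<le> d" by blast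
  define e where "e = split_endo M u d x g"
  note se = persistence_module.split_endo[OF pmG s]
  have e: "endo (PiE I G) M e" "idem (PiE I G) M e" unfolding e_def by (rule se(1), rule se(2))
  obtain f where f: "endo ?P M f" "\<forall>p\<in>insert p0 F. \<forall>x\<in>obj M p. f p x = e p x"
    using R(4)[OF RG GP e(1)] by blast
  have u: "u \<in> PiE I G" "u \<in> ?P" "x \<in> obj M u" using s GP unfolding splits_def by blast+
  define v where "v = arr M u p0 x"
  have v: "v \<in> obj M p0" unfolding v_def by (rule arr_in[OF u(2) p0 up0(1) u(3)])
  have "e p0 v = v"
    unfolding v_def using endo_arr[OF e(1) u(1) p0G up0(1) u(3)] se(3) e_def by simp
  then have fv: "f p0 v = v" using f(2) v by simp
  have v0: "v \<noteq> 0" unfolding v_def by (rule se(5)[OF p0G up0])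
  have eid: "e q y = y" if q: "q \<in> F" and y: "y \<in> obj M q" for q y
  proof -
    have qP: "q \<in> ?P" and qG: "q \<in> PiE I G" using q F(2) R(2) RG by blast+
    have ey: "e q y \<in> obj M q" by (rule endo_in[OF e(1) qG y])
    \<comment> \<open>At \<open>q\<close> the injective map \<open>f\<close> acts as the idempotent
      \<open>e\<close>, which kills \<open>y - e q y\<close>.\<close>
    have "f q (y - e q y) = e q y - e q (e q y)"
      using endo_diff[OF f(1) qP y ey] f(2) q y ey by simp
    also have "\<dots> = 0" using e(2) qG y unfolding idem_def by simp
    finally have "y - e q y = 0"
      using fitting_injective[OF pfd indec f(1) p0 v fv v0 qP diff_in[OF qP y ey]] by blast
    then show ?thesis by simp
  qed
  have nz: "arr M u q x \<noteq> 0" "arr M u q x \<in> obj M q" if "q \<in> F" "u \<le> q" "q \<le> d" for q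
  proof -
    have "q \<in> PiE I G" "q \<in> ?P" using that(1) F(2) R(2) RG by blast+
    then show "arr M u q x \<noteq> 0" "arr M u q x \<in> obj M q"
      using se(5)[OF _ that(2,3)] arr_in[OF u(2) _ that(2) u(3)] by blast+
  qed
  have iff: "q \<in> supp \<longleftrightarrow> u \<le> q \<and> q \<le> d" if q: "q \<in> F" for q
  proof
    assume "u \<le> q \<and> q \<le> d"
    then show "q \<in> supp" using nz[OF q] q F(2) unfolding supp_def by blast
  next
    assume "q \<in> supp"
    then obtain y where y: "y \<in> obj M q" "y \<noteq> 0" unfolding supp_def by blast
    then have "e q y \<noteq> 0" using eid[OF q] by simp
    then show "u \<le> q \<and> q \<le> d" unfolding e_def split_endo_def by (auto split: if_splits)
  qed
  have "\<exists>c. y = scl M c (arr M u q x)" if "q \<in> F" "y \<in> obj M q" "q \<in> supp" for q y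
    using eid[OF that(1,2)] iff[OF that(1)] that(3) unfolding e_def split_endo_def
    by (intro exI[of _ "g (arr M q d y)"]) simp
  then show ?thesis
    using finG cor u(2,3) R(2) RG iff nz(1)
    by (intro exI[of _ G] exI[of _ u] exI[of _ d] exI[of _ x]) auto
qed

text \<open>On every finite set of points the support looks like a grid interval of one of the three
  shapes. Product form, convexity and type of the support could each be violated only by a finite
  configuration, so each follows from the local description.\<close>

theorem supp_block:
  assumes card: "card I \<ge> 2"
  shows "block T I supp"
proof -
  let ?P = "PiE I T"
  define S where "S i = (\<lambda>q. q i) ` supp" for i
  have suppP: "supp \<subseteq> ?P" unfolding supp_def by blast
  have ST: "S i \<subseteq> T i" if "i \<in> I" for i unfolding S_def using suppP that by auto
  have Sne: "S i \<noteq> {}" for i unfolding S_def using p0_supp by blast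
  have local: "\<exists>G u d. (\<forall>i\<in>I. finite (G i)) \<and> F \<subseteq> PiE I G \<and> grid_corners I G u d \<and>
      (\<forall>q\<in>F. q \<in> supp \<longleftrightarrow> u \<le> q \<and> q \<le> d)" if "finite F" "F \<subseteq> ?P" for F
    using finite_local_structure[OF that] by blast
  have boxI: "q \<in> supp" if q: "q \<in> ?P" and qS: "\<And>i. i \<in> I \<Longrightarrow> \<exists>a\<in>supp. \<exists>b\<in>supp. a i \<le> q i \<and> q i \<le> b i" for q
  proof -
    have "\<forall>i\<in>I. \<exists>a. a \<in> supp \<and> a i \<le> q i" using qS by blast
    from bchoice[OF this] obtain a where a: "\<forall>i\<in>I. a i \<in> supp \<and> a i i \<le> q i" ..
    have "\<forall>i\<in>I. \<exists>b. b \<in> supp \<and> q i \<le> b i" using qS by blast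
    from bchoice[OF this] obtain b where b: "\<forall>i\<in>I. b i \<in> supp \<and> q i \<le> b i i" ..
    \<comment> \<open>The bounding points vary with the axis, but one interval contains all of them
      and therefore also \<open>q\<close>.\<close>
    let ?F = "insert q (a ` I \<union> b ` I)"
    have "finite ?F" "?F \<subseteq> ?P" using fin_I q a b suppP by auto
    from local[OF this] obtain G u d where G: "?F \<subseteq> PiE I G" "grid_corners I G u d"
      "\<forall>q\<in>?F. q \<in> supp \<longleftrightarrow> u \<le> q \<and> q \<le> d" by blast
    have ud: "u \<le> a i" "b i \<le> d" if "i \<in> I" for i using G(3) a b that by auto
    have uq: "u i \<le> q i" "q i \<le> d i" if "i \<in> I" for i
      using le_funD[OF ud(1)[OF that], of i] le_funD[OF ud(2)[OF that], of i] a b that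
      by (meson order_trans)+
    obtain i where iI: "i \<in> I" using card by fastforce
    have ai: "a i \<in> ?P" "b i \<in> ?P" using a b iI suppP by blast+
    have "u \<le> q"
    proof (rule le_funI)
      fix k show "u k \<le> q k"
        using uq(1)[of k] le_funD[OF ud(1)[OF iI], of k] PiE_arb[OF ai(1), of k] PiE_arb[OF q, of k]
        by (cases "k \<in> I") auto
    qed
    moreover have "q \<le> d"
    proof (rule le_funI)
      fix k show "q k \<le> d k"
        using uq(2)[of k] le_funD[OF ud(2)[OF iI], of k] PiE_arb[OF ai(2), of k] PiE_arb[OF q, of k]
        by (cases "k \<in> I") auto
    qed
    ultimately show ?thesis using G(3) by blast
  qed
  have suppS: "supp = PiE I S"
  proof
    show "supp \<subseteq> PiE I S"
    proof
      fix q assume q: "q \<in> supp"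
      then have "q \<in> ?P" using suppP by blast
      then show "q \<in> PiE I S" using q unfolding S_def by (auto simp: PiE_def)
    qed
    show "PiE I S \<subseteq> supp"
    proof
      fix q assume q: "q \<in> PiE I S"
      then have "q \<in> ?P" using PiE_mono[of I S T] ST by blast
      then show "q \<in> supp"
      proof (rule boxI)
        fix i assume "i \<in> I"
        then have "q i \<in> S i" using q by (auto elim: PiE_mem)
        then obtain a where "a \<in> supp" "q i = a i" unfolding S_def by blast
        then show "\<exists>a\<in>supp. \<exists>b\<in>supp. a i \<le> q i \<and> q i \<le> b i" by (metis order_refl)
      qed
    qed
  qed
  have p0S: "p0 i \<in> S i" for i unfolding S_def using p0_supp by blast
  have upd: "p0(i := s) \<in> supp \<longleftrightarrow> s \<in> S i" if "i \<in> I" for i s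
    using p0_supp that unfolding suppS by (auto simp: PiE_def extensional_def Pi_def split: if_splits)
  have conv: "y \<in> S i" if "i \<in> I" "x \<in> S i" "z \<in> S i" "y \<in> T i" "x \<le> y" "y \<le> z" for i x y z
  proof -
    have "p0(i := y) \<in> supp"
    proof (rule boxI)
      show "p0(i := y) \<in> ?P" by (rule PiE_upd_in[OF p0 that(1,4)])
      fix k assume "k \<in> I"
      have "p0(i := x) \<in> supp" "p0(i := z) \<in> supp" using upd that by blast+
      then show "\<exists>a\<in>supp. \<exists>b\<in>supp. a k \<le> (p0(i := y)) k \<and> (p0(i := y)) k \<le> b k"
        using that(5,6)
        by (intro bexI[of _ "p0(i := x)"] bexI[of _ "p0(i := z)"]) auto
    qed
    then show ?thesis using upd[OF that(1)] by blast
  qed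
  have "(\<forall>i\<in>I. \<forall>x\<in>S i. \<forall>y\<in>T i. y \<le> x \<longrightarrow> y \<in> S i) \<or>
      (\<forall>i\<in>I. \<forall>x\<in>S i. \<forall>y\<in>T i. x \<le> y \<longrightarrow> y \<in> S i) \<or> (\<exists>i\<in>I. \<forall>j\<in>I - {i}. S j = T j)"
  proof (rule ccontr)
    assume n: "\<not> ?thesis"
    obtain i1 x1 y1 where 1: "i1 \<in> I" "x1 \<in> S i1" "y1 \<in> T i1" "y1 \<le> x1" "y1 \<notin> S i1"
      using n by blast
    obtain i2 x2 y2 where 2: "i2 \<in> I" "x2 \<in> S i2" "y2 \<in> T i2" "x2 \<le> y2" "y2 \<notin> S i2"
      using n by blast
    obtain a where a: "a \<in> I" "S a \<noteq> T a" using n 1 by blast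
    then obtain b where b: "b \<in> I" "b \<noteq> a" "S b \<noteq> T b" using n by blast
    obtain sa sb where sa: "sa \<in> T a" "sa \<notin> S a" and sb: "sb \<in> T b" "sb \<notin> S b"
      using a b ST by blast
    \<comment> \<open>Two points for the failure of downward closure, two for upward closure, one on
      each of two axes with a proper factor, and \<open>p0\<close>. Each shape allowed by
      \<open>grid_corners\<close> would force one of the points outside the support into
      \<open>[u, d]\<close>.\<close>
    define F where "F = {p0, p0(i1 := x1), p0(i1 := y1), p0(i2 := x2), p0(i2 := y2),
      p0(a := sa), p0(b := sb)}"
    have F: "p0 \<in> F" "p0(i1 := x1) \<in> F" "p0(i1 := y1) \<in> F" "p0(i2 := x2) \<in> F"
      "p0(i2 := y2) \<in> F" "p0(a := sa) \<in> F" "p0(b := sb) \<in> F"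
      unfolding F_def by simp_all
    have x12: "x1 \<in> T i1" "x2 \<in> T i2" using 1 2 ST by blast+
    have finF: "finite F" unfolding F_def by simp
    have "F \<subseteq> ?P"
      unfolding F_def
      using p0 PiE_upd_in[OF p0 1(1) x12(1)] PiE_upd_in[OF p0 1(1,3)] PiE_upd_in[OF p0 2(1) x12(2)]
        PiE_upd_in[OF p0 2(1,3)] PiE_upd_in[OF p0 a(1) sa(1)] PiE_upd_in[OF p0 b(1) sb(1)]
      by simp
    from local[OF finF this] obtain G u d where G: "\<forall>i\<in>I. finite (G i)" "F \<subseteq> PiE I G"
      and cor: "grid_corners I G u d" and iff: "\<forall>q\<in>F. q \<in> supp \<longleftrightarrow> u \<le> q \<and> q \<le> d"
      by (elim exE conjE)
    have up0: "u \<le> p0" "p0 \<le> d" using iff F(1) p0_supp by blast+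
    have n1: "\<not> (u \<le> p0(i1 := y1) \<and> p0(i1 := y1) \<le> d)"
      using iff[THEN bspec, OF F(3)] upd[OF 1(1)] 1(5) by blast
    have n2: "\<not> (u \<le> p0(i2 := y2) \<and> p0(i2 := y2) \<le> d)"
      using iff[THEN bspec, OF F(5)] upd[OF 2(1)] 2(5) by blast
    have na: "\<not> (u \<le> p0(a := sa) \<and> p0(a := sa) \<le> d)"
      using iff[THEN bspec, OF F(6)] upd[OF a(1)] sa(2) by blast
    have nb: "\<not> (u \<le> p0(b := sb) \<and> p0(b := sb) \<le> d)"
      using iff[THEN bspec, OF F(7)] upd[OF b(1)] sb(2) by blast
    have d1: "p0(i1 := x1) \<le> d" using iff[THEN bspec, OF F(2)] upd[OF 1(1)] 1(2) by blast
    have u2: "u \<le> p0(i2 := x2)" using iff[THEN bspec, OF F(4)] upd[OF 2(1)] 2(2) by blast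
    have between: "Min (G k) \<le> t \<and> t \<le> Max (G k)" if tF: "p0(k := t) \<in> F" and k: "k \<in> I" for k t
    proof -
      have "(p0(k := t)) k \<in> G k" using PiE_mem[OF subsetD[OF G(2) tF] k] .
      then show ?thesis using G(1) k by simp
    qed
    have upd_between: "u \<le> p0(k := t) \<longleftrightarrow> u k \<le> t" "p0(k := t) \<le> d \<longleftrightarrow> t \<le> d k" for k t
      using up0 by (auto simp: le_fun_def)
    have "\<not> (\<forall>i\<in>I. u i = Min (G i))"
    proof
      assume "\<forall>i\<in>I. u i = Min (G i)"
      then have "u i1 \<le> y1" using 1(1) between[OF F(3)] by simp
      moreover have "y1 \<le> d i1" using d1 1(4) upd_between(2)[of i1 x1] by simp
      ultimately show False using n1 upd_between[where k = i1] by blast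
    qed
    moreover have "\<not> (\<forall>i\<in>I. d i = Max (G i))"
    proof
      assume "\<forall>i\<in>I. d i = Max (G i)"
      then have "y2 \<le> d i2" using 2(1) between[OF F(5)] by simp
      moreover have "u i2 \<le> y2" using u2 2(4) upd_between(1)[of i2 x2] by simp
      ultimately show False using n2 upd_between[where k = i2] by blast
    qed
    moreover have "\<not> (\<exists>i\<in>I. \<forall>j\<in>I - {i}. u j = Min (G j) \<and> d j = Max (G j))"
    proof
      assume "\<exists>i\<in>I. \<forall>j\<in>I - {i}. u j = Min (G j) \<and> d j = Max (G j)"
      then obtain i where i: "\<forall>j\<in>I - {i}. u j = Min (G j) \<and> d j = Max (G j)" by blast
      show False
      proof (cases "a = i")
        case True
        then have "u b \<le> sb \<and> sb \<le> d b" using i b between[OF F(7)] by auto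
        then show False using nb upd_between[where k = b] by blast
      next
        case False
        then have "u a \<le> sa \<and> sa \<le> d a" using i a between[OF F(6)] by auto
        then show False using na upd_between[where k = a] by blast
      qed
    qed
    ultimately show False using cor unfolding grid_corners_def by blast
  qed
  from product_is_block[OF fin_I card ST Sne conv this] show ?thesis unfolding suppS .
qed

text \<open>The local description on \<open>{p, q}\<close> gives one vector whose nonzero images
  span both spaces, so the structure map takes a basis to a basis.\<close>

lemma supp_arr:
  assumes p: "p \<in> supp" and q: "q \<in> supp" and pq: "p \<le> q"
  shows "y \<in> obj M p \<Longrightarrow> arr M p q y = 0 \<Longrightarrow> y = 0"
    and "z \<in> obj M q \<Longrightarrow> \<exists>y\<in>obj M p. arr M p q y = z"
proof -
  have pqP: "p \<in> PiE I T" "q \<in> PiE I T" using p q unfolding supp_def by blast+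
  then have "finite {p, q}" "{p, q} \<subseteq> PiE I T" by auto
  from finite_local_structure[OF this] obtain u d x where
    u: "u \<in> PiE I T" "x \<in> obj M u" and iff: "\<forall>q\<in>{p, q}. q \<in> supp \<longleftrightarrow> u \<le> q \<and> q \<le> d"
    and sp: "\<forall>q\<in>{p, q}. q \<in> supp \<longrightarrow> arr M u q x \<noteq> 0 \<and> (\<forall>y\<in>obj M q. \<exists>c. y = scl M c (arr M u q x))"
    by blast
  have up: "u \<le> p" using iff p by blast
  have xp: "arr M u p x \<in> obj M p" by (rule arr_in[OF u(1) pqP(1) up u(2)])
  have eq: "arr M p q (scl M c (arr M u p x)) = scl M c (arr M u q x)" for c
    using arr_scl[OF pqP pq xp] arr_comp[OF u(1) pqP up pq u(2)] by simp
  have nz: "arr M u q x \<noteq> 0" using sp q by blast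
  show "y = 0" if y: "y \<in> obj M p" "arr M p q y = 0"
  proof -
    obtain c where c: "y = scl M c (arr M u p x)" using sp p y(1) by blast
    then have "c = 0" using eq[of c] y(2) nz by simp
    then show ?thesis using c by simp
  qed
  show "\<exists>y\<in>obj M p. arr M p q y = z" if z: "z \<in> obj M q"
  proof -
    obtain c where "z = scl M c (arr M u q x)" using sp q z by blast
    then show ?thesis using eq[of c] scl_in[OF pqP(1) xp] by blast
  qed
qed

lemma supp_span:
  assumes q: "q \<in> supp" and y: "y \<in> obj M q" "y \<noteq> 0" and z: "z \<in> obj M q"
  shows "\<exists>c. z = scl M c y"
proof -
  have qP: "q \<in> PiE I T" using q unfolding supp_def by blast
  then have "finite {q}" "{q} \<subseteq> PiE I T" by auto
  from finite_local_structure[OF this] obtain u x where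
    sp: "\<forall>q\<in>{q}. q \<in> supp \<longrightarrow> arr M u q x \<noteq> 0 \<and> (\<forall>y\<in>obj M q. \<exists>c. y = scl M c (arr M u q x))"
    by blast
  obtain a where a: "y = scl M a (arr M u q x)" using sp q y by blast
  obtain b where b: "z = scl M b (arr M u q x)" using sp q z by blast
  have "a \<noteq> 0" using a y(2) by auto
  then have "z = scl M (b / a) y" unfolding a b by simp
  then show ?thesis ..
qed

text \<open>The generator \<open>x0\<close> at \<open>p0\<close> is carried to \<open>q\<close> by
  going down to the meet \<open>m q\<close> of \<open>p0\<close> and \<open>q\<close> and then up;
  both maps are bijective by \<open>supp_arr\<close>. The meet is in the support because the support
  is an interval on \<open>{p0, q, m q}\<close>. Monotonicity of \<open>m\<close> gives
  compatibility.\<close>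

theorem supp_basis:
  obtains \<xi> where "\<And>q. q \<in> supp \<Longrightarrow> \<xi> q \<in> obj M q" "\<And>q. q \<in> supp \<Longrightarrow> \<xi> q \<noteq> 0"
    "\<And>p q. p \<in> supp \<Longrightarrow> q \<in> supp \<Longrightarrow> p \<le> q \<Longrightarrow> arr M p q (\<xi> p) = \<xi> q" "\<xi> p0 \<noteq> 0"
proof -
  have suppP: "q \<in> PiE I T" if "q \<in> supp" for q using that unfolding supp_def by blast
  define m where "m q = (\<lambda>i. min (p0 i) (q i))" for q
  have mle: "m q \<le> p0" "m q \<le> q" for q unfolding m_def by (simp_all add: le_fun_def)
  have mmono: "m p \<le> m q" if "p \<le> q" for p q
    unfolding m_def by (rule le_funI) (rule min.mono[OF order_refl le_funD[OF that]])
  have mP: "m q \<in> PiE I T" if q: "q \<in> PiE I T" for q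
  proof (rule PiE_I)
    show "m q i \<in> T i" if "i \<in> I" for i
      using PiE_mem[OF p0 that] PiE_mem[OF q that] unfolding m_def by (simp add: min_def)
    show "m q i = undefined" if "i \<notin> I" for i
      using PiE_arb[OF p0 that] PiE_arb[OF q that] unfolding m_def by simp
  qed
  have ms: "m q \<in> supp" if q: "q \<in> supp" for q
  proof -
    have "finite {p0, q, m q}" "{p0, q, m q} \<subseteq> PiE I T" using suppP[OF q] p0 mP by auto
    from finite_local_structure[OF this] obtain u d where
      iff: "\<forall>r\<in>{p0, q, m q}. r \<in> supp \<longleftrightarrow> u \<le> r \<and> r \<le> d" by blast
    have le: "u \<le> p0" "u \<le> q" "q \<le> d" using iff q p0_supp by blast+
    have "u \<le> m q" using le(1,2) unfolding m_def by (simp add: le_fun_def)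
    moreover have "m q \<le> d" using mle(2) le(3) by (rule order_trans)
    ultimately show ?thesis using iff by blast
  qed
  have "\<forall>q\<in>supp. \<exists>y. y \<in> obj M (m q) \<and> arr M (m q) p0 y = x0"
    using supp_arr(2)[OF ms p0_supp mle(1) x0(1)] by blast
  from bchoice[OF this] obtain y where y: "\<forall>q\<in>supp. y q \<in> obj M (m q) \<and> arr M (m q) p0 (y q) = x0" ..
  have y0: "y q \<noteq> 0" if "q \<in> supp" for q
    using y that x0(2) arr_zero[OF suppP[OF ms[OF that]] p0 mle(1)] by auto
  define \<xi> where "\<xi> q = arr M (m q) q (y q)" for q
  have \<xi>: "\<xi> q \<in> obj M q" "\<xi> q \<noteq> 0" if q: "q \<in> supp" for q
  proof -
    show "\<xi> q \<in> obj M q"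
      unfolding \<xi>_def by (rule arr_in[OF suppP[OF ms[OF q]] suppP[OF q] mle(2)]) (use y q in blast)
    show "\<xi> q \<noteq> 0"
      unfolding \<xi>_def using supp_arr(1)[OF ms[OF q] q mle(2)] y y0[OF q] q by blast
  qed
  have "arr M p q (\<xi> p) = \<xi> q" if p: "p \<in> supp" and q: "q \<in> supp" and pq: "p \<le> q" for p q
  proof -
    note P = suppP[OF p] suppP[OF q] suppP[OF ms[OF p]] suppP[OF ms[OF q]]
    have yp: "y p \<in> obj M (m p)" "arr M (m p) p0 (y p) = x0" using y p by blast+
    have yq: "y q \<in> obj M (m q)" "arr M (m q) p0 (y q) = x0" using y q by blast+
    define z where "z = arr M (m p) (m q) (y p)"
    have z: "z \<in> obj M (m q)" unfolding z_def by (rule arr_in[OF P(3,4) mmono[OF pq] yp(1)])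
    have "arr M (m q) p0 z = x0"
      unfolding z_def using arr_comp[OF P(3,4) p0 mmono[OF pq] mle(1) yp(1)] yp(2) by simp
    then have "arr M (m q) p0 (z - y q) = 0"
      using arr_diff[OF P(4) p0 mle(1) z yq(1)] yq(2) by simp
    then have "z - y q = 0"
      using supp_arr(1)[OF ms[OF q] p0_supp mle(1) diff_in[OF P(4) z yq(1)]] by blast
    then have "\<xi> q = arr M (m q) q z" unfolding \<xi>_def by simp
    also have "\<dots> = arr M (m p) q (y p)"
      unfolding z_def by (rule arr_comp[OF P(3,4,2) mmono[OF pq] mle(2) yp(1)])
    also have "\<dots> = arr M p q (\<xi> p)"
      unfolding \<xi>_def by (rule arr_comp[OF P(3,1,2) mle(2) pq yp(1), symmetric])
    finally show ?thesis by simp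
  qed
  then show ?thesis using that[of \<xi>] \<xi> p0_supp by blast
qed

end

section \<open>Consequences of middle exactness\<close>

lemma cube_vertex_in:
  "t \<in> PiE I T \<Longrightarrow> t' \<in> PiE I T \<Longrightarrow> cube_vertex t t' A \<in> PiE I T"
  by (auto simp: cube_vertex_def PiE_def extensional_def)

lemma cube_vertex_mono:
  fixes t t' :: "nat \<Rightarrow> 'a::linorder"
  shows "t \<le> t' \<Longrightarrow> A \<subseteq> B \<Longrightarrow> cube_vertex t t' A \<le> cube_vertex t t' B"
  by (auto simp: cube_vertex_def le_fun_def)

text \<open>With \<open>y\<close> at the vertex \<open>{i}\<close> and 0 at the other vertices of
  size one, the hypothesis on \<open>y\<close> is the cycle condition in degree
  \<open>k - 1\<close>. A preimage in degree \<open>k\<close> is one vector at the empty vertex, and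
  its images at the singletons are what is claimed.\<close>

lemma kernels_lift_if_middle_exact:
  fixes T :: "nat \<Rightarrow> 'a::linorder set"
    and M :: "(nat \<Rightarrow> 'a, 'k::field, 'v::ab_group_add) persmod"
  assumes pm: "persistence_module (PiE {1..n} T) M"
    and ex: "\<forall>k. 2 \<le> k \<and> k \<le> n \<longrightarrow> middle_exact n T k M"
  shows "kernels_lift {1..n} T M"
  unfolding kernels_lift_def
proof (intro allI impI, elim conjE)
  fix p i s J r y
  assume p: "p \<in> PiE {1..n} T" and i: "i \<in> {1..n}" "s \<in> T i" "p i \<le> s"
    and J: "J \<subseteq> {1..n}" "J \<noteq> {}" "i \<notin> J" and r: "\<forall>j\<in>J. r j \<in> T j \<and> p j \<le> r j"
    and y: "y \<in> obj M (p(i := s))" and kill: "\<forall>j\<in>J. arr M (p(i := s)) (p(i := s, j := r j)) y = 0"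
  interpret persistence_module "PiE {1..n} T" M by (rule pm)
  have ps: "p(i := s) \<in> PiE {1..n} T" by (rule PiE_upd_in[OF p i(1,2)])
  have pr: "p(j := r j) \<in> PiE {1..n} T" "p \<le> p(j := r j)" if "j \<in> J" for j
    using PiE_upd_in[OF p subsetD[OF J(1) that]] le_upd[of p j "r j"] r[THEN bspec, OF that] by simp_all
  show "\<exists>z\<in>obj M p. arr M p (p(i := s)) z = y \<and> (\<forall>j\<in>J. arr M p (p(j := r j)) z = 0)"
  \<comment> \<open>Trivial steps are not directions of the cube and are treated directly:
    \<open>p i = s\<close> leaves nothing to lift, and \<open>r j = p j\<close> forces
    \<open>y = 0\<close>.\<close>
  proof (cases "p i = s \<or> (\<exists>j\<in>J. r j = p j)")
    case True
    then show ?thesis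
    proof (elim disjE bexE)
      assume "p i = s"
      then have e: "p(i := s) = p" by auto
      show ?thesis using y kill arr_id[OF p] unfolding e by blast
    next
      fix j assume j: "j \<in> J" "r j = p j"
      then have e: "p(i := s, j := r j) = p(i := s)" using J(3) by (auto simp: fun_eq_iff)
      have "y = 0" using kill[THEN bspec, OF j(1)] arr_id[OF ps y] unfolding e by simp
      then show ?thesis
        using zero_in[OF p] arr_zero[OF p ps] le_upd[of p i s] i(3) arr_zero[OF p pr] by blast
    qed
  next
    case False
    define L where "L = insert i J"
    define t' where "t' = (\<lambda>k. if k = i then s else if k \<in> J then r k else p k)"
    have t': "t' \<in> PiE {1..n} T"
      unfolding t'_def using p i r J(1) by (auto simp: PiE_def extensional_def Pi_def)
    have pt: "p \<le> t'" unfolding t'_def using i(3) r by (auto simp: le_fun_def)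
    have dirs: "cube_dirs n p t' = L"
      unfolding cube_dirs_def t'_def L_def using False i(1,3) r J(1) by (auto simp: less_le)
    have LI: "L \<subseteq> {1..n}" unfolding L_def using i(1) J(1) by blast
    have finL: "finite L" using LI finite_subset by blast
    define k where "k = card L"
    have "card J > 0" using J(2) finL unfolding L_def by (simp add: card_gt_0_iff)
    then have k2: "2 \<le> k" unfolding k_def L_def using finL J(3) unfolding L_def by simp
    have kn: "k \<le> n" unfolding k_def using card_mono[OF _ LI] by simp
    have "is_cube n T k p t'" unfolding is_cube_def using p t' pt dirs k_def by simp
    then have van: "koszul_homology_vanishes n M p t' (k - 1)"
      using ex k2 kn unfolding middle_exact_def by (metis Suc_1 Suc_le_lessD diff_less less_le_trans pos2 zero_less_diff zero_less_one)
    let ?v = "cube_vertex p t'"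
    have vin: "?v A \<in> PiE {1..n} T" for A by (rule cube_vertex_in[OF p t'])
    have vle: "?v (A - {x}) \<le> ?v A" for A x by (rule cube_vertex_mono[OF pt]) blast
    have v0: "?v {} = p" unfolding cube_vertex_def by simp
    have vi: "?v {i} = p(i := s)" unfolding cube_vertex_def t'_def by auto
    have vj: "?v {j} = p(j := r j)" if "j \<in> J" for j
      unfolding cube_vertex_def t'_def using that J(3) by auto
    have vij: "?v {i, j} = p(i := s, j := r j)" if "j \<in> J" for j
      unfolding cube_vertex_def t'_def using that J(3) by auto
    define c where "c A = (if A = {i} then y else 0)" for A :: "nat set"
    have c_term: "c \<in> koszul_term n M p t' (k - 1)"
      unfolding koszul_term_def dirs k_def[symmetric]
    proof (intro CollectI allI)
      fix A
      have "{i} \<subseteq> L \<and> card {i} + (k - 1) = k" using k2 unfolding L_def by simp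
      then show "if A \<subseteq> L \<and> card A + (k - 1) = k then c A \<in> obj M (?v A) else c A = 0"
        unfolding c_def using y zero_in[OF vin, of A] vi by auto
    qed
    have "koszul_diff n M p t' c A = 0" for A
    proof (cases "A \<subseteq> L")
      case True
      have "arr M (?v (A - {x})) (?v A) (c (A - {x})) = 0" if x: "x \<in> A" for x
      proof (cases "A - {x} = {i}")
        case eq: True
        then have A: "A = {i, x}" and xJ: "x \<in> J" using x True unfolding L_def by auto
        show ?thesis unfolding eq unfolding A vi vij[OF xJ] c_def using kill xJ by simp
      next
        case False
        then show ?thesis unfolding c_def using arr_zero[OF vin vin vle] by simp
      qed
      then show ?thesis unfolding koszul_diff_def dirs by simp
    qed (simp add: koszul_diff_def dirs)
    then have "koszul_diff n M p t' c = (\<lambda>_. 0)" by blast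
    then have "c \<in> koszul_diff n M p t' ` koszul_term n M p t' (Suc (k - 1))"
      using van c_term unfolding koszul_homology_vanishes_def by blast
    then obtain b where b: "b \<in> koszul_term n M p t' k" "c = koszul_diff n M p t' b"
      using k2 by auto
    have bA: "if A \<subseteq> L \<and> card A + k = k then b A \<in> obj M (?v A) else b A = 0" for A
      using b(1) unfolding koszul_term_def dirs k_def[symmetric] by blast
    have z: "b {} \<in> obj M p" using bA[of "{}"] v0 by simp
    have single: "c {x} = arr M p (?v {x}) (b {})" if x: "x \<in> L" for x
    proof -
      have "c {x} = scl M ((- 1) ^ card {y \<in> {x} - {x}. y > x}) (arr M (?v ({x} - {x})) (?v {x}) (b ({x} - {x})))"
        unfolding b(2) koszul_diff_def dirs using x by simp
      then show ?thesis using v0 by simp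
    qed
    have "arr M p (p(i := s)) (b {}) = y"
      using single[of i] vi unfolding c_def L_def by simp
    moreover have "arr M p (p(j := r j)) (b {}) = 0" if j: "j \<in> J" for j
    proof -
      have "j \<noteq> i" using j J(3) by blast
      then show ?thesis using single[of j] vj[OF j] j unfolding c_def L_def by simp
    qed
    ultimately show ?thesis using z by blast
  qed
qed

text \<open>Put \<open>y\<close> at the vertex \<open>J\<close> and \<open>- w x\<close> at
  \<open>L - {x}\<close>, each multiplied by its Koszul sign so that the signs of the differential
  cancel. The hypothesis makes this a cycle in degree 1, and the component at \<open>J\<close> of
  the boundary of a chain in degree 2 is the required sum.\<close>

lemma cokernels_embed_if_middle_exact:
  fixes T :: "nat \<Rightarrow> 'a::linorder set"
    and M :: "(nat \<Rightarrow> 'a, 'k::field, 'v::ab_group_add) persmod"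
  assumes pm: "persistence_module (PiE {1..n} T) M"
    and ex: "\<forall>k. 2 \<le> k \<and> k \<le> n \<longrightarrow> middle_exact n T k M"
  shows "cokernels_embed {1..n} T M"
  unfolding cokernels_embed_def
proof (intro allI impI, elim conjE)
  fix p i s J l y w
  assume p: "p \<in> PiE {1..n} T" and i: "i \<in> {1..n}" "s \<in> T i" "p i \<le> s"
    and J: "J \<subseteq> {1..n}" "J \<noteq> {}" "i \<notin> J" and l: "\<forall>j\<in>J. l j \<in> T j \<and> l j \<le> p j"
    and y: "y \<in> obj M p" and w: "\<forall>j\<in>J. w j \<in> obj M (p(i := s, j := l j))"
    and eq: "arr M p (p(i := s)) y = (\<Sum>j\<in>J. arr M (p(i := s, j := l j)) (p(i := s)) (w j))"
  interpret persistence_module "PiE {1..n} T" M by (rule pm)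
  have ps: "p(i := s) \<in> PiE {1..n} T" by (rule PiE_upd_in[OF p i(1,2)])
  have pl: "p(j := l j) \<in> PiE {1..n} T" "p(j := l j) \<le> p" if "j \<in> J" for j
    using PiE_upd_in[OF p subsetD[OF J(1) that]] upd_le[of "l j" p j] l[THEN bspec, OF that] by simp_all
  have finJ: "finite J" using J(1) finite_subset by blast
  show "\<exists>v. (\<forall>j\<in>J. v j \<in> obj M (p(j := l j))) \<and> y = (\<Sum>j\<in>J. arr M (p(j := l j)) p (v j))"
  proof (cases "p i = s \<or> (\<exists>j\<in>J. l j = p j)")
    case True
    then show ?thesis
    proof (elim disjE bexE)
      assume "p i = s"
      then have e: "p(i := s) = p" by auto
      show ?thesis using w eq arr_id[OF p y] unfolding e by auto
    next
      \<comment> \<open>If \<open>l j0 = p j0\<close>, then \<open>y\<close> itself serves as the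
        only contribution.\<close>
      fix j0 assume j0: "j0 \<in> J" "l j0 = p j0"
      then have e: "p(j0 := l j0) = p" by (auto simp: fun_eq_iff)
      have "(\<Sum>j\<in>J. arr M (p(j := l j)) p (if j = j0 then y else 0)) = (\<Sum>j\<in>J. if j = j0 then y else 0)"
        by (rule sum.cong[OF refl]) (use arr_id[OF p y] e arr_zero[OF pl(1) p pl(2)] in auto)
      also have "\<dots> = y" using j0(1) finJ by simp
      finally show ?thesis
        using e y zero_in[OF pl(1)] by (intro exI[of _ "\<lambda>j. if j = j0 then y else 0"]) auto
    qed
  next
    case False
    define L where "L = insert i J"
    define t where "t = (\<lambda>k. if k \<in> J then l k else p k)"
    define t' where "t' = p(i := s)"
    have t: "t \<in> PiE {1..n} T"
      unfolding t_def using p l J(1) by (auto simp: PiE_def extensional_def Pi_def)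
    have t': "t' \<in> PiE {1..n} T" unfolding t'_def by (rule ps)
    have tt: "t \<le> t'" unfolding t_def t'_def using i(3) l by (auto simp: le_fun_def)
    have dirs: "cube_dirs n t t' = L"
      unfolding cube_dirs_def t_def t'_def L_def using False i(1,3) l J(1,3) by (auto simp: less_le)
    have LI: "L \<subseteq> {1..n}" unfolding L_def using i(1) J(1) by blast
    have finL: "finite L" using LI finite_subset by blast
    have iL: "i \<in> L" and JL: "J = L - {i}" unfolding L_def using J(3) by auto
    define k where "k = card L"
    have "card J > 0" using J(2) finJ by (simp add: card_gt_0_iff)
    then have k2: "2 \<le> k" unfolding k_def L_def using finJ J(3) by simp
    have kn: "k \<le> n" unfolding k_def using card_mono[OF _ LI] by simp
    have "is_cube n T k t t'" unfolding is_cube_def using t t' tt dirs k_def by simp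
    then have van: "koszul_homology_vanishes n M t t' 1"
      using ex k2 kn unfolding middle_exact_def by (metis Suc_1 Suc_le_lessD zero_less_one)
    let ?v = "cube_vertex t t'"
    have vin: "?v A \<in> PiE {1..n} T" for A by (rule cube_vertex_in[OF t t'])
    have vle: "?v (A - {x}) \<le> ?v A" for A x by (rule cube_vertex_mono[OF tt]) blast
    have vL: "?v L = p(i := s)" unfolding cube_vertex_def t_def t'_def L_def by auto
    have vJ: "?v J = p" unfolding cube_vertex_def t_def t'_def using J(3) by auto
    have vLj: "?v (L - {j}) = p(i := s, j := l j)" if "j \<in> J" for j
      unfolding cube_vertex_def t_def t'_def L_def using that J(3) by auto
    have vJj: "?v (J - {j}) = p(j := l j)" if "j \<in> J" for j
      unfolding cube_vertex_def t_def t'_def using that J(3) by auto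
    define u where "u x = (if x = i then y else - w x)" for x
    define sg :: "nat \<Rightarrow> 'k" where "sg x = (- 1) ^ card {y \<in> L - {x}. y > x}" for x
    have sg2: "sg x * sg x = 1" for x
      unfolding sg_def by (simp flip: power_mult_distrib)
    have u_in: "u x \<in> obj M (?v (L - {x}))" if "x \<in> L" for x
    proof (cases "x = i")
      case True
      then show ?thesis using y vJ JL unfolding u_def by simp
    next
      case False
      then have xJ: "x \<in> J" using that unfolding L_def by blast
      have "p(i := s, x := l x) \<in> PiE {1..n} T"
        using PiE_upd_in[OF ps subsetD[OF J(1) xJ]] l xJ by blast
      then show ?thesis using w xJ False vLj[OF xJ] neg_in unfolding u_def by simp
    qed
    define c where "c A = (\<Sum>x\<in>L. if A = L - {x} then scl M (sg x) (u x) else 0)" for A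
    have inj: "L - {x} = L - {x'} \<longleftrightarrow> x = x'" if "x \<in> L" "x' \<in> L" for x x' using that by blast
    have cL: "c (L - {x}) = scl M (sg x) (u x)" if x: "x \<in> L" for x
    proof -
      have "c (L - {x}) = (\<Sum>x'\<in>L. if x' = x then scl M (sg x) (u x) else 0)"
        unfolding c_def by (rule sum.cong[OF refl]) (use inj x in auto)
      then show ?thesis using finL x by simp
    qed
    have c0: "c A = 0" if "\<And>x. x \<in> L \<Longrightarrow> A \<noteq> L - {x}" for A
      unfolding c_def by (rule sum.neutral) (use that in auto)
    have cardL: "card (L - {x}) + 1 = k" if "x \<in> L" for x
      unfolding k_def using card_Suc_Diff1[OF finL that] by simp
    have codim1: "\<exists>x\<in>L. A = L - {x}" if A: "A \<subseteq> L" "card A + 1 = k" for A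
    proof -
      have "card (L - A) = 1" using A card_Diff_subset[OF finite_subset[OF A(1) finL] A(1)] unfolding k_def by simp
      then obtain x where "L - A = {x}" by (auto simp: card_1_singleton_iff)
      then have "x \<in> L" "A = L - {x}" using A(1) by auto
      then show ?thesis by blast
    qed
    have c_term: "c \<in> koszul_term n M t t' 1"
      unfolding koszul_term_def dirs k_def[symmetric]
    proof (intro CollectI allI)
      fix A
      show "if A \<subseteq> L \<and> card A + 1 = k then c A \<in> obj M (?v A) else c A = 0"
      proof (cases "A \<subseteq> L \<and> card A + 1 = k")
        case True
        then obtain x where x: "x \<in> L" "A = L - {x}" using codim1 by blast
        then show ?thesis using True cL[OF x(1)] u_in[OF x(1)] scl_in[OF vin] by simp
      next
        case False
        then have "c A = 0" by (intro c0) (use cardL in auto)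
        then show ?thesis using False by auto
      qed
    qed
    have "koszul_diff n M t t' c A = 0" for A
    proof (cases "A \<subseteq> L")
      case True
      show ?thesis
      proof (cases "A = L")
        case AL: True
        have tm: "scl M (sg x) (arr M (?v (L - {x})) (?v L) (c (L - {x}))) =
            arr M (?v (L - {x})) (?v L) (u x)" if x: "x \<in> L" for x
          using cL[OF x] arr_scl[OF vin vin vle u_in[OF x]] sg2 by simp
        have "koszul_diff n M t t' c L = (\<Sum>x\<in>L. arr M (?v (L - {x})) (?v L) (u x))"
          unfolding koszul_diff_def dirs using tm unfolding sg_def by simp
        also have "\<dots> = arr M (?v (L - {i})) (?v L) (u i) + (\<Sum>x\<in>J. arr M (?v (L - {x})) (?v L) (u x))"
          unfolding JL using sum.remove[OF finL iL] by blast
        also have "arr M (?v (L - {i})) (?v L) (u i) = arr M p (p(i := s)) y"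
          using vJ vL JL unfolding u_def by simp
        also have "(\<Sum>x\<in>J. arr M (?v (L - {x})) (?v L) (u x)) =
            (\<Sum>x\<in>J. - arr M (p(i := s, x := l x)) (p(i := s)) (w x))"
        proof (rule sum.cong[OF refl])
          fix x assume x: "x \<in> J"
          have "x \<noteq> i" using x J(3) by blast
          moreover have "w x \<in> obj M (?v (L - {x}))" using w x vLj[OF x] by simp
          ultimately show "arr M (?v (L - {x})) (?v L) (u x) = - arr M (p(i := s, x := l x)) (p(i := s)) (w x)"
            using arr_neg[OF vin vin vle, of "w x" L x] vLj[OF x] vL unfolding u_def by simp
        qed
        finally show ?thesis using eq AL by (simp del: fun_upd_apply add: sum_negf)
      next
        case False
        have "c (A - {x}) = 0" if x: "x \<in> A" for x
        proof (rule c0)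
          fix x' assume "x' \<in> L"
          then show "A - {x} \<noteq> L - {x'}" using True False x by blast
        qed
        then show ?thesis unfolding koszul_diff_def dirs using arr_zero[OF vin vin vle] by simp
      qed
    qed (simp add: koszul_diff_def dirs)
    then have "koszul_diff n M t t' c = (\<lambda>_. 0)" by blast
    then have "c \<in> koszul_diff n M t t' ` koszul_term n M t t' (Suc 1)"
      using van c_term unfolding koszul_homology_vanishes_def by blast
    then obtain b where b: "b \<in> koszul_term n M t t' 2" "c = koszul_diff n M t t' b"
      by (auto simp: numeral_2_eq_2)
    have bA: "if A \<subseteq> L \<and> card A + 2 = k then b A \<in> obj M (?v A) else b A = 0" for A
      using b(1) unfolding koszul_term_def dirs k_def[symmetric] by blast
    have bJ: "b (J - {x}) \<in> obj M (p(x := l x))" if x: "x \<in> J" for x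
    proof -
      have "J - {x} \<subseteq> L" unfolding L_def by blast
      moreover have "card (J - {x}) + 2 = k"
        using card_Suc_Diff1[OF finJ x] cardL[OF iL] JL by simp
      ultimately show ?thesis using bA[of "J - {x}"] vJj[OF x] by simp
    qed
    define e :: "nat \<Rightarrow> 'k" where "e x = (- 1) ^ card {y \<in> J - {x}. y > x}" for x
    have "y = scl M (sg i) (scl M (sg i) y)" using sg2 by simp
    also have "scl M (sg i) y = c J" using cL[OF iL] JL unfolding u_def by simp
    also have "c J = (\<Sum>x\<in>J. scl M (e x) (arr M (p(x := l x)) p (b (J - {x}))))"
      unfolding b(2) koszul_diff_def dirs e_def using vJ vJj JL by auto
    also have "scl M (sg i) \<dots> = (\<Sum>x\<in>J. arr M (p(x := l x)) p (scl M (sg i * e x) (b (J - {x}))))"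
      unfolding scale_sum_right
      by (rule sum.cong[OF refl]) (use arr_scl[OF pl(1) p pl(2) bJ] in simp)
    finally show ?thesis
      using bJ scl_in[OF pl(1)] by (intro exI[of _ "\<lambda>x. scl M (sg i * e x) (b (J - {x}))"]) blast
  qed
qed

section \<open>Block modules are middle exact\<close>

text \<open>A whole axis added by rule \<open>induced\<close> is both upward and downward closed, so
  each of the three types survives.\<close>

lemma block_product:
  fixes T :: "'i \<Rightarrow> 'a::linorder set"
  assumes "block T I B"
  shows "\<exists>S. B = PiE I S \<and> (\<forall>i\<in>I. S i \<subseteq> T i) \<and>
    ((\<forall>i\<in>I. \<forall>x\<in>S i. \<forall>y\<in>T i. y \<le> x \<longrightarrow> y \<in> S i) \<or>
     (\<forall>i\<in>I. \<forall>x\<in>S i. \<forall>y\<in>T i. x \<le> y \<longrightarrow> y \<in> S i) \<or> (\<exists>i\<in>I. \<forall>j\<in>I - {i}. S j = T j))"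
  using assms
proof (induction rule: block.induct)
  case (birth I U)
  then have "\<forall>i\<in>I. U i \<subseteq> T i" "\<forall>i\<in>I. \<forall>x\<in>U i. \<forall>y\<in>T i. x \<le> y \<longrightarrow> y \<in> U i"
    unfolding proper_upset_def by (simp_all add: psubset_eq)
  then show ?case by (intro exI[of _ U] conjI) simp_all
next
  case (death I U)
  then have "\<forall>i\<in>I. U i \<subseteq> T i" "\<forall>i\<in>I. \<forall>x\<in>U i. \<forall>y\<in>T i. y \<le> x \<longrightarrow> y \<in> U i"
    unfolding proper_downset_def by (simp_all add: psubset_eq)
  then show ?case by (intro exI[of _ U] conjI) simp_all
next
  case (band i j S)
  then have "S \<subseteq> T i" unfolding poset_interval_def by simp
  then have "\<forall>k\<in>{i, j}. (T(i := S)) k \<subseteq> T k" by simp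
  moreover have "\<exists>k\<in>{i, j}. \<forall>l\<in>{i, j} - {k}. (T(i := S)) l = T l" by auto
  ultimately show ?case by (intro exI[of _ "T(i := S)"] conjI refl disjI2)
next
  case (induced I i B)
  from induced.IH obtain S where S: "B = PiE (I - {i}) S" "\<forall>k\<in>I - {i}. S k \<subseteq> T k"
    and type: "(\<forall>k\<in>I - {i}. \<forall>x\<in>S k. \<forall>y\<in>T k. y \<le> x \<longrightarrow> y \<in> S k) \<or>
     (\<forall>k\<in>I - {i}. \<forall>x\<in>S k. \<forall>y\<in>T k. x \<le> y \<longrightarrow> y \<in> S k) \<or>
     (\<exists>k\<in>I - {i}. \<forall>j\<in>I - {i} - {k}. S j = T j)" by (elim exE conjE)
  define S' where "S' = S(i := T i)"
  have S'i: "S' i = T i" and S'k: "\<And>k. k \<noteq> i \<Longrightarrow> S' k = S k" unfolding S'_def by simp_all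
  have sub: "\<forall>k\<in>I. S' k \<subseteq> T k" using S(2) unfolding S'_def by auto
  have "{x \<in> PiE I T. restrict x (I - {i}) \<in> B} = PiE I S'"
  proof (rule set_eqI)
    fix x
    have "x \<in> PiE I S'" if "x \<in> PiE I T" "restrict x (I - {i}) \<in> B"
    proof (rule PiE_I)
      fix k assume k: "k \<in> I"
      show "x k \<in> S' k"
      proof (cases "k = i")
        case True
        then show ?thesis using PiE_mem[OF that(1) k] S'i by simp
      next
        case False
        then show ?thesis using PiE_mem[OF that(2)[unfolded S(1)], of k] k S'k by simp
      qed
    qed (use PiE_arb[OF that(1)] in simp)
    moreover have "x \<in> PiE I T" if "x \<in> PiE I S'"
      using that PiE_mono[of I S' T] sub by blast
    moreover have "restrict x (I - {i}) \<in> B" if "x \<in> PiE I S'"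
      unfolding S(1) using PiE_mem[OF that] S'k by auto
    ultimately show "x \<in> {x \<in> PiE I T. restrict x (I - {i}) \<in> B} \<longleftrightarrow> x \<in> PiE I S'" by blast
  qed
  moreover have "(\<forall>k\<in>I. \<forall>x\<in>S' k. \<forall>y\<in>T k. y \<le> x \<longrightarrow> y \<in> S' k) \<or>
     (\<forall>k\<in>I. \<forall>x\<in>S' k. \<forall>y\<in>T k. x \<le> y \<longrightarrow> y \<in> S' k) \<or> (\<exists>k\<in>I. \<forall>j\<in>I - {k}. S' j = T j)"
    using type unfolding S'_def by (auto split: if_splits)
  ultimately show ?case using sub by (intro exI[of _ S'] conjI)
qed

text \<open>Suppose that membership in the factor changes along every direction of the cube. If the
  factors are down-sets, only the bottom vertex can lie in the block; if they are up-sets, only the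
  top vertex. If at most one factor is proper this case cannot occur, since one of the at least two
  directions has a whole axis as its factor.\<close>

lemma cube_meets_block:
  fixes T :: "nat \<Rightarrow> 'a::linorder set"
  assumes B: "block T {1..n} B" and t: "t \<in> PiE {1..n} T" and t': "t' \<in> PiE {1..n} T" and tt: "t \<le> t'"
    and card: "2 \<le> card (cube_dirs n t t')"
  shows "(\<exists>m\<in>cube_dirs n t t'. \<forall>A. m \<notin> A \<longrightarrow>
      (cube_vertex t t' (insert m A) \<in> B \<longleftrightarrow> cube_vertex t t' A \<in> B)) \<or>
    (\<forall>A\<subseteq>cube_dirs n t t'. cube_vertex t t' A \<in> B \<longrightarrow> A = cube_dirs n t t') \<or>
    (\<forall>A\<subseteq>cube_dirs n t t'. cube_vertex t t' A \<in> B \<longrightarrow> A = {})"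
proof -
  let ?D = "cube_dirs n t t'"
  have D: "?D \<subseteq> {1..n}" unfolding cube_dirs_def by blast
  from block_product[OF B] obtain S where S: "B = PiE {1..n} S" "\<forall>i\<in>{1..n}. S i \<subseteq> T i"
    and type: "(\<forall>i\<in>{1..n}. \<forall>x\<in>S i. \<forall>y\<in>T i. y \<le> x \<longrightarrow> y \<in> S i) \<or>
     (\<forall>i\<in>{1..n}. \<forall>x\<in>S i. \<forall>y\<in>T i. x \<le> y \<longrightarrow> y \<in> S i) \<or> (\<exists>i\<in>{1..n}. \<forall>j\<in>{1..n} - {i}. S j = T j)"
    by (elim exE conjE)
  have tT: "t i \<in> T i" "t' i \<in> T i" if "i \<in> {1..n}" for i
    using PiE_mem[OF t that] PiE_mem[OF t' that] .
  have vB: "cube_vertex t t' A \<in> B \<longleftrightarrow> (\<forall>i\<in>{1..n}. (if i \<in> A then t' i else t i) \<in> S i)" for A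
    unfolding S(1) using PiE_arb[OF t] PiE_arb[OF t']
    by (auto simp: cube_vertex_def PiE_iff extensional_def)
  show ?thesis
  proof (cases "\<exists>m\<in>?D. t m \<in> S m \<longleftrightarrow> t' m \<in> S m")
    case True
    then obtain m where m: "m \<in> ?D" "t m \<in> S m \<longleftrightarrow> t' m \<in> S m" by blast
    have "cube_vertex t t' (insert m A) \<in> B \<longleftrightarrow> cube_vertex t t' A \<in> B" if "m \<notin> A" for A
    proof -
      have "(if i \<in> insert m A then t' i else t i) \<in> S i \<longleftrightarrow> (if i \<in> A then t' i else t i) \<in> S i" for i
        using m(2) that by (cases "i = m") simp_all
      then show ?thesis unfolding vB by simp
    qed
    then show ?thesis using m(1) by blast
  next
    case False
    then have one: "t' m \<in> S m \<longleftrightarrow> t m \<notin> S m" if "m \<in> ?D" for m using that by blast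
    from type consider (down) "\<forall>i\<in>{1..n}. \<forall>x\<in>S i. \<forall>y\<in>T i. y \<le> x \<longrightarrow> y \<in> S i"
      | (up) "\<forall>i\<in>{1..n}. \<forall>x\<in>S i. \<forall>y\<in>T i. x \<le> y \<longrightarrow> y \<in> S i"
      | (band) i where "\<forall>j\<in>{1..n} - {i}. S j = T j" by blast
    then show ?thesis
    proof cases
      case down
      have "t' m \<notin> S m" if m: "m \<in> ?D" for m
        using down one[OF m] m D tT(1)[of m] tt by (auto simp: le_fun_def)
      moreover have "t' m \<in> S m" if "A \<subseteq> ?D" "cube_vertex t t' A \<in> B" "m \<in> A" for A m
        using that(2)[unfolded vB, THEN bspec, of m] that(1,3) D by auto
      ultimately have "A = {}" if "A \<subseteq> ?D" "cube_vertex t t' A \<in> B" for A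
        using that by blast
      then show ?thesis by blast
    next
      case up
      have "t m \<notin> S m" if m: "m \<in> ?D" for m
        using up one[OF m] m D tT(2)[of m] tt by (auto simp: le_fun_def)
      moreover have "t m \<in> S m" if "cube_vertex t t' A \<in> B" "m \<in> ?D" "m \<notin> A" for A m
        using that(1)[unfolded vB, THEN bspec, of m] that(2,3) D by auto
      ultimately have "A = ?D" if "A \<subseteq> ?D" "cube_vertex t t' A \<in> B" for A
        using that by blast
      then show ?thesis by blast
    next
      case (band i)
      have "\<not> ?D \<subseteq> {i}"
      proof
        assume "?D \<subseteq> {i}"
        then have "card ?D \<le> card {i}" by (rule card_mono[rotated]) simp
        then show False using card by simp
      qed
      then obtain m where m: "m \<in> ?D" "m \<noteq> i" by blast
      then have "S m = T m" using band D by blast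
      then show ?thesis using one[OF m(1)] tT[of m] m(1) D by blast
    qed
  qed
qed

text \<open>The sign of the component of the differential from \<open>A - {x}\<close> to
  \<open>A\<close>. Removing \<open>x\<close> inside makes the sign the same for \<open>A\<close>
  and \<open>A - {x}\<close>.\<close>

definition ksign :: "nat \<Rightarrow> nat set \<Rightarrow> 'k::comm_ring_1" where
  "ksign x A = (- 1) ^ card {y \<in> A - {x}. y > x}"

lemma ksign_Diff [simp]: "ksign x (A - {x}) = ksign x A"
  unfolding ksign_def by (simp add: Diff_idemp)

lemma ksign_insert_self [simp]: "ksign x (insert x A) = ksign x A"
  unfolding ksign_def by simp

lemma ksign_square: "ksign x A * ksign x A = (1 :: 'k::comm_ring_1)"
  unfolding ksign_def by (simp flip: power_mult_distrib)

lemma ksign_insert: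
  assumes "finite A" "m \<notin> A" "m \<noteq> x"
  shows "ksign x (insert m A) = (if m > x then - ksign x A else ksign x A :: 'k::comm_ring_1)"
proof (cases "m > x")
  case True
  have "{y \<in> insert m A - {x}. y > x} = insert m {y \<in> A - {x}. y > x}" using True assms(3) by auto
  moreover have "card (insert m {y \<in> A - {x}. y > x}) = Suc (card {y \<in> A - {x}. y > x})"
    using assms(1,2) by (intro card_insert_disjoint) auto
  ultimately show ?thesis using True unfolding ksign_def by simp
next
  case False
  have "{y \<in> insert m A - {x}. y > x} = {y \<in> A - {x}. y > x}" using False by auto
  then show ?thesis using False unfolding ksign_def by simp
qed

text \<open>Exactly one of \<open>x\<close> and \<open>y\<close> is the larger one, so exchanging
  the order of insertion changes exactly one of the two signs. This drives both the vanishing of the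
  squared differential and the contracting homotopy.\<close>

lemma ksign_exchange:
  assumes A: "finite A" "x \<noteq> y" "x \<notin> A" "y \<notin> A"
  shows "ksign x (insert y A) * ksign y A = - (ksign y (insert x A) * ksign x A :: 'k::comm_ring_1)"
  using ksign_insert[OF A(1,4), of x, where 'k = 'k] ksign_insert[OF A(1,3), of y, where 'k = 'k] A(2)
  by (cases "x < y") auto

text \<open>Pairs with \<open>x < y\<close> cancel against pairs with \<open>y < x\<close>. The
  diagonal is left out of the sum rather than shown to vanish, so nothing is divided by 2.\<close>

lemma sum_antisymmetric:
  fixes F :: "nat \<Rightarrow> nat \<Rightarrow> 'v::ab_group_add"
  assumes A: "finite A" and anti: "\<And>x y. x \<in> A \<Longrightarrow> y \<in> A \<Longrightarrow> x \<noteq> y \<Longrightarrow> F x y = - F y x"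
  shows "(\<Sum>x\<in>A. \<Sum>y\<in>A - {x}. F x y) = 0"
proof -
  have split: "(\<Sum>y\<in>A - {x}. F x y) =
      (\<Sum>y\<in>A. if y < x then F x y else 0) + (\<Sum>y\<in>A. if x < y then F x y else 0)"
    if x: "x \<in> A" for x
  proof -
    have "(\<Sum>y\<in>A - {x}. F x y) = (\<Sum>y\<in>A. if y \<noteq> x then F x y else 0)"
      using A x by (subst sum.remove[of A x]) auto
    also have "\<dots> = (\<Sum>y\<in>A. (if y < x then F x y else 0) + (if x < y then F x y else 0))"
      by (rule sum.cong[OF refl]) auto
    finally show ?thesis by (simp add: sum.distrib)
  qed
  have "(\<Sum>x\<in>A. \<Sum>y\<in>A. if x < y then F x y else 0) = (\<Sum>y\<in>A. \<Sum>x\<in>A. if x < y then F x y else 0)"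
    by (rule sum.swap)
  also have "\<dots> = (\<Sum>y\<in>A. \<Sum>x\<in>A. - (if x < y then F y x else 0))"
  proof (intro sum.cong refl)
    fix y x assume "y \<in> A" "x \<in> A"
    then show "(if x < y then F x y else 0) = - (if x < y then F y x else 0)"
      using anti[of x y] by auto
  qed
  finally show ?thesis using split by (simp add: sum.distrib sum_negf)
qed

lemma koszul_diff_ksign:
  assumes "A \<subseteq> cube_dirs n t t'"
  shows "koszul_diff n M t t' c A = (\<Sum>x\<in>A. scl M (ksign x A)
    (arr M (cube_vertex t t' (A - {x})) (cube_vertex t t' A) (c (A - {x}))))"
  using assms unfolding koszul_diff_def ksign_def by simp

lemma koszul_diff_squared:
  fixes T :: "nat \<Rightarrow> 'a::linorder set"
    and M :: "(nat \<Rightarrow> 'a, 'k::field, 'v::ab_group_add) persmod"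
  assumes pm: "persistence_module (PiE {1..n} T) M"
    and t: "t \<in> PiE {1..n} T" "t' \<in> PiE {1..n} T" "t \<le> t'"
    and c: "\<And>A. A \<subseteq> cube_dirs n t t' \<Longrightarrow> c A \<in> obj M (cube_vertex t t' A)"
  shows "koszul_diff n M t t' (koszul_diff n M t t' c) = (\<lambda>_. 0)"
proof
  fix A
  interpret persistence_module "PiE {1..n} T" M by (rule pm)
  let ?D = "cube_dirs n t t'" and ?v = "cube_vertex t t'"
  have vin: "?v A \<in> PiE {1..n} T" for A by (rule cube_vertex_in[OF t(1,2)])
  have vle: "?v (A - X) \<le> ?v A" for A X by (rule cube_vertex_mono[OF t(3)]) blast
  show "koszul_diff n M t t' (koszul_diff n M t t' c) A = 0"
  proof (cases "A \<subseteq> ?D")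
    case True
    have finA: "finite A" by (rule finite_subset[OF True]) (simp add: cube_dirs_def)
    define F where "F x y = scl M (ksign x A * ksign y (A - {x}))
      (arr M (?v (A - {x} - {y})) (?v A) (c (A - {x} - {y})))" for x y
    have "scl M (ksign x A) (arr M (?v (A - {x})) (?v A) (koszul_diff n M t t' c (A - {x}))) =
        (\<Sum>y\<in>A - {x}. F x y)" if x: "x \<in> A" for x
    proof -
      have sub: "A - {x} \<subseteq> ?D" using True by blast
      have cy: "c (A - {x} - {y}) \<in> obj M (?v (A - {x} - {y}))" for y
        by (rule c) (use True in blast)
      have a: "arr M (?v (A - {x} - {y})) (?v (A - {x})) (c (A - {x} - {y})) \<in> obj M (?v (A - {x}))" for y
        by (rule arr_in[OF vin vin vle cy])
      have "arr M (?v (A - {x})) (?v A) (koszul_diff n M t t' c (A - {x})) =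
          (\<Sum>y\<in>A - {x}. arr M (?v (A - {x})) (?v A) (scl M (ksign y (A - {x}))
            (arr M (?v (A - {x} - {y})) (?v (A - {x})) (c (A - {x} - {y})))))"
        unfolding koszul_diff_ksign[OF sub] by (rule arr_sum[OF vin vin vle]) (rule scl_in[OF vin a])
      also have "\<dots> = (\<Sum>y\<in>A - {x}. scl M (ksign y (A - {x}))
            (arr M (?v (A - {x} - {y})) (?v A) (c (A - {x} - {y}))))"
        by (rule sum.cong[OF refl])
          (simp only: arr_scl[OF vin vin vle a] arr_comp[OF vin vin vin vle vle cy])
      finally show ?thesis unfolding F_def by (simp add: scale_sum_right)
    qed
    then have "koszul_diff n M t t' (koszul_diff n M t t' c) A = (\<Sum>x\<in>A. \<Sum>y\<in>A - {x}. F x y)"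
      unfolding koszul_diff_ksign[OF True] by simp
    also have "\<dots> = 0"
    proof (rule sum_antisymmetric[OF finA])
      fix x y assume xy: "x \<in> A" "y \<in> A" "x \<noteq> y"
      define A' where "A' = A - {x} - {y}"
      have A': "A - {x} = insert y A'" "A - {y} = insert x A'" "A - {y} - {x} = A'"
        "finite A'" "x \<notin> A'" "y \<notin> A'"
        unfolding A'_def using xy finA by auto
      have "ksign x A = (ksign x (insert y A') :: 'k)" "ksign y A = (ksign y (insert x A') :: 'k)"
        using ksign_Diff[of x A, where 'a = 'k] ksign_Diff[of y A, where 'a = 'k] A'(1,2) by simp_all
      then have "ksign x A * ksign y (A - {x}) = - (ksign y A * ksign x (A - {y}) :: 'k)"
        using ksign_exchange[OF A'(4) xy(3) A'(5,6), where 'k = 'k] A'(1,2) by simp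
      then show "F x y = - F y x"
        unfolding F_def A'(3) A'_def[symmetric] by simp
    qed
    finally show ?thesis .
  qed (simp add: koszul_diff_def)
qed

text \<open>
  The Koszul complex of an interval module on a cube with directions \<open>D\<close>; \<open>Z\<close> is the set of
  vertices in the interval. A direction on which membership does not depend yields a contracting
  homotopy.
\<close>

lemma scalar_koszul_exact:
  fixes c :: "nat set \<Rightarrow> 'k::field"
  assumes D: "finite D"
    and Z: "(\<exists>m\<in>D. \<forall>A. m \<notin> A \<longrightarrow> (Z (insert m A) \<longleftrightarrow> Z A)) \<or>
      (\<forall>A\<subseteq>D. Z A \<longrightarrow> A = D) \<or> (\<forall>A\<subseteq>D. Z A \<longrightarrow> A = {})"
    and i: "0 < i" "i < card D"
    and supp: "\<And>A. c A \<noteq> 0 \<Longrightarrow> A \<subseteq> D \<and> Z A \<and> card A + i = card D"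
    and cyc: "\<And>A. A \<subseteq> D \<Longrightarrow> (\<Sum>x\<in>A. ksign x A * (if Z (A - {x}) \<and> Z A then c (A - {x}) else 0)) = 0"
  shows "\<exists>b. (\<forall>A. b A \<noteq> 0 \<longrightarrow> A \<subseteq> D \<and> Z A \<and> card A + Suc i = card D) \<and>
    (\<forall>A\<subseteq>D. (\<Sum>x\<in>A. ksign x A * (if Z (A - {x}) \<and> Z A then b (A - {x}) else 0)) = c A) \<and>
    ((\<forall>A. c A = 0) \<longrightarrow> (\<forall>A. b A = 0))"
proof (cases "\<exists>m\<in>D. \<forall>A. m \<notin> A \<longrightarrow> (Z (insert m A) \<longleftrightarrow> Z A)")
  case True
  then obtain m where m: "m \<in> D" "\<And>A. m \<notin> A \<Longrightarrow> Z (insert m A) \<longleftrightarrow> Z A" by blast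
  \<comment> \<open>The contraction in direction \<open>m\<close>: the value at a vertex without
    \<open>m\<close> is read off from the vertex with \<open>m\<close> added.\<close>
  define b where "b A = (if m \<in> A then 0 else ksign m A * c (insert m A))" for A
  have bsupp: "A \<subseteq> D \<and> Z A \<and> card A + Suc i = card D" if "b A \<noteq> 0" for A
  proof -
    have mA: "m \<notin> A" "c (insert m A) \<noteq> 0" using that unfolding b_def by (auto split: if_splits)
    have s: "insert m A \<subseteq> D" "Z (insert m A)" "card (insert m A) + i = card D"
      using supp[OF mA(2)] by blast+
    have "finite A" using finite_subset[OF _ D, of A] s(1) by simp
    then show ?thesis using s mA m(2)[OF mA(1)] by simp
  qed
  have "(\<Sum>x\<in>A. ksign x A * (if Z (A - {x}) \<and> Z A then b (A - {x}) else 0)) = c A" if A: "A \<subseteq> D" for A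
  proof -
    have finA: "finite A" by (rule finite_subset[OF A D])
    show ?thesis
    proof (cases "Z A")
      case ZA: False
      then have "c A = 0" using supp by blast
      then show ?thesis using ZA by simp
    next
      case ZA: True
      show ?thesis
      proof (cases "m \<in> A")
        case mA: True
        have ZAm: "Z (A - {m})" using m(2)[of "A - {m}"] mA ZA by (simp add: insert_absorb)
        have "(\<Sum>x\<in>A. ksign x A * (if Z (A - {x}) \<and> Z A then b (A - {x}) else 0)) =
            (\<Sum>x\<in>A. if x = m then ksign m A * b (A - {m}) else 0)"
        proof (rule sum.cong[OF refl])
          fix x assume "x \<in> A"
          have "b (A - {x}) = 0" if "x \<noteq> m" using that mA unfolding b_def by simp
          then show "ksign x A * (if Z (A - {x}) \<and> Z A then b (A - {x}) else 0) =
              (if x = m then ksign m A * b (A - {m}) else 0)" using ZA ZAm by simp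
        qed
        also have "\<dots> = ksign m A * b (A - {m})" using finA mA by simp
        also have "\<dots> = (ksign m A * ksign m A) * c A"
          unfolding b_def using mA by (simp add: insert_absorb)
        finally show ?thesis by (simp add: ksign_square)
      next
        case mA: False
        \<comment> \<open>For \<open>m\<close> outside \<open>A\<close> the cycle condition at the
          larger set expresses \<open>c A\<close> by values of \<open>c\<close> at sets containing
          \<open>m\<close>, which are values of \<open>b\<close> up to sign.\<close>
        let ?A = "insert m A"
        have "?A \<subseteq> D" using A m(1) by blast
        from cyc[OF this] have "0 = ksign m A * c A +
            (\<Sum>x\<in>A. ksign x ?A * (if Z (?A - {x}) \<and> Z ?A then c (?A - {x}) else 0))"
          using finA mA ZA m(2)[OF mA] by simp
        also have "(\<Sum>x\<in>A. ksign x ?A * (if Z (?A - {x}) \<and> Z ?A then c (?A - {x}) else 0)) =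
            (\<Sum>x\<in>A. - (ksign m A * (ksign x A * (if Z (A - {x}) \<and> Z A then b (A - {x}) else 0))))"
        proof (rule sum.cong[OF refl])
          fix x assume x: "x \<in> A"
          define A' where "A' = A - {x}"
          have xm: "x \<noteq> m" using x mA by blast
          have A': "A = insert x A'" "finite A'" "x \<notin> A'" "m \<notin> A'" "?A - {x} = insert m A'"
            unfolding A'_def using x mA finA xm by auto
          have "ksign x ?A = (ksign x (insert m A') :: 'k)"
            using ksign_Diff[of x ?A, where 'a = 'k] A'(5) by simp
          moreover have "ksign x A = (ksign x A' :: 'k)" unfolding A'_def by simp
          moreover have "ksign x (insert m A') * ksign m A' = - (ksign m A * ksign x A' :: 'k)"
            using ksign_exchange[OF A'(2) xm A'(3,4), where 'k = 'k] A'(1) by simp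
          then have "ksign x (insert m A') = - (ksign m A * ksign x A' * ksign m A' :: 'k)"
            using ksign_square[of m A', where 'k = 'k]
            by (metis (no_types, lifting) mult.assoc mult.right_neutral mult_minus_left)
          moreover have "b (A - {x}) = ksign m A' * c (insert m A')"
            unfolding b_def A'_def using mA by simp
          moreover have "Z (?A - {x}) \<longleftrightarrow> Z (A - {x})"
            using m(2)[OF A'(4)] A'(5) unfolding A'_def by simp
          ultimately show "ksign x ?A * (if Z (?A - {x}) \<and> Z ?A then c (?A - {x}) else 0) =
              - (ksign m A * (ksign x A * (if Z (A - {x}) \<and> Z A then b (A - {x}) else 0)))"
            using m(2)[OF mA] A'(5) by simp
        qed
        finally have "ksign m A * c A =
            ksign m A * (\<Sum>x\<in>A. ksign x A * (if Z (A - {x}) \<and> Z A then b (A - {x}) else 0))"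
          by (simp add: sum_negf sum_distrib_left)
        moreover have "ksign m A \<noteq> (0 :: 'k)" using ksign_square[of m A, where 'k = 'k] by auto
        ultimately show ?thesis by simp
      qed
    qed
  qed
  \<comment> \<open>Recorded for infinite direct sums, where the chosen \<open>b\<close> must vanish
    in almost all summands.\<close>
  moreover have "(\<forall>A. c A = 0) \<longrightarrow> (\<forall>A. b A = 0)" unfolding b_def by simp
  ultimately show ?thesis using bsupp by (intro exI[of _ b] conjI allI impI) simp_all
next
  case False
  \<comment> \<open>The extreme vertices sit in degrees 0 and \<open>card D\<close>, outside the
    range of \<open>i\<close>.\<close>
  have "c A = 0" for A
  proof (rule ccontr)
    assume "c A \<noteq> 0"
    then have A: "A \<subseteq> D" "Z A" "card A + i = card D" using supp[of A] by simp_all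
    have "(\<forall>A\<subseteq>D. Z A \<longrightarrow> A = D) \<or> (\<forall>A\<subseteq>D. Z A \<longrightarrow> A = {})"
      using Z False by (elim disjE) simp_all
    then have "A = D \<or> A = {}" using A(1,2) by (elim disjE) simp_all
    then show False using A(3) i by (elim disjE) simp_all
  qed
  then show ?thesis by (intro exI[of _ "\<lambda>_. 0"]) simp
qed

section \<open>Exactness for direct sums of block modules\<close>

lemma direct_sum_interval_simps:
  "scl (direct_sum J (\<lambda>j. interval_module (B j))) a f j = a * f j"
  "f \<in> obj (direct_sum J (\<lambda>j. interval_module (B j))) p \<longleftrightarrow>
    (\<forall>j\<in>J. p \<notin> B j \<longrightarrow> f j = 0) \<and> (\<forall>j. j \<notin> J \<longrightarrow> f j = 0) \<and> finite {j. f j \<noteq> 0}"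
  "arr (direct_sum J (\<lambda>j. interval_module (B j))) p q f j =
    (if j \<in> J \<and> p \<in> B j \<and> q \<in> B j then f j else 0)"
  by (auto simp: direct_sum_def interval_module_def)

text \<open>The isomorphism turns a cycle into a family of scalar cycles, one for each block. Chains
  bounding them are chosen independently, and they are zero where the scalar cycle is zero; so only
  finitely many are nonzero and they assemble to an element of the direct sum.\<close>

lemma middle_exact_if_decomposable:
  fixes T :: "nat \<Rightarrow> 'a::linorder set"
    and M :: "(nat \<Rightarrow> 'a, 'k::field, 'v::ab_group_add) persmod" and J :: "'j set"
  assumes pm: "persistence_module (PiE {1..n} T) M"
    and B: "\<forall>j\<in>J. block T {1..n} (B j)"
    and iso: "persmod_iso (PiE {1..n} T) M (direct_sum J (\<lambda>j. interval_module (B j)))"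
    and k: "2 \<le> k"
  shows "middle_exact n T k M"
  unfolding middle_exact_def
proof (intro allI impI, elim conjE)
  fix t t' i
  assume cube: "is_cube n T k t t'" and i: "0 < i" "i < k"
  interpret persistence_module "PiE {1..n} T" M by (rule pm)
  let ?Q = "PiE {1..n} T" and ?N = "direct_sum J (\<lambda>j. interval_module (B j)) :: (nat \<Rightarrow> 'a, 'k, 'j \<Rightarrow> 'k) persmod"
  let ?D = "cube_dirs n t t'" and ?v = "cube_vertex t t'"
  have t: "t \<in> ?Q" "t' \<in> ?Q" "t \<le> t'" and Dk: "card ?D = k"
    using cube unfolding is_cube_def by blast+
  have vin: "?v A \<in> ?Q" for A by (rule cube_vertex_in[OF t(1,2)])
  have vle: "?v (A - X) \<le> ?v A" for A X by (rule cube_vertex_mono[OF t(3)]) blast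
  have finD: "finite ?D" by (simp add: cube_dirs_def)
  from iso obtain \<phi> where bij: "\<forall>p\<in>?Q. bij_betw (\<phi> p) (obj M p) (obj ?N p)"
    and add: "\<forall>p\<in>?Q. \<forall>x\<in>obj M p. \<forall>y\<in>obj M p. \<phi> p (x + y) = \<phi> p x + \<phi> p y"
    and scl: "\<forall>p\<in>?Q. \<forall>x\<in>obj M p. \<forall>c. \<phi> p (scl M c x) = scl ?N c (\<phi> p x)"
    and arr: "\<forall>p\<in>?Q. \<forall>q\<in>?Q. p \<le> q \<longrightarrow> (\<forall>x\<in>obj M p. \<phi> q (arr M p q x) = arr ?N p q (\<phi> p x))"
    unfolding persmod_iso_def by (elim exE conjE)
  have \<phi>_in: "\<phi> p x \<in> obj ?N p" if "p \<in> ?Q" "x \<in> obj M p" for p x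
    using bij_betwE[OF bij[THEN bspec, OF that(1)]] that(2) by blast
  have \<phi>_inj: "x = y" if "p \<in> ?Q" "x \<in> obj M p" "y \<in> obj M p" "\<phi> p x = \<phi> p y" for p x y
    using bij_betw_imp_inj_on[OF bij[THEN bspec, OF that(1)]] that(2-4) by (simp add: inj_on_eq_iff)
  have \<phi>_surj: "\<exists>x\<in>obj M p. \<phi> p x = f" if "p \<in> ?Q" "f \<in> obj ?N p" for p f
    using bij_betw_imp_surj_on[OF bij[THEN bspec, OF that(1)]] that(2) by (metis imageE)
  have \<phi>0: "\<phi> p 0 = 0" if p: "p \<in> ?Q" for p
    using add[THEN bspec, OF p, THEN bspec, OF zero_in[OF p], THEN bspec, OF zero_in[OF p]] by simp
  have \<phi>_sum: "\<phi> p (sum f A) j = (\<Sum>x\<in>A. \<phi> p (f x) j)"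
    if p: "p \<in> ?Q" and f: "\<And>x. x \<in> A \<Longrightarrow> f x \<in> obj M p" and fin: "finite A"
    for p f j and A :: "nat set"
    using fin f
  proof (induction A rule: finite_induct)
    case empty
    then show ?case using \<phi>0[OF p] by simp
  next
    case (insert a A)
    have "\<phi> p (f a + sum f A) = \<phi> p (f a) + \<phi> p (sum f A)"
      using add p insert.prems sum_in[OF p, of A f] by simp
    then show ?case using insert by simp
  qed
  have diff_in': "koszul_diff n M t t' c A \<in> obj M (?v A)"
    if A: "A \<subseteq> ?D" and c: "\<And>A. A \<subseteq> ?D \<Longrightarrow> c A \<in> obj M (?v A)" for A c
  proof -
    have "c (A - {x}) \<in> obj M (?v (A - {x}))" for x by (rule c) (use A in blast)
    then show ?thesis
      unfolding koszul_diff_ksign[OF A]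
      by (intro sum_in[OF vin] scl_in[OF vin] arr_in[OF vin vin vle])
  qed
  have \<phi>_diff: "\<phi> (?v A) (koszul_diff n M t t' c A) j =
      (\<Sum>x\<in>A. ksign x A * (if j \<in> J \<and> ?v (A - {x}) \<in> B j \<and> ?v A \<in> B j
        then \<phi> (?v (A - {x})) (c (A - {x})) j else 0))"
    if A: "A \<subseteq> ?D" and c: "\<And>A. A \<subseteq> ?D \<Longrightarrow> c A \<in> obj M (?v A)" for A c j
  proof -
    have cx: "c (A - {x}) \<in> obj M (?v (A - {x}))" for x by (rule c) (use A in blast)
    have ax: "arr M (?v (A - {x})) (?v A) (c (A - {x})) \<in> obj M (?v A)" for x
      by (rule arr_in[OF vin vin vle cx])
    have finA: "finite A" by (rule finite_subset[OF A finD])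
    show ?thesis
      unfolding koszul_diff_ksign[OF A] \<phi>_sum[OF vin scl_in[OF vin ax] finA]
    proof (rule sum.cong[OF refl])
      fix x
      have "\<phi> (?v A) (scl M (ksign x A) (arr M (?v (A - {x})) (?v A) (c (A - {x})))) =
          scl ?N (ksign x A) (arr ?N (?v (A - {x})) (?v A) (\<phi> (?v (A - {x})) (c (A - {x}))))"
        using scl[THEN bspec, OF vin, THEN bspec, OF ax, rule_format]
          arr[THEN bspec, OF vin, THEN bspec, OF vin, THEN mp, OF vle, THEN bspec, OF cx] by simp
      then show "\<phi> (?v A) (scl M (ksign x A) (arr M (?v (A - {x})) (?v A) (c (A - {x})))) j =
          ksign x A * (if j \<in> J \<and> ?v (A - {x}) \<in> B j \<and> ?v A \<in> B j
            then \<phi> (?v (A - {x})) (c (A - {x})) j else 0)"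
        by (simp add: direct_sum_interval_simps)
    qed
  qed
  have term_in: "c A \<in> obj M (?v A)" if "c \<in> koszul_term n M t t' i" for c A i
    using that[unfolded koszul_term_def, THEN CollectD, rule_format, of A] zero_in[OF vin, of A]
    by (auto split: if_splits)
  have term_0: "c A = 0" if "c \<in> koszul_term n M t t' i" "\<not> (A \<subseteq> ?D \<and> card A + i = k)" for c A i
    using that(1)[unfolded koszul_term_def Dk, THEN CollectD, rule_format, of A] that(2) by auto
  show "koszul_homology_vanishes n M t t' i"
    unfolding koszul_homology_vanishes_def
  proof (intro equalityI subsetI)
    fix d assume "d \<in> koszul_diff n M t t' ` koszul_term n M t t' (Suc i)"
    then obtain b where b: "b \<in> koszul_term n M t t' (Suc i)" "d = koszul_diff n M t t' b" by blast
    have "d \<in> koszul_term n M t t' i"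
      unfolding koszul_term_def Dk
    proof (intro CollectI allI)
      fix A
      show "if A \<subseteq> ?D \<and> card A + i = k then d A \<in> obj M (?v A) else d A = 0"
      proof (cases "A \<subseteq> ?D \<and> card A + i = k")
        case True
        then show ?thesis using diff_in'[of A b] term_in[OF b(1)] b(2) by simp
      next
        case False
        have "d A = 0"
        proof (cases "A \<subseteq> ?D")
          case AD: True
          have finA: "finite A" by (rule finite_subset[OF AD finD])
          have "b (A - {x}) = 0" if x: "x \<in> A" for x
            by (rule term_0[OF b(1)]) (use False AD card_Suc_Diff1[OF finA x] in auto)
          then show ?thesis
            unfolding b(2) koszul_diff_ksign[OF AD] using arr_zero[OF vin vin vle] by simp
        qed (simp add: b(2) koszul_diff_def)
        then show ?thesis using False by auto
      qed
    qed
    moreover have "koszul_diff n M t t' d = (\<lambda>_. 0)"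
      unfolding b(2) by (rule koszul_diff_squared[OF pm t]) (rule term_in[OF b(1)])
    ultimately show "d \<in> {c \<in> koszul_term n M t t' i. koszul_diff n M t t' c = (\<lambda>_. 0)}" by simp
  next
    fix c assume "c \<in> {c \<in> koszul_term n M t t' i. koszul_diff n M t t' c = (\<lambda>_. 0)}"
    then have c: "c \<in> koszul_term n M t t' i" and cyc: "koszul_diff n M t t' c = (\<lambda>_. 0)" by simp_all
    define cj where "cj j A = (if A \<subseteq> ?D then \<phi> (?v A) (c A) j else 0)" for j A
    have cN: "\<phi> (?v A) (c A) \<in> obj ?N (?v A)" for A by (rule \<phi>_in[OF vin term_in[OF c]])
    have ex: "\<exists>b. (\<forall>A. b A \<noteq> 0 \<longrightarrow> A \<subseteq> ?D \<and> ?v A \<in> B j \<and> card A + Suc i = card ?D) \<and>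
        (\<forall>A\<subseteq>?D. (\<Sum>x\<in>A. ksign x A * (if ?v (A - {x}) \<in> B j \<and> ?v A \<in> B j then b (A - {x}) else 0))
          = cj j A) \<and>
        ((\<forall>A. cj j A = 0) \<longrightarrow> (\<forall>A. b A = 0))" if j: "j \<in> J" for j
    proof (rule scalar_koszul_exact[OF finD])
      show "0 < i" "i < card ?D" using i Dk by simp_all
      have "block T {1..n} (B j)" using B j by blast
      from cube_meets_block[OF this t] k Dk
      show "(\<exists>m\<in>?D. \<forall>A. m \<notin> A \<longrightarrow> (?v (insert m A) \<in> B j \<longleftrightarrow> ?v A \<in> B j)) \<or>
          (\<forall>A\<subseteq>?D. ?v A \<in> B j \<longrightarrow> A = ?D) \<or> (\<forall>A\<subseteq>?D. ?v A \<in> B j \<longrightarrow> A = {})" by simp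
      show "A \<subseteq> ?D \<and> ?v A \<in> B j \<and> card A + i = card ?D" if "cj j A \<noteq> 0" for A
      proof -
        have AD: "A \<subseteq> ?D" and nz: "\<phi> (?v A) (c A) j \<noteq> 0" using that unfolding cj_def by (auto split: if_splits)
        have "?v A \<in> B j" using cN[of A] nz j unfolding direct_sum_interval_simps by blast
        moreover have "card A + i = k"
        proof (rule ccontr)
          assume "card A + i \<noteq> k"
          then have "c A = 0" by (intro term_0[OF c]) blast
          then show False using nz \<phi>0[OF vin] by simp
        qed
        ultimately show ?thesis using AD Dk by simp
      qed
      show "(\<Sum>x\<in>A. ksign x A * (if ?v (A - {x}) \<in> B j \<and> ?v A \<in> B j then cj j (A - {x}) else 0)) = 0"
        if A: "A \<subseteq> ?D" for A
      proof -
        have cjx: "cj j (A - {x}) = \<phi> (?v (A - {x})) (c (A - {x})) j" for x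
          unfolding cj_def by (rule if_P) (use A in blast)
        have "(\<Sum>x\<in>A. ksign x A * (if ?v (A - {x}) \<in> B j \<and> ?v A \<in> B j then cj j (A - {x}) else 0)) =
            \<phi> (?v A) (koszul_diff n M t t' c A) j"
          unfolding \<phi>_diff[OF A term_in[OF c]] cjx using j by simp
        then show ?thesis using cyc \<phi>0[OF vin] by simp
      qed
    qed
    then have "\<forall>j\<in>J. \<exists>b. (\<forall>A. b A \<noteq> 0 \<longrightarrow> A \<subseteq> ?D \<and> ?v A \<in> B j \<and> card A + Suc i = card ?D) \<and>
        (\<forall>A\<subseteq>?D. (\<Sum>x\<in>A. ksign x A * (if ?v (A - {x}) \<in> B j \<and> ?v A \<in> B j then b (A - {x}) else 0))
          = cj j A) \<and> ((\<forall>A. cj j A = 0) \<longrightarrow> (\<forall>A. b A = 0))" by (intro ballI)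
    from bchoice[OF this] obtain \<beta> where \<beta>:
      "\<forall>j\<in>J. (\<forall>A. \<beta> j A \<noteq> 0 \<longrightarrow> A \<subseteq> ?D \<and> ?v A \<in> B j \<and> card A + Suc i = card ?D) \<and>
        (\<forall>A\<subseteq>?D. (\<Sum>x\<in>A. ksign x A * (if ?v (A - {x}) \<in> B j \<and> ?v A \<in> B j then \<beta> j (A - {x}) else 0))
          = cj j A) \<and> ((\<forall>A. cj j A = 0) \<longrightarrow> (\<forall>A. \<beta> j A = 0))" ..
    have \<beta>1: "A \<subseteq> ?D \<and> ?v A \<in> B j \<and> card A + Suc i = card ?D" if "j \<in> J" "\<beta> j A \<noteq> 0" for j A
      using \<beta>[THEN bspec, OF that(1)] that(2) by simp
    have \<beta>2: "(\<Sum>x\<in>A. ksign x A * (if ?v (A - {x}) \<in> B j \<and> ?v A \<in> B j then \<beta> j (A - {x}) else 0)) = cj j A"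
      if "j \<in> J" "A \<subseteq> ?D" for j A using \<beta>[THEN bspec, OF that(1)] that(2) by simp
    have \<beta>3: "\<beta> j A = 0" if "j \<in> J" "\<forall>A. cj j A = 0" for j A
      using \<beta>[THEN bspec, OF that(1)] that(2) by simp
    define g where "g A j = (if j \<in> J then \<beta> j A else 0)" for A j
    have "finite (\<Union>A\<in>Pow ?D. {j. \<phi> (?v A) (c A) j \<noteq> 0})"
      using finD cN unfolding direct_sum_interval_simps by blast
    moreover have "{j. g A j \<noteq> 0} \<subseteq> (\<Union>A\<in>Pow ?D. {j. \<phi> (?v A) (c A) j \<noteq> 0})" for A
    proof
      fix j assume "j \<in> {j. g A j \<noteq> 0}"
      then have j: "j \<in> J" "\<beta> j A \<noteq> 0" unfolding g_def by (auto split: if_splits)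
      then obtain A' where "cj j A' \<noteq> 0" using \<beta>3 by blast
      then have "A' \<subseteq> ?D" "\<phi> (?v A') (c A') j \<noteq> 0" unfolding cj_def by (auto split: if_splits)
      then show "j \<in> (\<Union>A\<in>Pow ?D. {j. \<phi> (?v A) (c A) j \<noteq> 0})" by blast
    qed
    ultimately have "finite {j. g A j \<noteq> 0}" for A using finite_subset by blast
    moreover have "g A j = 0" if "j \<in> J" "?v A \<notin> B j" for A j
      using \<beta>1[OF that(1), of A] that unfolding g_def by auto
    moreover have "g A j = 0" if "j \<notin> J" for A j using that unfolding g_def by simp
    ultimately have gN: "g A \<in> obj ?N (?v A)" for A
      unfolding direct_sum_interval_simps by blast
    have "\<forall>A. \<exists>x. x \<in> obj M (?v A) \<and> \<phi> (?v A) x = g A" using \<phi>_surj[OF vin gN] by blast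
    from choice[OF this] obtain h where h: "\<forall>A. h A \<in> obj M (?v A) \<and> \<phi> (?v A) (h A) = g A" ..
    define b where "b A = (if A \<subseteq> ?D \<and> card A + Suc i = k then h A else 0)" for A
    have b_term: "b \<in> koszul_term n M t t' (Suc i)"
      unfolding koszul_term_def Dk b_def using h by auto
    have \<phi>b: "\<phi> (?v A) (b A) = g A" for A
    proof (cases "A \<subseteq> ?D \<and> card A + Suc i = k")
      case True
      then show ?thesis using h unfolding b_def by simp
    next
      case False
      have "g A j = 0" for j
        using \<beta>1[of j A] False Dk unfolding g_def by auto
      then have "g A = 0" by (intro ext) simp
      then show ?thesis using False \<phi>0[OF vin] unfolding b_def by auto
    qed
    have "koszul_diff n M t t' b A = c A" for A
    proof (cases "A \<subseteq> ?D")
      case True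
      have "\<phi> (?v A) (koszul_diff n M t t' b A) j = \<phi> (?v A) (c A) j" for j
      proof (cases "j \<in> J")
        case j: True
        have gj: "g A j = \<beta> j A" for A unfolding g_def using j by simp
        have "\<phi> (?v A) (koszul_diff n M t t' b A) j = cj j A"
          unfolding \<phi>_diff[OF True term_in[OF b_term]] \<phi>b gj \<beta>2[OF j True, symmetric]
          using j by simp
        then show ?thesis unfolding cj_def using True by simp
      next
        case j: False
        have "\<phi> (?v A) (koszul_diff n M t t' b A) \<in> obj ?N (?v A)"
          by (rule \<phi>_in[OF vin diff_in'[OF True term_in[OF b_term]]])
        then show ?thesis using cN[of A] j unfolding direct_sum_interval_simps by simp
      qed
      then have "\<phi> (?v A) (koszul_diff n M t t' b A) = \<phi> (?v A) (c A)" by (rule ext)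
      then show ?thesis by (rule \<phi>_inj[OF vin diff_in'[OF True term_in[OF b_term]] term_in[OF c]])
    next
      case False
      then have "c A = 0" by (intro term_0[OF c]) blast
      then show ?thesis using False by (simp add: koszul_diff_def)
    qed
    then have "c = koszul_diff n M t t' b" by (intro ext) simp
    then show "c \<in> koszul_diff n M t t' ` koszul_term n M t t' (Suc i)" using b_term by blast
  qed
qed

section \<open>Decomposition of middle exact modules\<close>

text \<open>Identifies the image of \<open>e\<close> with the interval module on \<open>B\<close>,
  the vector \<open>\<xi> q\<close> corresponding to 1.\<close>

definition block_basis :: "'p::order set \<Rightarrow> ('p, 'k::field, 'v::ab_group_add) persmod \<Rightarrow>
    ('p \<Rightarrow> 'v \<Rightarrow> 'v) \<Rightarrow> 'p set \<Rightarrow> ('p \<Rightarrow> 'v) \<Rightarrow> bool" where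
  "block_basis Q M e B \<xi> \<longleftrightarrow> B \<subseteq> Q \<and>
    (\<forall>q\<in>B. \<xi> q \<in> obj M q \<and> e q (\<xi> q) = \<xi> q \<and> \<xi> q \<noteq> 0) \<and>
    (\<forall>q\<in>B. \<forall>x\<in>obj M q. \<exists>c. e q x = scl M c (\<xi> q)) \<and>
    (\<forall>q\<in>Q - B. \<forall>x\<in>obj M q. e q x = 0) \<and>
    (\<forall>p\<in>B. \<forall>q\<in>B. p \<le> q \<longrightarrow> arr M p q (\<xi> p) = \<xi> q)"

lemma indecomposable_summand_structure:
  fixes T :: "nat \<Rightarrow> 'a::linorder set"
    and M :: "(nat \<Rightarrow> 'a, 'k::field, 'v::ab_group_add) persmod"
  assumes n: "2 \<le> n" and pm: "persistence_module (PiE {1..n} T) M" and pfd: "pfd (PiE {1..n} T) M"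
    and lift: "kernels_lift {1..n} T M" and embed: "cokernels_embed {1..n} T M"
    and e: "endo (PiE {1..n} T) M e" "idem (PiE {1..n} T) M e"
    and ind: "indecomposable (PiE {1..n} T) (image_mod M e)"
    and nz: "\<exists>p\<in>PiE {1..n} T. \<exists>x\<in>obj M p. e p x \<noteq> 0"
  shows "\<exists>B p0 \<xi>. block T {1..n} B \<and> p0 \<in> B \<and> block_basis (PiE {1..n} T) M e B \<xi>"
proof -
  interpret persistence_module "PiE {1..n} T" M by (rule pm)
  obtain p0 x where p0: "p0 \<in> PiE {1..n} T" "x \<in> obj M p0" "e p0 x \<noteq> 0" using nz by blast
  let ?N = "image_mod M e"
  interpret N: persistence_module "PiE {1..n} T" ?N by (rule persistence_module_image[OF e(1)])
  interpret N: indecomposable_module "{1..n}" T ?N p0 "e p0 x"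
  proof unfold_locales
    show "pfd (PiE {1..n} T) ?N" by (rule pfd_image[OF e(1) pfd])
    show "kernels_lift {1..n} T ?N" by (rule kernels_lift_image[OF pm lift e])
    show "cokernels_embed {1..n} T ?N" by (rule cokernels_embed_image[OF pm embed e])
    show "indecomposable (PiE {1..n} T) ?N" by (rule ind)
  qed (use p0 in auto)
  have supp: "q \<in> N.supp \<longleftrightarrow> q \<in> PiE {1..n} T \<and> (\<exists>x\<in>obj M q. e q x \<noteq> 0)" for q
    unfolding N.supp_def by auto
  have suppQ: "N.supp \<subseteq> PiE {1..n} T" using supp by blast
  obtain \<xi> where \<xi>: "\<And>q. q \<in> N.supp \<Longrightarrow> \<xi> q \<in> obj ?N q" "\<And>q. q \<in> N.supp \<Longrightarrow> \<xi> q \<noteq> 0"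
    "\<And>p q. p \<in> N.supp \<Longrightarrow> q \<in> N.supp \<Longrightarrow> p \<le> q \<Longrightarrow> arr ?N p q (\<xi> p) = \<xi> q" "\<xi> p0 \<noteq> 0"
    by (rule N.supp_basis) (rule that)
  show ?thesis
    unfolding block_basis_def
  proof (intro exI[of _ N.supp] exI[of _ p0] exI[of _ \<xi>] conjI ballI impI)
    show "block T {1..n} N.supp" by (rule N.supp_block) (use n in simp)
    show "p0 \<in> N.supp" by (rule N.p0_supp)
    show "N.supp \<subseteq> PiE {1..n} T" by (rule suppQ)
  next
    fix q assume q: "q \<in> N.supp"
    have qQ: "q \<in> PiE {1..n} T" using suppQ q by blast
    obtain z where z: "z \<in> obj M q" "\<xi> q = e q z" using \<xi>(1)[OF q] by auto
    show "\<xi> q \<in> obj M q" "e q (\<xi> q) = \<xi> q"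
      using z endo_in[OF e(1) qQ z(1)] e(2) qQ unfolding idem_def by simp_all
    show "\<xi> q \<noteq> 0" by (rule \<xi>(2)[OF q])
    fix x assume "x \<in> obj M q"
    then show "\<exists>c. e q x = scl M c (\<xi> q)"
      using N.supp_span[OF q \<xi>(1)[OF q] \<xi>(2)[OF q], of "e q x"] by simp
  next
    fix q x assume "q \<in> PiE {1..n} T - N.supp" "x \<in> obj M q"
    then show "e q x = 0" using supp by blast
  next
    fix p q assume "p \<in> N.supp" "q \<in> N.supp" "p \<le> q"
    then show "arr M p q (\<xi> p) = \<xi> q" using \<xi>(3)[of p q] by simp
  qed
qed

text \<open>The isomorphism takes a vector to its coordinates with respect to the vectors
  \<open>\<xi> e p\<close>. A summand is indexed by a point of its block together with the basis
  vector there, as the index type in \<open>block_decomposable\<close> prescribes.\<close>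

lemma decomposable_if_kernels_lift:
  fixes T :: "nat \<Rightarrow> 'a::linorder set"
    and M :: "(nat \<Rightarrow> 'a, 'k::field, 'v::ab_group_add) persmod"
  assumes n: "2 \<le> n" and pm: "persistence_module (PiE {1..n} T) M" and pfd: "pfd (PiE {1..n} T) M"
    and lift: "kernels_lift {1..n} T M" and embed: "cokernels_embed {1..n} T M"
  shows "block_decomposable n T M"
proof -
  let ?Q = "PiE {1..n} T"
  interpret persistence_module ?Q M by (rule pm)
  obtain E where E: "\<And>e. e \<in> E \<Longrightarrow> endo ?Q M e" "\<And>e. e \<in> E \<Longrightarrow> idem ?Q M e"
    "\<And>e. e \<in> E \<Longrightarrow> indecomposable ?Q (image_mod M e)"
    "\<And>e. e \<in> E \<Longrightarrow> \<exists>p\<in>?Q. \<exists>x\<in>obj M p. e p x \<noteq> 0"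
    "\<And>e f p x. e \<in> E \<Longrightarrow> f \<in> E \<Longrightarrow> e \<noteq> f \<Longrightarrow> p \<in> ?Q \<Longrightarrow> x \<in> obj M p \<Longrightarrow> e p (f p x) = 0"
    "\<And>p. p \<in> ?Q \<Longrightarrow> \<exists>S\<subseteq>E. finite S \<and> (\<forall>x\<in>obj M p. x = (\<Sum>e\<in>S. e p x))"
    by (rule decomposition_into_indecomposables[OF pfd]) (rule that)
  have "\<forall>e\<in>E. \<exists>B p0 \<xi>. block T {1..n} B \<and> p0 \<in> B \<and> block_basis ?Q M e B \<xi>"
  proof
    fix e assume e: "e \<in> E"
    show "\<exists>B p0 \<xi>. block T {1..n} B \<and> p0 \<in> B \<and> block_basis ?Q M e B \<xi>"
      by (rule indecomposable_summand_structure[OF n pm pfd lift embed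
            E(1)[OF e] E(2)[OF e] E(3)[OF e] E(4)[OF e]])
  qed
  from bchoice[OF this] obtain S where
    "\<forall>e\<in>E. \<exists>p0 \<xi>. block T {1..n} (S e) \<and> p0 \<in> S e \<and> block_basis ?Q M e (S e) \<xi>" ..
  from bchoice[OF this] obtain P0 where
    "\<forall>e\<in>E. \<exists>\<xi>. block T {1..n} (S e) \<and> P0 e \<in> S e \<and> block_basis ?Q M e (S e) \<xi>" ..
  from bchoice[OF this] obtain \<xi> where st:
    "\<forall>e\<in>E. block T {1..n} (S e) \<and> P0 e \<in> S e \<and> block_basis ?Q M e (S e) (\<xi> e)" ..
  have bl: "block T {1..n} (S e)" and P0: "P0 e \<in> S e" if "e \<in> E" for e
    using st[THEN bspec, OF that] by simp_all
  have bb: "block_basis ?Q M e (S e) (\<xi> e)" if "e \<in> E" for e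
    using st[THEN bspec, OF that] by simp
  note bbD = bb[unfolded block_basis_def]
  have SQ: "S e \<subseteq> ?Q" if "e \<in> E" for e using bbD[OF that] by simp
  have \<xi>: "\<xi> e q \<in> obj M q" "e q (\<xi> e q) = \<xi> e q" "\<xi> e q \<noteq> 0" if "e \<in> E" "q \<in> S e" for e q
    using bbD[OF that(1)] that(2) by simp_all
  have span: "\<exists>c. e q x = scl M c (\<xi> e q)" if "e \<in> E" "q \<in> S e" "x \<in> obj M q" for e q x
    using bbD[OF that(1)] that(2,3) by simp
  have off: "e q x = 0" if "e \<in> E" "q \<in> ?Q" "q \<notin> S e" "x \<in> obj M q" for e q x
    using bbD[OF that(1)] that(2-4) by simp
  have arr\<xi>: "arr M p q (\<xi> e p) = \<xi> e q" if "e \<in> E" "p \<in> S e" "q \<in> S e" "p \<le> q" for e p q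
    using bbD[OF that(1)] that(2-4) by simp
  \<comment> \<open>The coordinate of \<open>e q x\<close>. Its value 0 off the block matches the
    zero spaces of the interval module.\<close>
  define K where "K e q x = (if q \<in> S e then SOME c. e q x = scl M c (\<xi> e q) else 0)" for e q x
  have K: "e q x = scl M (K e q x) (\<xi> e q)" if "e \<in> E" "q \<in> S e" "x \<in> obj M q" for e q x
    using someI_ex[OF span[OF that]] that(2) unfolding K_def by simp
  have K0: "K e q x = 0" if "q \<notin> S e" for e q x using that unfolding K_def by simp
  have K_eqI: "K e q x = c" if "e \<in> E" "q \<in> S e" "x \<in> obj M q" "e q x = scl M c (\<xi> e q)" for e q x c
    using K[OF that(1-3)] that(4) \<xi>(3)[OF that(1,2)] by simp
  have eq_if_K: "e q x = e q y"
    if "e \<in> E" "q \<in> ?Q" "x \<in> obj M q" "y \<in> obj M q" "K e q x = K e q y" for e q x y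
    using that K[OF that(1) _ that(3)] K[OF that(1) _ that(4)] off[OF that(1,2)]
    by (cases "q \<in> S e") auto
  \<comment> \<open>Distinct summands receive distinct indices, because a vector fixed by two
    orthogonal idempotents is 0.\<close>
  define idx where "idx e = (P0 e, \<xi> e (P0 e))" for e
  have inj: "inj_on idx E"
  proof (rule inj_onI, rule ccontr)
    fix e f assume e: "e \<in> E" and f: "f \<in> E" and eq: "idx e = idx f" and ne: "e \<noteq> f"
    have P: "P0 f = P0 e" "\<xi> f (P0 e) = \<xi> e (P0 e)" using eq unfolding idx_def by auto
    have Pf: "P0 e \<in> S f" using P0[OF f] P(1) by simp
    have "\<xi> e (P0 e) = e (P0 e) (f (P0 e) (\<xi> e (P0 e)))"
      using \<xi>(2)[OF e P0[OF e]] \<xi>(2)[OF f Pf] P(2) by simp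
    also have "\<dots> = 0" by (rule E(5)[OF e f ne]) (use SQ[OF e] P0[OF e] \<xi>(1)[OF e P0[OF e]] in auto)
    finally show False using \<xi>(3)[OF e P0[OF e]] by simp
  qed
  define J where "J = idx ` E"
  define B where "B j = S (inv_into E idx j)" for j
  define \<phi> where "\<phi> p x j = (if j \<in> J then K (inv_into E idx j) p x else 0)" for p x j
  have invE: "inv_into E idx j \<in> E" if "j \<in> J" for j
    using that unfolding J_def by (rule inv_into_into)
  have inv: "inv_into E idx (idx e) = e" if "e \<in> E" for e by (rule inv_into_f_f[OF inj that])
  have idxJ: "idx e \<in> J" if "e \<in> E" for e using that unfolding J_def by blast
  have \<phi>_idx: "\<phi> p x (idx e) = K e p x" if "e \<in> E" for p x e
    unfolding \<phi>_def using idxJ[OF that] inv[OF that] by simp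
  let ?N = "direct_sum J (\<lambda>j. interval_module (B j)) :: (nat \<Rightarrow> 'a, 'k, (nat \<Rightarrow> 'a) \<times> 'v \<Rightarrow> 'k) persmod"
  have "persmod_iso ?Q M ?N"
    unfolding persmod_iso_def
  proof (intro exI[of _ \<phi>] conjI ballI impI allI)
    fix p assume p: "p \<in> ?Q"
    obtain R where R: "R \<subseteq> E" "finite R" "\<forall>x\<in>obj M p. x = (\<Sum>e\<in>R. e p x)" using E(6)[OF p] by blast
    \<comment> \<open>Only the finitely many summands in \<open>R\<close> are nonzero at
      \<open>p\<close>: apply \<open>e\<close> to the decomposition of \<open>x\<close> and use
      orthogonality.\<close>
    have eR: "e p x = 0" if e: "e \<in> E" "e \<notin> R" and x: "x \<in> obj M p" for e x
    proof -
      have fx: "f p x \<in> obj M p" if "f \<in> R" for f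
        using endo_in[OF E(1) p x] that R(1) by blast
      have "e p x = e p (\<Sum>f\<in>R. f p x)" using R(3) x by simp
      also have "\<dots> = (\<Sum>f\<in>R. e p (f p x))" by (rule endo_sum[OF E(1)[OF e(1)] p fx])
      also have "\<dots> = 0" by (rule sum.neutral) (use E(5)[OF e(1) _ _ p x] R(1) e(2) in blast)
      finally show ?thesis .
    qed
    show "bij_betw (\<phi> p) (obj M p) (obj ?N p)"
      unfolding bij_betw_def
    proof
      show "inj_on (\<phi> p) (obj M p)"
      proof (rule inj_onI)
        fix x y assume x: "x \<in> obj M p" and y: "y \<in> obj M p" and eq: "\<phi> p x = \<phi> p y"
        have "e p x = e p y" if e: "e \<in> R" for e
        proof -
          have "e \<in> E" using e R(1) by blast
          then show ?thesis
            using eq_if_K[OF _ p x y] \<phi>_idx[of e p x] \<phi>_idx[of e p y] eq by simp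
        qed
        then have "(\<Sum>e\<in>R. e p x) = (\<Sum>e\<in>R. e p y)" by (rule sum.cong[OF refl])
        then show "x = y" using R(3) x y by metis
      qed
      show "\<phi> p ` obj M p = obj ?N p"
      proof (intro equalityI subsetI)
        fix f assume "f \<in> \<phi> p ` obj M p"
        then obtain x where x: "x \<in> obj M p" "f = \<phi> p x" by blast
        have "{j. \<phi> p x j \<noteq> 0} \<subseteq> idx ` R"
        proof
          fix j assume "j \<in> {j. \<phi> p x j \<noteq> 0}"
          then have j: "j \<in> J" "K (inv_into E idx j) p x \<noteq> 0" unfolding \<phi>_def by (auto split: if_splits)
          let ?e = "inv_into E idx j"
          have e: "?e \<in> E" by (rule invE[OF j(1)])
          have pS: "p \<in> S ?e" using j(2) K0 by blast
          have "?e p x \<noteq> 0" using K[OF e pS x(1)] j(2) \<xi>(3)[OF e pS] by simp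
          then have "?e \<in> R" using eR[OF e _ x(1)] by blast
          moreover have "j = idx ?e" using j(1) unfolding J_def by (simp add: f_inv_into_f)
          ultimately show "j \<in> idx ` R" by blast
        qed
        then have "finite {j. \<phi> p x j \<noteq> 0}" using R(2) finite_subset by blast
        then show "f \<in> obj ?N p"
          unfolding direct_sum_interval_simps x(2) using K0 by (auto simp: \<phi>_def B_def)
      next
        fix f assume "f \<in> obj ?N p"
        then have f1: "\<forall>j\<in>J. p \<notin> B j \<longrightarrow> f j = 0" and f2: "\<forall>j. j \<notin> J \<longrightarrow> f j = 0"
          and f3: "finite {j. f j \<noteq> 0}" unfolding direct_sum_interval_simps by blast+
        define X where "X = {e \<in> E. f (idx e) \<noteq> 0}"
        have "idx ` X \<subseteq> {j. f j \<noteq> 0}" unfolding X_def by blast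
        then have "finite (idx ` X)" using f3 finite_subset by blast
        moreover have "inj_on idx X" using inj unfolding X_def by (rule inj_on_subset) blast
        ultimately have finX: "finite X" by (rule finite_imageD)
        have XE: "e \<in> E" if "e \<in> X" for e using that unfolding X_def by blast
        have XS: "p \<in> S e" if e: "e \<in> X" for e
        proof (rule ccontr)
          assume "p \<notin> S e"
          then have "p \<notin> B (idx e)" unfolding B_def using inv[OF XE[OF e]] by simp
          then have "f (idx e) = 0" using f1 idxJ[OF XE[OF e]] by blast
          then show False using e unfolding X_def by simp
        qed
        define x where "x = (\<Sum>e\<in>X. scl M (f (idx e)) (\<xi> e p))"
        have xi: "scl M (f (idx e)) (\<xi> e p) \<in> obj M p" if "e \<in> X" for e
          by (rule scl_in[OF p \<xi>(1)[OF XE[OF that] XS[OF that]]])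
        have x: "x \<in> obj M p" unfolding x_def by (rule sum_in[OF p xi])
        have ex: "e p x = (if e \<in> X then scl M (f (idx e)) (\<xi> e p) else 0)" if e: "e \<in> E" for e
        proof -
          have "e p (scl M (f (idx e')) (\<xi> e' p)) = (if e' = e then scl M (f (idx e)) (\<xi> e p) else 0)"
            if e': "e' \<in> X" for e'
          proof -
            have "e p (scl M (f (idx e')) (\<xi> e' p)) = scl M (f (idx e')) (e p (\<xi> e' p))"
              by (rule endo_scl[OF E(1)[OF e] p \<xi>(1)[OF XE[OF e'] XS[OF e']]])
            moreover have "e p (\<xi> e' p) = 0" if "e' \<noteq> e"
              using E(5)[OF e XE[OF e'] _ p \<xi>(1)[OF XE[OF e'] XS[OF e']]] that
                \<xi>(2)[OF XE[OF e'] XS[OF e']] by auto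
            ultimately show ?thesis using \<xi>(2)[OF XE[OF e'] XS[OF e']] by auto
          qed
          then have "(\<Sum>e'\<in>X. e p (scl M (f (idx e')) (\<xi> e' p))) =
              (\<Sum>e'\<in>X. if e' = e then scl M (f (idx e)) (\<xi> e p) else 0)"
            by (rule sum.cong[OF refl])
          moreover have "e p x = (\<Sum>e'\<in>X. e p (scl M (f (idx e')) (\<xi> e' p)))"
            unfolding x_def by (rule endo_sum[OF E(1)[OF e] p xi])
          ultimately have "e p x = (\<Sum>e'\<in>X. if e' = e then scl M (f (idx e)) (\<xi> e p) else 0)"
            by simp
          then show ?thesis using finX by simp
        qed
        have "\<phi> p x j = f j" for j
        proof (cases "j \<in> J")
          case True
          then obtain e where e: "e \<in> E" "j = idx e" unfolding J_def by blast
          have "K e p x = f (idx e)"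
          proof (cases "e \<in> X")
            case True
            then show ?thesis using K_eqI[OF e(1) XS[OF True] x] ex[OF e(1)] by simp
          next
            case False
            then have "f (idx e) = 0" using e(1) unfolding X_def by simp
            moreover have "K e p x = 0"
            proof (cases "p \<in> S e")
              case True
              then show ?thesis using K_eqI[OF e(1) True x, of 0] ex[OF e(1)] False by simp
            qed (rule K0)
            ultimately show ?thesis by simp
          qed
          then show ?thesis using \<phi>_idx[OF e(1)] e(2) by simp
        next
          case False
          then have "f j = 0" using f2 by blast
          then show ?thesis using False unfolding \<phi>_def by simp
        qed
        then have "\<phi> p x = f" by (rule ext)
        then show "f \<in> \<phi> p ` obj M p" using x by blast
      qed
    qed
    fix x assume x: "x \<in> obj M p"
    show "\<phi> p (x + y) = \<phi> p x + \<phi> p y" if y: "y \<in> obj M p" for y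
    proof (rule ext)
      fix j
      have "K e p (x + y) = K e p x + K e p y" if e: "e \<in> E" for e
      proof (cases "p \<in> S e")
        case True
        show ?thesis
          by (rule K_eqI[OF e True add_in[OF p x y]])
            (simp add: endo_add[OF E(1)[OF e] p x y] K[OF e True x] K[OF e True y] scale_left_distrib)
      qed (simp add: K0)
      then show "\<phi> p (x + y) j = (\<phi> p x + \<phi> p y) j" unfolding \<phi>_def using invE by simp
    qed
    show "\<phi> p (scl M c x) = scl ?N c (\<phi> p x)" for c
    proof (rule ext)
      fix j
      have "K e p (scl M c x) = c * K e p x" if e: "e \<in> E" for e
      proof (cases "p \<in> S e")
        case True
        show ?thesis
          by (rule K_eqI[OF e True scl_in[OF p x]])
            (simp add: endo_scl[OF E(1)[OF e] p x] K[OF e True x])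
      qed (simp add: K0)
      then show "\<phi> p (scl M c x) j = scl ?N c (\<phi> p x) j"
        unfolding direct_sum_interval_simps \<phi>_def using invE by simp
    qed
    fix q assume q: "q \<in> ?Q" "p \<le> q"
    show "\<phi> q (arr M p q x) = arr ?N p q (\<phi> p x)"
    proof (rule ext)
      fix j
      have ax: "arr M p q x \<in> obj M q" by (rule arr_in[OF p q x])
      have "K e q (arr M p q x) = (if p \<in> S e \<and> q \<in> S e then K e p x else 0)" if e: "e \<in> E" for e
      proof (cases "q \<in> S e")
        case qS: True
        have ea: "e q (arr M p q x) = arr M p q (e p x)" by (rule endo_arr[OF E(1)[OF e] p q x])
        show ?thesis
        proof (cases "p \<in> S e")
          case pS: True
          have "e q (arr M p q x) = scl M (K e p x) (\<xi> e q)"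
            unfolding ea K[OF e pS x] arr_scl[OF p q \<xi>(1)[OF e pS]] arr\<xi>[OF e pS qS q(2)] ..
          then show ?thesis using K_eqI[OF e qS ax] pS qS by simp
        next
          case pS: False
          have "e q (arr M p q x) = scl M 0 (\<xi> e q)"
            unfolding ea off[OF e p pS x] using arr_zero[OF p q] by simp
          then show ?thesis using K_eqI[OF e qS ax] pS by simp
        qed
      qed (simp add: K0)
      then show "\<phi> q (arr M p q x) j = arr ?N p q (\<phi> p x) j"
        unfolding direct_sum_interval_simps \<phi>_def B_def using invE by simp
    qed
  qed
  moreover have "\<forall>j\<in>J. block T {1..n} (B j)" unfolding B_def using bl invE by blast
  ultimately show ?thesis unfolding block_decomposable_def by blast
qed

theorem theorem14:
  fixes n :: nat
    and T :: "nat \<Rightarrow> 'a::linorder set"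
    and M :: "(nat \<Rightarrow> 'a, 'k::field, 'v::ab_group_add) persmod"
  assumes "n \<ge> 2"
    and "persistence_module (PiE {1..n} T) M"
    and "pointwise_finite_dimensional (PiE {1..n} T) M"
  shows "block_decomposable n T M \<longleftrightarrow> (\<forall>k. 2 \<le> k \<and> k \<le> n \<longrightarrow> middle_exact n T k M)"
proof
  assume "block_decomposable n T M"
  then show "\<forall>k. 2 \<le> k \<and> k \<le> n \<longrightarrow> middle_exact n T k M"
    unfolding block_decomposable_def using middle_exact_if_decomposable[OF assms(2)] by blast
next
  assume ex: "\<forall>k. 2 \<le> k \<and> k \<le> n \<longrightarrow> middle_exact n T k M"
  interpret persistence_module "PiE {1..n} T" M by (rule assms(2))
  have "pfd (PiE {1..n} T) M"
    unfolding pfd_def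
  proof
    fix q assume "q \<in> PiE {1..n} T"
    then obtain S where "finite S" "span S = obj M q"
      using assms(3) unfolding pointwise_finite_dimensional_def by blast
    then show "fin_dim (obj M q)" unfolding fin_dim_def by (intro exI[of _ S]) simp
  qed
  then show "block_decomposable n T M"
    by (rule decomposable_if_kernels_lift[OF assms(1,2) _
        kernels_lift_if_middle_exact[OF assms(2) ex] cokernels_embed_if_middle_exact[OF assms(2) ex]])
qed

end
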